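(* Let $X$ be a locally convex space belonging to the class $\mathfrak M$. Then there exists $T\in L(X)$ such that $T$ is hypercyclic and non-mixing.
   Context: Conventions: $\mathbb K$ is $\mathbb R$ or $\mathbb C$; all vector spaces are non-zero and over $\mathbb K$; all topological spaces are Hausdorff; $\mathbb Z_+=\{0,1,2,\dots\}$. $L(X)$ is the space of continuous linear operators on $X$. The topology of a locally convex space $X$ is called weak if it coincides with $\sigma(X,Y)$ (the weakest topology making all functionals in $Y$ continuous) for some linear space $Y$ of linear functionals on $X$ separating points of $X$. A sequence $\{x_n\}_{n\in\mathbb Z_+}$ in a topological vector space $X$ is an $\ell_1$-sequence if $x_n\to0$ in $X$ and $\sum_{n=0}^\infty a_nx_n$ converges in $X$ for each $a\in\ell_1$. A locally convex space $X$ belongs to the class $\mathfrak M$ if its topology is not weak and there exists an $\ell_1$-sequence in $X$ with dense linear span. $T\in L(X)$ is hypercyclic if there is $x\in X$ such that $\{T^nx:n\in\mathbb Z_+\}$ is dense in $X$. $T$ is mixing if for any non-empty open $U,V\subseteq X$ there is $r>0$ such that $T^n(U)\cap V\neq\varnothing$ for all integers $n>r$; non-mixing means not mixing. *)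

theory Defs
  imports "HOL-Analysis.Analysis"
begin

text \<open>
  The scalar multiplication \<open>smul\<close> over the field \<open>'k\<close> (intended: \<open>real\<close> or \<open>complex\<close>) is a
  parameter, since a type carries only one built-in \<open>scaleR\<close>.  The real structure underlying
  the space is that of the type class, so that \<open>convex\<close> is the library notion; \<open>smul_of_real\<close>
  says that the two agree.  Continuity of addition and the Hausdorff property are part of the
  sort of \<open>'a\<close>.
\<close>

locale hausdorff_lcs = vector_space smul
  for smul :: "'k::real_normed_field \<Rightarrow>
    'a::{real_vector, topological_ab_group_add, t2_space} \<Rightarrow> 'a" +
  assumes smul_of_real: "smul (of_real r) x = r *\<^sub>R x"
    and continuous_smul: "continuous_on UNIV (\<lambda>(c, x). smul c x)"
    and locally_convex: "locally convex (UNIV :: 'a set)"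
    and nonzero: "\<exists>x::'a. x \<noteq> 0"

definition continuous_linear_operators ::
  "('k::real_normed_field \<Rightarrow> 'a::{ab_group_add, topological_space} \<Rightarrow> 'a) \<Rightarrow> ('a \<Rightarrow> 'a) set"
  where "continuous_linear_operators smul =
    {T. Vector_Spaces.linear smul smul T \<and> continuous_on UNIV T}"

definition separating_functional_space ::
  "('k::real_normed_field \<Rightarrow> 'a::ab_group_add \<Rightarrow> 'a) \<Rightarrow> ('a \<Rightarrow> 'k) set \<Rightarrow> bool"
  where "separating_functional_space smul Y \<longleftrightarrow>
    (\<forall>f\<in>Y. Vector_Spaces.linear smul (*) f) \<and>
    (\<lambda>x. 0) \<in> Y \<and>
    (\<forall>f\<in>Y. \<forall>g\<in>Y. (\<lambda>x. f x + g x) \<in> Y) \<and>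
    (\<forall>c. \<forall>f\<in>Y. (\<lambda>x. c * f x) \<in> Y) \<and>
    (\<forall>x y. x \<noteq> y \<longrightarrow> (\<exists>f\<in>Y. f x \<noteq> f y))"

text \<open>The open sets of \<open>\<sigma>(X,Y)\<close>; \<open>generate_topology\<close> yields the coarsest topology containing
  the given sets.\<close>

definition sigma_open :: "('a \<Rightarrow> 'k::topological_space) set \<Rightarrow> 'a set \<Rightarrow> bool"
  where "sigma_open Y = generate_topology {f -` U |f U. f \<in> Y \<and> open U}"

definition weak_topology ::
  "('k::real_normed_field \<Rightarrow> 'a::{ab_group_add, topological_space} \<Rightarrow> 'a) \<Rightarrow> bool"
  where "weak_topology smul \<longleftrightarrow>
    (\<exists>Y. separating_functional_space smul Y \<and> (\<forall>S. open S \<longleftrightarrow> sigma_open Y S))"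

definition l1_sequence ::
  "('k::real_normed_field \<Rightarrow> 'a::{ab_group_add, topological_space} \<Rightarrow> 'a) \<Rightarrow> (nat \<Rightarrow> 'a) \<Rightarrow> bool"
  where "l1_sequence smul x \<longleftrightarrow>
    x \<longlonglongrightarrow> 0 \<and>
    (\<forall>a. summable (\<lambda>n. norm (a n)) \<longrightarrow> summable (\<lambda>n. smul (a n) (x n)))"

definition class_M ::
  "('k::real_normed_field \<Rightarrow> 'a::{real_vector, topological_ab_group_add, t2_space} \<Rightarrow> 'a) \<Rightarrow> bool"
  where "class_M smul \<longleftrightarrow>
    hausdorff_lcs smul \<and>
    \<not> weak_topology smul \<and>
    (\<exists>x. l1_sequence smul x \<and> closure (module.span smul (range x)) = UNIV)"

definition hypercyclic :: "('a::topological_space \<Rightarrow> 'a) \<Rightarrow> bool"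
  where "hypercyclic T \<longleftrightarrow> (\<exists>x. closure (range (\<lambda>n. (T ^^ n) x)) = UNIV)"

definition mixing :: "('a::topological_space \<Rightarrow> 'a) \<Rightarrow> bool"
  where "mixing T \<longleftrightarrow>
    (\<forall>U V. open U \<and> U \<noteq> {} \<and> open V \<and> V \<noteq> {} \<longrightarrow>
      (\<exists>r>0. \<forall>n>r. (T ^^ n) ` U \<inter> V \<noteq> {}))"

end

theory Submission
  imports Defs
begin

text \<open>
  Since the topology is not weak, some continuous seminorm \<open>p\<close> has an infinite-dimensional quotient.
  Gram--Schmidt with respect to \<open>p\<close> turns the given \<open>\<ell>\<^sub>1\<close>-sequence into a biorthogonal system
  \<open>(x\<^sub>j, f\<^sub>j)\<close>, indexed by the integers, with \<open>\<bar>f\<^sub>j\<bar> \<le> p\<close> and with dense span.  The operator is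
  \<open>T = I + K\<close>, where \<open>K z = \<Sum>\<^sub>j \<omega>\<^sub>j f\<^sub>j(z) x\<^bsub>j-1\<^esub>\<close> is a bilateral shift whose weights decrease
  extremely fast in both directions.  On a finite block of indices, after rescaling, \<open>T\<close> is a single
  unipotent Jordan block, that is, the translation \<open>U(t) \<mapsto> U(t + 1)\<close> on polynomials of bounded degree.
  For \<open>n \<rightarrow> \<infinity>\<close> the polynomials \<open>binom(t, i) (1 - t/n)\<^sup>D\<close> and \<open>binom(t - n, i) (t/n)\<^sup>D\<close> with
  \<open>i < D\<close>, of degree less than \<open>2 D\<close>, show that vectors in the lower half of the block are moved
  by \<open>T\<^sup>n\<close>, up to small errors, arbitrarily to each other.  The blocks grow alternately upwards,
  which puts any prescribed vectors into the lower half and gives hypercyclicity, and downwards, which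
  puts \<open>x\<^sub>0\<close> into the upper half; there the same computation for the dual block gives functionals
  \<open>G\<^sub>n\<close> near \<open>f\<^sub>0\<close> with \<open>\<bar>G\<^sub>n \<circ> T\<^sup>n\<bar> \<le> p\<close> for infinitely many \<open>n\<close>, which prevents mixing.
\<close>

subsection \<open>Finite differences and Jordan chains\<close>

text \<open>Hypercyclicity needs given vectors low in a block, non-mixing needs \<open>x 0\<close>
  high in one. A bilateral shift has no fixed end, so infinitely many blocks of both shapes can
  alternate. Each requirement concerns one exponent \<open>n\<close>, and a change of total size
  \<open>e\<close> in the weights alters the \<open>n\<close>-th power by at most
  \<open>n * 2 ^ n * e\<close>; so a requirement met by the truncated operator persists when all
  weights outside the block are small. Weights are therefore fixed block by block, each threshold
  being chosen after its exponent. The factor 3 between blocks: the indices from \<open>- R\<close>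
  to \<open>R - 1\<close> are the lower half of those from \<open>- R\<close> to
  \<open>3 * R - 1\<close>, and the next symmetric block has \<open>3 * R\<close> in place of
  \<open>R\<close>. Non-weakness enters once: if the null space of every continuous seminorm
  contained the common kernel of finitely many continuous functionals, these functionals would
  dominate the seminorm and the topology would be weak. The space may be neither complete nor
  metrizable. All limits are therefore taken among the sums of \<open>c n * w n\<close> with
  \<open>c\<close> in l1, where completeness of l1 is available; \<open>K\<close> maps into these
  sums and sees a vector only through \<open>p\<close>.\<close>

definition fdiff :: "(nat \<Rightarrow> real) \<Rightarrow> nat \<Rightarrow> real"
  where "fdiff U = (\<lambda>t. U (Suc t) - U t)"

lemma fdiff_funpow_Suc: "(fdiff ^^ Suc l) U t = (fdiff ^^ l) U (Suc t) - (fdiff ^^ l) U t"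
  by (simp add: fdiff_def)

lemma fdiff_funpow_shift: "(fdiff ^^ l) (\<lambda>t. U (t + n)) = (\<lambda>t. (fdiff ^^ l) U (t + n))"
  by (induction l) (auto simp: fdiff_def)

lemma fdiff_funpow_add:
  "(fdiff ^^ l) (\<lambda>t. U t + V t) = (\<lambda>t. (fdiff ^^ l) U t + (fdiff ^^ l) V t)"
  by (induction l) (auto simp: fdiff_def)

lemma fdiff_funpow_zero: "(fdiff ^^ l) (\<lambda>_. 0) = (\<lambda>_. 0)"
  by (induction l) (auto simp: fdiff_def)

text \<open>Being killed by \<open>fdiff ^^ a\<close> expresses "polynomial of degree less than
  \<open>a\<close>", with \<open>a = 0\<close> for the zero function. Degrees add, so
  \<open>m = a + b - 1\<close> suffices; the induction is the discrete Leibniz rule.\<close>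

lemma fdiff_funpow_mult_zero:
  assumes "(fdiff ^^ a) U = (\<lambda>_. 0)" "(fdiff ^^ b) V = (\<lambda>_. 0)" "a + b \<le> Suc m"
  shows "(fdiff ^^ m) (\<lambda>t. U t * V t) = (\<lambda>_. 0)"
  using assms
proof (induction m arbitrary: a b U V)
  case 0
  then have "a = 0 \<or> b = 0" by auto
  with 0 show ?case by (auto dest: fun_cong)
next
  case (Suc m)
  show ?case
  proof (cases "a = 0 \<or> b = 0")
    case True
    then have "(\<lambda>t. U t * V t) = (\<lambda>_. 0)" using Suc.prems by (auto dest: fun_cong)
    then show ?thesis by (simp only: fdiff_funpow_zero)
  next
    case False
    then obtain a' b' where ab: "a = Suc a'" "b = Suc b'" by (meson not0_implies_Suc)
    have shift: "(fdiff ^^ a) (\<lambda>t. U (t + 1)) = (\<lambda>_. 0)"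
      using Suc.prems(1) by (simp only: fdiff_funpow_shift)
    have "fdiff (\<lambda>t. U t * V t) = (\<lambda>t. fdiff U t * V t + U (t + 1) * fdiff V t)"
      by (auto simp: fdiff_def algebra_simps)
    then have "(fdiff ^^ Suc m) (\<lambda>t. U t * V t) =
        (\<lambda>t. (fdiff ^^ m) (\<lambda>t. fdiff U t * V t) t + (fdiff ^^ m) (\<lambda>t. U (t + 1) * fdiff V t) t)"
      by (simp only: funpow_Suc_right o_apply fdiff_funpow_add)
    moreover have "(fdiff ^^ m) (\<lambda>t. fdiff U t * V t) = (\<lambda>_. 0)"
      using Suc.prems ab by (intro Suc.IH[of a' _ b]) (auto simp: funpow_Suc_right simp del: funpow.simps)
    moreover have "(fdiff ^^ m) (\<lambda>t. U (t + 1) * fdiff V t) = (\<lambda>_. 0)"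
      using Suc.prems ab
      by (intro Suc.IH[OF shift, of b']) (auto simp: funpow_Suc_right simp del: funpow.simps)
    ultimately show ?thesis by simp
  qed
qed

lemma fdiff_funpow_gbinomial:
  "(fdiff ^^ l) (\<lambda>t. (real t + c) gchoose i) =
    (\<lambda>t. if l \<le> i then (real t + c) gchoose (i - l) else 0)"
proof (induction l)
  case (Suc l)
  have "fdiff (\<lambda>t. (real t + c) gchoose Suc k) = (\<lambda>t. (real t + c) gchoose k)" for k
    using gbinomial_Suc_Suc[of "real _ + c" k] by (auto simp: fdiff_def algebra_simps)
  from this[of "i - Suc l"] show ?case
    using Suc by (cases "l < i"; cases "l = i") (auto simp: Suc_diff_Suc fdiff_def)
qed simp

lemma fdiff_funpow_gbinomial_0:
  "(fdiff ^^ l) (\<lambda>t. real t gchoose i) 0 = of_bool (l = i)"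
  using fdiff_funpow_gbinomial[of l 0 i] by (auto simp: gbinomial_0_left split: if_splits)

lemma fdiff_funpow_power:
  "(fdiff ^^ Suc D) (\<lambda>t. (a + b * real t) ^ D) = (\<lambda>_. 0)"
proof (induction D)
  case 0
  show ?case by (simp add: fdiff_def)
next
  case (Suc D)
  have "(fdiff ^^ 2) (\<lambda>t. a + b * real t) = (\<lambda>_. 0)"
    by (simp add: fdiff_def numeral_2_eq_2 algebra_simps)
  then show ?case
    using fdiff_funpow_mult_zero[of 2 _ "Suc D" "\<lambda>t. (a + b * real t) ^ D" "Suc (Suc D)"] Suc
    by simp
qed

text \<open>An \<open>l\<close>-th difference involves only \<open>l + 1\<close> consecutive values,
  so pointwise limits pass through it. The moving base point \<open>k n\<close> will be 0 and
  \<open>n\<close>, the two ends of an orbit.\<close>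

lemma fdiff_funpow_tendsto:
  assumes "\<And>m. (\<lambda>n. U n (k n + m)) \<longlonglongrightarrow> L m"
  shows "(\<lambda>n. (fdiff ^^ l) (U n) (k n + m)) \<longlonglongrightarrow> (fdiff ^^ l) L m"
proof (induction l arbitrary: m)
  case 0
  then show ?case using assms by simp
next
  case (Suc l)
  then show ?case
    using tendsto_diff[OF Suc[of "Suc m"] Suc[of m]] by (simp add: fdiff_def)
qed

lemma gbinomial_ratio_tendsto:
  "(\<lambda>n. ((s * real n + c) gchoose i) / real n ^ i) \<longlonglongrightarrow> s ^ i / fact i"
proof (induction i)
  case (Suc i)
  have "(\<lambda>n. c / real n) \<longlonglongrightarrow> 0" "(\<lambda>n. real i / real n) \<longlonglongrightarrow> 0"
    using lim_const_over_n by auto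
  then have "(\<lambda>n. ((s * real n + c) gchoose i) / real n ^ i *
      ((s + c / real n - real i / real n) / real (Suc i))) \<longlonglongrightarrow>
      s ^ i / fact i * ((s + 0 - 0) / real (Suc i))"
    by (intro tendsto_intros Suc) auto
  then have "(\<lambda>n. ((s * real n + c) gchoose i) / real n ^ i *
      ((s + c / real n - real i / real n) / real (Suc i))) \<longlonglongrightarrow> s ^ Suc i / fact (Suc i)"
    by (simp add: field_simps)
  moreover have "\<forall>\<^sub>F n in sequentially. ((s * real n + c) gchoose i) / real n ^ i *
      ((s + c / real n - real i / real n) / real (Suc i)) =
      ((s * real n + c) gchoose Suc i) / real n ^ Suc i"
    using eventually_gt_at_top[of 0]
  proof eventually_elim
    case (elim n)
    have "((s * real n + c) gchoose Suc i) * real (Suc i) =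
        ((s * real n + c) gchoose i) * (s * real n + c - real i)"
      using gbinomial_mult_1[of "s * real n + c" i] by (simp add: algebra_simps)
    then have *: "(s * real n + c) gchoose Suc i =
        ((s * real n + c) gchoose i) * (s * real n + c - real i) / real (Suc i)"
      by (simp add: field_simps del: of_nat_Suc)
    show ?case
      unfolding * using elim by (simp add: divide_simps del: of_nat_Suc)
  qed
  ultimately show ?case
    by (rule Lim_transform_eventually)
qed simp

lemma gbinomial_over_power_tendsto_0:
  assumes "i < D"
  shows "(\<lambda>n. ((s * real n + c) gchoose i) / real n ^ D) \<longlonglongrightarrow> 0"
proof -
  have "(\<lambda>n. ((s * real n + c) gchoose i) / real n ^ i * (1 / real n) ^ (D - i)) \<longlonglongrightarrow>
      s ^ i / fact i * 0 ^ (D - i)"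
    by (intro tendsto_intros gbinomial_ratio_tendsto lim_const_over_n)
  moreover have "((s * real n + c) gchoose i) / real n ^ i * (1 / real n) ^ (D - i) =
      ((s * real n + c) gchoose i) / real n ^ D" for n
    using assms by (simp add: power_divide flip: power_add)
  ultimately show ?thesis using assms by (simp add: zero_power)
qed

text \<open>
  The numbers \<open>(fdiff ^^ l) U n\<close> are the coefficients of the translate \<open>U(t + n)\<close> in the basis
  \<open>binom(t, l)\<close>.
\<close>

lemma chain_to_zero:
  assumes "i < D"
  shows "\<exists>U. (\<forall>n. (fdiff ^^ (2 * D)) (U n) = (\<lambda>_. 0)) \<and>
    (\<forall>l. (\<lambda>n. (fdiff ^^ l) (U n) 0) \<longlonglongrightarrow> of_bool (l = i)) \<and>
    (\<forall>l. (\<lambda>n. (fdiff ^^ l) (U n) n) \<longlonglongrightarrow> 0)"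
proof -
  \<comment> \<open>For bounded \<open>t\<close> the second factor tends to 1; at
    \<open>t = n + m\<close> it is \<open>(- m / n) ^ D\<close>, which beats the growth
    \<open>n ^ i\<close> of the binomial. At \<open>n = 0\<close> the quotient is 0 by convention,
    so the degree bound holds there too.\<close>
  define U where "U = (\<lambda>n t. ((real t + 0) gchoose i) * (1 + (- 1 / real n) * real t) ^ D)"
  have "(fdiff ^^ (2 * D)) (U n) = (\<lambda>_. 0)" for n
    unfolding U_def
    by (rule fdiff_funpow_mult_zero[of "Suc i" _ "Suc D"])
      (use assms in \<open>simp_all only: fdiff_funpow_gbinomial fdiff_funpow_power, auto\<close>)
  moreover have "(\<lambda>n. (fdiff ^^ l) (U n) 0) \<longlonglongrightarrow> of_bool (l = i)" for l
  proof -
    have "(\<lambda>n. U n (0 + m)) \<longlonglongrightarrow> (real m + 0) gchoose i" for m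
    proof -
      have "(\<lambda>n. ((real m + 0) gchoose i) * (1 + (- 1 / real n) * real m) ^ D) \<longlonglongrightarrow>
          ((real m + 0) gchoose i) * (1 + 0 * real m) ^ D"
        by (intro tendsto_intros lim_const_over_n)
      then show ?thesis by (simp add: U_def)
    qed
    from fdiff_funpow_tendsto[of U "\<lambda>_. 0", OF this, of l 0] show ?thesis
      by (simp add: fdiff_funpow_gbinomial_0)
  qed
  moreover have "(\<lambda>n. (fdiff ^^ l) (U n) n) \<longlonglongrightarrow> 0" for l
  proof -
    have "(\<lambda>n. U n (n + m)) \<longlonglongrightarrow> 0" for m
    proof -
      have "(\<lambda>n. ((1 * real n + real m) gchoose i) / real n ^ D * (- real m) ^ D) \<longlonglongrightarrow> 0 * (- real m) ^ D"
        by (intro tendsto_intros gbinomial_over_power_tendsto_0 assms)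
      moreover have "\<forall>\<^sub>F n in sequentially.
          ((1 * real n + real m) gchoose i) / real n ^ D * (- real m) ^ D = U n (n + m)"
        using eventually_gt_at_top[of 0]
      proof eventually_elim
        case (elim n)
        then have *: "1 + (- 1 / real n) * real (n + m) = (- real m) / real n"
          by (simp add: field_simps)
        show ?case unfolding U_def * power_divide by simp
      qed
      ultimately show ?thesis by (simp add: Lim_transform_eventually)
    qed
    from fdiff_funpow_tendsto[of U "\<lambda>n. n", OF this, of l 0] show ?thesis
      by (simp add: fdiff_funpow_zero)
  qed
  ultimately show ?thesis by blast
qed

text \<open>The mirror image of \<open>chain_to_zero\<close>: the binomial is centred at
  \<open>n\<close> and the damping factor vanishes at 0, so the orbit starts near zero and arrives
  near the \<open>i\<close>-th basis vector.\<close>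

lemma chain_from_zero:
  assumes "i < D"
  shows "\<exists>U. (\<forall>n. (fdiff ^^ (2 * D)) (U n) = (\<lambda>_. 0)) \<and>
    (\<forall>l. (\<lambda>n. (fdiff ^^ l) (U n) 0) \<longlonglongrightarrow> 0) \<and>
    (\<forall>l. (\<lambda>n. (fdiff ^^ l) (U n) n) \<longlonglongrightarrow> of_bool (l = i))"
proof -
  define U where "U = (\<lambda>n t. ((real t + (- real n)) gchoose i) * (0 + (1 / real n) * real t) ^ D)"
  have "(fdiff ^^ (2 * D)) (U n) = (\<lambda>_. 0)" for n
    unfolding U_def
    by (rule fdiff_funpow_mult_zero[of "Suc i" _ "Suc D"])
      (use assms in \<open>simp_all only: fdiff_funpow_gbinomial fdiff_funpow_power, auto\<close>)
  moreover have "(\<lambda>n. (fdiff ^^ l) (U n) 0) \<longlonglongrightarrow> 0" for l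
  proof -
    have "(\<lambda>n. U n (0 + m)) \<longlonglongrightarrow> 0" for m
    proof -
      have "(\<lambda>n. (((- 1) * real n + real m) gchoose i) / real n ^ D * real m ^ D) \<longlonglongrightarrow> 0 * real m ^ D"
        by (intro tendsto_intros gbinomial_over_power_tendsto_0 assms)
      then show ?thesis by (simp add: U_def power_divide algebra_simps)
    qed
    from fdiff_funpow_tendsto[of U "\<lambda>n. 0", OF this, of l 0] show ?thesis
      by (simp add: fdiff_funpow_zero)
  qed
  moreover have "(\<lambda>n. (fdiff ^^ l) (U n) n) \<longlonglongrightarrow> of_bool (l = i)" for l
  proof -
    have "(\<lambda>n. U n (n + m)) \<longlonglongrightarrow> (real m + 0) gchoose i" for m
    proof -
      have "(\<lambda>n. ((real m + 0) gchoose i) * (1 + real m / real n) ^ D) \<longlonglongrightarrow>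
          ((real m + 0) gchoose i) * (1 + 0) ^ D"
        by (intro tendsto_intros lim_const_over_n)
      moreover have "\<forall>\<^sub>F n in sequentially.
          ((real m + 0) gchoose i) * (1 + real m / real n) ^ D = U n (n + m)"
        using eventually_gt_at_top[of 0]
        by eventually_elim (simp add: U_def add_divide_distrib)
      ultimately show ?thesis by (simp add: Lim_transform_eventually)
    qed
    from fdiff_funpow_tendsto[of U "\<lambda>n. n", OF this, of l 0] show ?thesis
      by (simp add: fdiff_funpow_gbinomial_0)
  qed
  ultimately show ?thesis by blast
qed

subsection \<open>The Hahn--Banach theorem by minimal sublinear functionals\<close>

text \<open>Homogeneity is asked for as an inequality, which is easy to verify for infima; applying
  it to the inverse factor yields equality.\<close>

definition sublinear :: "('a::real_vector \<Rightarrow> real) \<Rightarrow> bool"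
  where "sublinear q \<longleftrightarrow> (\<forall>x y. q (x + y) \<le> q x + q y) \<and> (\<forall>t x. 0 \<le> t \<longrightarrow> q (t *\<^sub>R x) \<le> t * q x)"

lemma sublinearD:
  assumes "sublinear q"
  shows sublinear_add: "q (x + y) \<le> q x + q y"
    and sublinear_scale_le: "0 \<le> t \<Longrightarrow> q (t *\<^sub>R x) \<le> t * q x"
    and sublinear_zero: "q 0 = 0"
    and sublinear_scale: "0 \<le> t \<Longrightarrow> q (t *\<^sub>R x) = t * q x"
    and sublinear_lower: "- q (- x) \<le> q x"
proof -
  show a: "q (x + y) \<le> q x + q y" for x y using assms by (simp add: sublinear_def)
  show b: "0 \<le> t \<Longrightarrow> q (t *\<^sub>R x) \<le> t * q x" for t x using assms by (simp add: sublinear_def)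
  show z: "q 0 = 0" using a[of 0 0] b[of 0 0] by simp
  show "q (t *\<^sub>R x) = t * q x" if "0 \<le> t"
  proof (cases "t = 0")
    case False
    then have "q (inverse t *\<^sub>R t *\<^sub>R x) \<le> inverse t * q (t *\<^sub>R x)" using that by (intro b) auto
    then have "t * q x \<le> q (t *\<^sub>R x)" using False that by (simp add: field_simps)
    then show ?thesis using b[OF that, of x] by simp
  qed (use z in auto)
  show "- q (- x) \<le> q x" using a[of x "- x"] z by simp
qed

text \<open>The infimum is finite because \<open>- p (- x) \<le> q x\<close> for every member
  \<open>q\<close>. For subadditivity, two members of the chain are replaced by the smaller
  one.\<close>

lemma sublinear_chain_INF:
  assumes C: "C \<noteq> {}" "\<And>q. q \<in> C \<Longrightarrow> sublinear q \<and> q \<le> p"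
    and chain: "\<And>q r. q \<in> C \<Longrightarrow> r \<in> C \<Longrightarrow> q \<le> r \<or> r \<le> q"
  shows "sublinear (\<lambda>x. INF q\<in>C. q x)" and "\<And>q. q \<in> C \<Longrightarrow> (\<lambda>x. INF q\<in>C. q x) \<le> q"
proof -
  define u where "u x = (INF q\<in>C. q x)" for x
  have "- p (- x) \<le> q x" if "q \<in> C" for q x
    using sublinear_lower[of q x] C(2)[OF that] by (meson le_funD neg_le_iff_le order_trans)
  then have bdd: "bdd_below ((\<lambda>q. q x) ` C)" for x
    by (meson bdd_belowI2)
  have le: "u x \<le> q x" if "q \<in> C" for q x
    unfolding u_def by (rule cINF_lower[OF bdd that])
  have ge: "m \<le> u x" if "\<And>q. q \<in> C \<Longrightarrow> m \<le> q x" for m x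
    unfolding u_def by (rule cINF_greatest[OF C(1) that])
  have "u (x + y) \<le> u x + u y" for x y
  proof -
    have "u (x + y) \<le> q x + r y" if qr: "q \<in> C" "r \<in> C" for q r
    proof -
      obtain s where s: "s \<in> C" "s \<le> q" "s \<le> r" using chain[OF qr] qr by blast
      have "u (x + y) \<le> s (x + y)" by (rule le[OF s(1)])
      also have "\<dots> \<le> s x + s y" using C(2)[OF s(1)] sublinear_add by blast
      also have "\<dots> \<le> q x + r y" using s by (simp add: add_mono le_funD)
      finally show ?thesis .
    qed
    then have "u (x + y) - r y \<le> u x" if "r \<in> C" for r
      using that by (intro ge) (simp add: diff_le_eq)
    then have "u (x + y) - u x \<le> u y" by (intro ge) (simp add: algebra_simps)
    then show ?thesis by simp
  qed
  moreover have "u (t *\<^sub>R x) \<le> t * u x" if "0 \<le> t" for t x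
  proof (cases "t = 0")
    case True
    then show ?thesis using C le[of _ 0] sublinear_zero by fastforce
  next
    case False
    have "u (t *\<^sub>R x) / t \<le> u x"
    proof (rule ge)
      fix q assume q: "q \<in> C"
      have "u (t *\<^sub>R x) \<le> t * q x" using le[OF q] C(2)[OF q] sublinear_scale_le that by (metis order_trans)
      then show "u (t *\<^sub>R x) / t \<le> q x" using False that by (simp add: field_simps)
    qed
    then show ?thesis using False that by (simp add: field_simps)
  qed
  ultimately show "sublinear (\<lambda>x. INF q\<in>C. q x)" by (simp add: sublinear_def u_def)
  show "(\<lambda>x. INF q\<in>C. q x) \<le> q" if "q \<in> C" for q
    using le[OF that] by (simp add: le_fun_def u_def)
qed

lemma minimal_sublinear_exists:
  assumes "sublinear p"
  obtains q where "sublinear q" "q \<le> p" "\<And>r. sublinear r \<Longrightarrow> r \<le> q \<Longrightarrow> r = q"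
proof -
  let ?A = "{q. sublinear q \<and> q \<le> p}"
  \<comment> \<open>The order is reversed: Zorn's maximal elements become minimal functionals, and
    infima serve as upper bounds of chains.\<close>
  let ?P = "\<lambda>a b :: 'a \<Rightarrow> real. b \<le> a"
  have "\<exists>m\<in>?A. \<forall>a\<in>?A. a \<le> m \<longrightarrow> a = m"
  proof (rule predicate_Zorn)
    show "partial_order_on ?A (relation_of ?P ?A)"
      by (rule partial_order_on_relation_ofI) auto
    fix C assume C: "C \<in> Chains (relation_of ?P ?A)"
    then have sub: "\<And>q. q \<in> C \<Longrightarrow> sublinear q \<and> q \<le> p"
      and chain: "\<And>q r. q \<in> C \<Longrightarrow> r \<in> C \<Longrightarrow> q \<le> r \<or> r \<le> q"
      by (auto simp: Chains_def relation_of_def)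
    show "\<exists>u\<in>?A. \<forall>a\<in>C. u \<le> a"
    proof (cases "C = {}")
      case False
      note * = sublinear_chain_INF[OF False sub chain]
      then have "(\<lambda>x. INF q\<in>C. q x) \<le> p" using False sub by (meson ex_in_conv order_trans)
      then show ?thesis using * by blast
    qed (use assms in auto)
  qed
  then show ?thesis using that by (metis (no_types, lifting) mem_Collect_eq order_trans)
qed

text \<open>
  Lowering a sublinear functional along the ray through \<open>y\<close> forces equality in the triangle
  inequality with \<open>y\<close>; so a minimal sublinear functional is additive.
\<close>

lemma sublinear_lower_along:
  assumes "sublinear q"
  obtains r where "sublinear r" "r \<le> q" "\<And>x. r x \<le> q (x + y) - q y"
proof -
  define r where "r x = (INF t\<in>{0..}. q (x + t *\<^sub>R y) - t * q y)" for x
  note q = sublinearD[OF assms]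
  have "- q (- x) \<le> q (x + t *\<^sub>R y) - t * q y" if "0 \<le> t" for x t
    using q(1)[of "- x" "x + t *\<^sub>R y"] q(4)[OF that, of y] by simp
  then have bdd: "bdd_below ((\<lambda>t. q (x + t *\<^sub>R y) - t * q y) ` {0..})" for x
    by (intro bdd_belowI2[where m = "- q (- x)"]) auto
  have le: "r x \<le> q (x + t *\<^sub>R y) - t * q y" if "0 \<le> t" for x t
    unfolding r_def by (rule cINF_lower[OF bdd]) (use that in auto)
  have ge: "m \<le> r x" if "\<And>t. 0 \<le> t \<Longrightarrow> m \<le> q (x + t *\<^sub>R y) - t * q y" for m x
    unfolding r_def by (rule cINF_greatest) (use that in auto)
  have "r (x + z) \<le> r x + r z" for x z
  proof -
    have "r (x + z) \<le> (q (x + t *\<^sub>R y) - t * q y) + (q (z + s *\<^sub>R y) - s * q y)"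
      if "0 \<le> t" "0 \<le> s" for s t
      using le[of "t + s" "x + z"] q(1)[of "x + t *\<^sub>R y" "z + s *\<^sub>R y"] that
      by (simp add: algebra_simps)
    then have "r (x + z) - (q (z + s *\<^sub>R y) - s * q y) \<le> r x" if "0 \<le> s" for s
      using that by (intro ge) (simp add: algebra_simps)
    then have "r (x + z) - r x \<le> r z" by (intro ge) (simp add: algebra_simps)
    then show ?thesis by simp
  qed
  moreover have "r (t *\<^sub>R x) \<le> t * r x" if "0 \<le> t" for t x
  proof (cases "t = 0")
    case True
    then show ?thesis using le[of 0 0] q(3) by simp
  next
    case False
    have "r (t *\<^sub>R x) / t \<le> r x"
    proof (rule ge)
      fix s :: real assume s: "0 \<le> s"
      have "r (t *\<^sub>R x) \<le> q (t *\<^sub>R (x + s *\<^sub>R y)) - (t * s) * q y"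
        using le[of "t * s" "t *\<^sub>R x"] s that by (simp add: algebra_simps)
      then show "r (t *\<^sub>R x) / t \<le> q (x + s *\<^sub>R y) - s * q y"
        using False that q(4)[OF that, of "x + s *\<^sub>R y"] by (simp add: field_simps)
    qed
    then show ?thesis using False that by (simp add: field_simps)
  qed
  ultimately have "sublinear r" by (simp add: sublinear_def)
  moreover have "r \<le> q" using le[of 0] by (simp add: le_fun_def)
  ultimately show ?thesis using that le[of 1] by simp
qed

text \<open>Lowering \<open>p\<close> along \<open>y\<close> before minimising gives
  \<open>p' (- y) \<le> - p y\<close>, so every linear \<open>g \<le> p'\<close> is forced to take
  the value \<open>p y\<close> at \<open>y\<close>. No extension from a subspace occurs.\<close>

lemma hahn_banach_sublinear:
  assumes "sublinear p"
  obtains g where "linear g" "\<And>x. g x \<le> p x" "g y = p y"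
proof -
  obtain p' where p': "sublinear p'" "p' \<le> p" "\<And>x. p' x \<le> p (x + y) - p y"
    using sublinear_lower_along[OF assms, of y] by blast
  obtain g where g: "sublinear g" "g \<le> p'" and min: "\<And>r. sublinear r \<Longrightarrow> r \<le> g \<Longrightarrow> r = g"
    using minimal_sublinear_exists[OF p'(1)] by blast
  \<comment> \<open>The functional obtained by lowering \<open>g\<close> along \<open>z\<close> lies
    below \<open>g\<close>, hence equals it by minimality; its defining bound then reads
    \<open>g x \<le> g (x + z) - g z\<close>.\<close>
  have add: "g (x + z) = g x + g z" for x z
    using sublinear_lower_along[OF g(1), of z] min sublinear_add[OF g(1), of x z]
    by (metis add_le_cancel_right diff_add_cancel order_antisym)
  have minus: "g (- x) = - g x" for x
    using add[of x "- x"] sublinear_zero[OF g(1)] by simp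
  have "g (t *\<^sub>R x) = t * g x" for t x
    using sublinear_scale[OF g(1), of t x] sublinear_scale[OF g(1), of "- t" x] minus[of "t *\<^sub>R x"]
    by (cases "0 \<le> t") auto
  with add have "linear g" by (auto intro: linearI)
  moreover have le: "g x \<le> p x" for x using g(2) p'(2) by (meson le_funD order_trans)
  moreover have "g y = p y"
  proof -
    have "g (- y) \<le> p' (- y)" using g(2) by (rule le_funD)
    also have "\<dots> \<le> - p y" using p'(3)[of "- y"] sublinear_zero[OF assms] by simp
    finally show ?thesis using minus[of y] le[of y] by simp
  qed
  ultimately show ?thesis using that by blast
qed

subsection \<open>Seminorms on locally convex spaces\<close>

context hausdorff_lcs
begin

definition seminorm :: "('a \<Rightarrow> real) \<Rightarrow> bool"
  where "seminorm p \<longleftrightarrow>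
    (\<forall>x y. p (x + y) \<le> p x + p y) \<and> (\<forall>c x. p (smul c x) = norm c * p x)"

lemma seminormD:
  assumes "seminorm p"
  shows seminorm_add: "p (x + y) \<le> p x + p y"
    and seminorm_scale: "p (smul c x) = norm c * p x"
    and seminorm_zero: "p 0 = 0"
    and seminorm_minus: "p (- x) = p x"
    and seminorm_nonneg: "0 \<le> p x"
    and seminorm_diff: "p (x - y) \<le> p x + p y"
    and seminorm_reverse_triangle: "\<bar>p x - p y\<bar> \<le> p (x - y)"
    and seminorm_sublinear: "sublinear p"
    and seminorm_scaleR: "p (r *\<^sub>R x) = \<bar>r\<bar> * p x"
proof -
  show a: "p (x + y) \<le> p x + p y" for x y using assms by (simp add: seminorm_def)
  show s: "p (smul c x) = norm c * p x" for c x using assms by (simp add: seminorm_def)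
  show z: "p 0 = 0" using s[of 0 0] by simp
  show m: "p (- x) = p x" for x using s[of "- 1" x] by (simp add: scale_minus_left)
  show "0 \<le> p x" using a[of x "- x"] z m by simp
  show "p (x - y) \<le> p x + p y" using a[of x "- y"] m[of y] by simp
  have c: "p (x - y) = p (y - x)" for x y using m[of "x - y"] by simp
  show "\<bar>p x - p y\<bar> \<le> p (x - y)" using a[of "x - y" y] a[of "y - x" x] c[of x y] by simp
  show r: "p (r *\<^sub>R x) = \<bar>r\<bar> * p x" for r x
    using s[of "of_real r" x] by (simp add: smul_of_real)
  show "sublinear p" by (auto simp: sublinear_def a r)
qed

lemma continuous_smul_right: "continuous_on UNIV (smul c)"
proof -
  have "continuous_on UNIV ((\<lambda>(c, x). smul c x) \<circ> (\<lambda>x. (c, x)))"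
    by (intro continuous_on_compose continuous_intros continuous_on_subset[OF continuous_smul]) auto
  then show ?thesis by (simp add: o_def)
qed

lemma continuous_smul_left: "continuous_on UNIV (\<lambda>c. smul c x)"
proof -
  have "continuous_on UNIV ((\<lambda>(c, x). smul c x) \<circ> (\<lambda>c. (c, x)))"
    by (intro continuous_on_compose continuous_intros continuous_on_subset[OF continuous_smul]) auto
  then show ?thesis by (simp add: o_def)
qed

lemma open_seminorm_ball:
  fixes p :: "'a \<Rightarrow> real"
  assumes "continuous_on UNIV p"
  shows "open {y. p (y - x) < e}"
proof -
  have "continuous_on UNIV (p \<circ> (\<lambda>y. y + (- x)))"
    by (intro continuous_on_compose continuous_intros continuous_on_subset[OF assms]) auto
  then have "continuous_on UNIV (\<lambda>y. p (y - x))" by (simp add: o_def)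
  then show ?thesis by (rule open_Collect_less[OF _ continuous_on_const])
qed

text \<open>The target need not carry a seminorm, so continuity is expressed through neighbourhoods of \<open>0\<close>.\<close>

lemma additive_continuous:
  fixes F :: "'a \<Rightarrow> 'd::topological_ab_group_add" and p :: "'a \<Rightarrow> real"
  assumes "continuous_on UNIV p" and diff: "\<And>x y. F (x - y) = F x - F y"
    and small: "\<And>U. open U \<Longrightarrow> 0 \<in> U \<Longrightarrow> \<exists>e>0. \<forall>x. p x < e \<longrightarrow> F x \<in> U"
    and p0: "p 0 = 0"
  shows "continuous_on UNIV F"
proof -
  have "open (F -` U)" if "open U" for U
  proof (subst open_subopen, intro ballI)
    fix x assume "x \<in> F -` U"
    moreover have "open ((\<lambda>z. z + F x) -` U)"
      by (intro open_vimage[OF that] continuous_intros)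
    ultimately obtain e where e: "e > 0" "\<And>z. p z < e \<Longrightarrow> F z + F x \<in> U"
      using small[of "(\<lambda>z. z + F x) -` U"] by auto
    have "F y \<in> U" if "p (y - x) < e" for y
      using e(2)[OF that] by (simp add: diff)
    then show "\<exists>T. open T \<and> x \<in> T \<and> T \<subseteq> F -` U"
      using e(1) p0 open_seminorm_ball[OF assms(1)] by (intro exI[of _ "{y. p (y - x) < e}"]) auto
  qed
  then show ?thesis by (simp add: continuous_on_open_vimage)
qed

lemma bounded_functional_continuous:
  fixes f :: "'a \<Rightarrow> 'd::real_normed_vector"
  assumes "seminorm p" "continuous_on UNIV p" "\<And>x y. f (x - y) = f x - f y"
    and le: "\<And>x. norm (f x) \<le> p x"
  shows "continuous_on UNIV f"
proof (rule additive_continuous[OF assms(2,3)])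
  fix U :: "'d set" assume "open U" "0 \<in> U"
  then obtain e where "e > 0" "ball 0 e \<subseteq> U" by (meson open_contains_ball)
  then show "\<exists>e>0. \<forall>x. p x < e \<longrightarrow> f x \<in> U"
    using le by (intro exI[of _ e]) (auto simp: subset_iff intro: le_less_trans)
qed (use assms seminorm_zero in auto)

lemma seminorm_continuousI:
  assumes p: "seminorm p" and N: "open N" "0 \<in> N" "\<And>x. x \<in> N \<Longrightarrow> p x \<le> 1"
  shows "continuous_on UNIV p"
proof -
  have "(p \<longlongrightarrow> p x) (nhds x)" for x
  proof (rule tendstoI)
    fix e :: real assume e: "e > 0"
    \<comment> \<open>The factor \<open>2 / e\<close> yields \<open>p (y - x) \<le> e / 2\<close>
      and thereby a strict bound by \<open>e\<close>.\<close>
    define g where "g = (\<lambda>y. smul (of_real (2 / e)) (y + (- x)))"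
    have "continuous_on UNIV (smul (of_real (2 / e)) \<circ> (\<lambda>y. y + (- x)))"
      by (intro continuous_on_compose continuous_intros continuous_on_subset[OF continuous_smul_right]) auto
    then have "open (g -` N)" using N(1) by (intro open_vimage) (simp_all add: g_def o_def)
    moreover have "x \<in> g -` N" using N(2) by (simp add: g_def)
    ultimately have "\<forall>\<^sub>F y in nhds x. y \<in> g -` N" by (rule eventually_nhds_in_open)
    then show "\<forall>\<^sub>F y in nhds x. dist (p y) (p x) < e"
    proof eventually_elim
      case (elim y)
      then have "2 / e * p (y - x) \<le> 1"
        using N(3)[of "g y"] e by (simp add: g_def seminorm_scale[OF p] norm_divide)
      then show ?case
        using seminorm_reverse_triangle[OF p, of y x] e by (simp add: dist_real_def field_simps)
    qed
  qed
  then show ?thesis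
    unfolding continuous_on_def by (blast intro: tendsto_mono[OF at_within_le_nhds])
qed

text \<open>\<open>B\<close> is the balanced core of a convex neighbourhood. It contains an open set
  around 0 because scalar multiplication is jointly continuous at \<open>(0, 0)\<close>.\<close>

lemma balanced_convex_neighbourhood:
  assumes "open W" "0 \<in> W"
  obtains B N where "convex B" "\<forall>c x. norm c \<le> 1 \<longrightarrow> x \<in> B \<longrightarrow> smul c x \<in> B" "B \<subseteq> W"
    "open N" "0 \<in> N" "N \<subseteq> B"
proof -
  obtain u C where C: "open u" "convex C" "0 \<in> u" "u \<subseteq> C" "C \<subseteq> W"
    using locally_convex assms unfolding locally_def by (metis open_openin subtopology_UNIV)
  have "open ((\<lambda>(c, x). smul c x) -` u)" using continuous_smul C(1) by (intro open_vimage)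
  moreover have "(0, 0) \<in> (\<lambda>(c, x). smul c x) -` u" using C by simp
  ultimately obtain A E where "open A" "open E" "(0, 0) \<in> A \<times> E"
      "A \<times> E \<subseteq> (\<lambda>(c, x). smul c x) -` u"
    by (rule open_prod_elim)
  then have AE: "open A" "open E" "0 \<in> A" "0 \<in> E" "A \<times> E \<subseteq> (\<lambda>(c, x). smul c x) -` u"
    by auto
  obtain d where d: "d > 0" "ball 0 d \<subseteq> A" using AE by (meson open_contains_ball)
  define B where "B = {x. \<forall>c. norm c \<le> 1 \<longrightarrow> smul c x \<in> C}"
  \<comment> \<open>For \<open>norm c \<le> 1\<close>, \<open>smul c x\<close> is the product of
    \<open>c * of_real (d / 2)\<close>, of norm less than \<open>d\<close>, and the rescaled vector,
    which lies in \<open>E\<close>.\<close>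
  define N where "N = smul (of_real (2 / d)) -` E"
  have "\<forall>c x. norm c \<le> 1 \<longrightarrow> x \<in> B \<longrightarrow> smul c x \<in> B"
    unfolding B_def by (auto simp: norm_mult mult_le_one)
  moreover have "convex B"
  proof (rule convexI)
    fix x y u v assume *: "x \<in> B" "y \<in> B" "0 \<le> u" "0 \<le> v" "u + v = (1::real)"
    show "u *\<^sub>R x + v *\<^sub>R y \<in> B"
      unfolding B_def
    proof safe
      fix c :: 'k assume "norm c \<le> 1"
      then have "u *\<^sub>R smul c x + v *\<^sub>R smul c y \<in> C"
        using * C(2) by (auto simp: B_def intro: convexD)
      then show "smul c (u *\<^sub>R x + v *\<^sub>R y) \<in> C"
        by (simp add: scale_right_distrib mult.commute flip: smul_of_real)
    qed
  qed
  moreover have "B \<subseteq> W"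
  proof
    fix x assume "x \<in> B"
    then have "smul 1 x \<in> C" by (auto simp: B_def simp del: scale_one)
    then show "x \<in> W" using C by auto
  qed
  moreover have "open N" unfolding N_def by (intro open_vimage AE continuous_smul_right)
  moreover have "0 \<in> N" using AE by (simp add: N_def)
  moreover have "N \<subseteq> B"
    unfolding B_def
  proof safe
    fix x c assume x: "x \<in> N" and c: "norm (c :: 'k) \<le> 1"
    have "norm (c * of_real (d / 2)) < d"
      using c d mult_right_mono[OF c, of "d / 2"] by (simp add: norm_mult norm_divide)
    then have "(c * of_real (d / 2), smul (of_real (2 / d)) x) \<in> A \<times> E"
      using d x by (auto simp: N_def)
    then have "(c * of_real (d / 2), smul (of_real (2 / d)) x) \<in> (\<lambda>(c, x). smul c x) -` u"
      by (rule subsetD[OF AE(5)])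
    then have "smul (c * of_real (d / 2)) (smul (of_real (2 / d)) x) \<in> u"
      by (simp only: vimage_eq case_prod_conv)
    then show "smul c x \<in> C" using C(4) d by auto
  qed
  ultimately show ?thesis by (intro that[of B N])
qed

text \<open>The gauge of a balanced convex set: balancedness absorbs the phase of a scalar,
  convexity gives the triangle inequality, and the bound 1 on \<open>N\<close> gives
  continuity.\<close>

lemma minkowski_seminorm:
  assumes "open W" "0 \<in> W"
  obtains p where "seminorm p" "continuous_on UNIV p" "{x. p x < 1} \<subseteq> W"
proof -
  obtain B N where B: "convex B" and bal': "\<forall>c x. norm c \<le> 1 \<longrightarrow> x \<in> B \<longrightarrow> smul c x \<in> B"
      and BW: "B \<subseteq> W" and N: "open N" "0 \<in> N" "N \<subseteq> B"
    by (rule balanced_convex_neighbourhood[OF assms])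
  note bal = bal'[rule_format]
  define S where "S x = {t. 0 < t \<and> (1 / t) *\<^sub>R x \<in> B}" for x :: 'a
  define p where "p x = Inf (S x)" for x
  have S_scale: "norm c * t \<in> S (smul c x)" if "c \<noteq> 0" "t \<in> S x" for c t x
  proof -
    have "smul (c / of_real (norm c)) ((1 / t) *\<^sub>R x) \<in> B"
      using that by (intro bal) (auto simp: S_def norm_divide)
    moreover have "smul (c / of_real (norm c)) ((1 / t) *\<^sub>R x) = (1 / (norm c * t)) *\<^sub>R smul c x"
      by (simp add: field_simps flip: smul_of_real)
    ultimately show ?thesis using that by (simp add: S_def)
  qed
  have S_ne: "S x \<noteq> {}" for x
  proof -
    have "open ((\<lambda>c. smul c x) -` N)" using N by (intro open_vimage continuous_smul_left)
    moreover have "0 \<in> (\<lambda>c. smul c x) -` N" using N by simp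
    ultimately obtain d where d: "d > 0" "ball 0 d \<subseteq> (\<lambda>c. smul c x) -` N"
      by (meson open_contains_ball)
    have "of_real (d / 2) \<in> ball (0 :: 'k) d" using d(1) by (simp add: norm_divide)
    with d have "smul (of_real (d / 2)) x \<in> N" by blast
    then have "(d / 2) *\<^sub>R x \<in> B" using N(3) by (auto simp only: smul_of_real)
    then have "2 / d \<in> S x" using d by (simp add: S_def)
    then show ?thesis by blast
  qed
  have bdd: "bdd_below (S x)" for x by (rule bdd_belowI[of _ 0]) (auto simp: S_def)
  have le: "p x \<le> t" if "t \<in> S x" for x t
    unfolding p_def by (rule cInf_lower[OF that bdd])
  have ge: "m \<le> p x" if "\<And>t. t \<in> S x \<Longrightarrow> m \<le> t" for m x
    unfolding p_def by (rule cInf_greatest[OF S_ne that])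
  have scale_le: "p (smul c x) \<le> norm c * p x" if "c \<noteq> 0" for c x
  proof -
    have "p (smul c x) / norm c \<le> p x"
      using le[OF S_scale[OF that]] that by (intro ge) (simp add: field_simps)
    then show ?thesis using that by (simp add: field_simps)
  qed
  have "0 \<in> B" using N by auto
  have p0: "p 0 = 0"
  proof (rule order_antisym)
    show "p 0 \<le> 0"
    proof (rule field_le_epsilon)
      fix e :: real assume "e > 0"
      then show "p 0 \<le> 0 + e" using \<open>0 \<in> B\<close> by (intro le) (simp add: S_def)
    qed
  qed (rule ge, simp add: S_def)
  have "p (smul c x) = norm c * p x" for c x
  proof (cases "c = 0")
    case False
    have "p x \<le> inverse (norm c) * p (smul c x)"
      using scale_le[of "inverse c" "smul c x"] False by (simp add: norm_inverse)
    then have "norm c * p x \<le> p (smul c x)"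
      using False by (simp add: field_simps)
    with scale_le[OF False, of x] show ?thesis by simp
  qed (use p0 in simp)
  moreover have "p (x + y) \<le> p x + p y" for x y
  proof -
    \<comment> \<open>\<open>(x + y) / (s + t)\<close> is the convex combination of
      \<open>x / s\<close> and \<open>y / t\<close> with weights \<open>s / (s + t)\<close> and
      \<open>t / (s + t)\<close>.\<close>
    have *: "p (x + y) \<le> s + t" if "s \<in> S x" "t \<in> S y" for s t
    proof (rule le)
      have st: "0 < s" "0 < t" using that by (auto simp: S_def)
      then have "(s / (s + t)) *\<^sub>R (1 / s) *\<^sub>R x + (t / (s + t)) *\<^sub>R (1 / t) *\<^sub>R y \<in> B"
        using that by (intro convexD[OF B]) (auto simp: S_def simp flip: add_divide_distrib)
      then show "s + t \<in> S (x + y)" using st by (simp add: S_def scaleR_right_distrib)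
    qed
    then have "p (x + y) - t \<le> p x" if "t \<in> S y" for t
      using that by (intro ge) (simp add: algebra_simps)
    then have "p (x + y) - p x \<le> p y" by (intro ge) (simp add: algebra_simps)
    then show ?thesis by simp
  qed
  ultimately have p: "seminorm p" by (simp add: seminorm_def)
  have "p x \<le> 1" if "x \<in> N" for x using that N by (intro le) (auto simp: S_def)
  with p N have "continuous_on UNIV p" by (intro seminorm_continuousI)
  moreover have "x \<in> W" if "p x < 1" for x
  proof -
    obtain t where t: "t \<in> S x" "t < 1" using ge[of x 1] \<open>p x < 1\<close> by fastforce
    then have "smul (of_real t) ((1 / t) *\<^sub>R x) \<in> B" by (intro bal) (auto simp: S_def)
    then show ?thesis using t BW by (auto simp: S_def smul_of_real)
  qed
  ultimately show ?thesis using that p by blast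
qed

end

subsection \<open>Weak topologies\<close>

context hausdorff_lcs
begin

abbreviation linear_functional :: "('a \<Rightarrow> 'k) \<Rightarrow> bool"
  where "linear_functional \<equiv> Vector_Spaces.linear smul (*)"

lemma linear_functional_iff:
  "linear_functional f \<longleftrightarrow> (\<forall>x y. f (x + y) = f x + f y) \<and> (\<forall>c x. f (smul c x) = c * f x)"
proof -
  have "module ((*) :: 'k \<Rightarrow> 'k \<Rightarrow> 'k)" by unfold_locales (auto simp: algebra_simps)
  moreover have "vector_space ((*) :: 'k \<Rightarrow> 'k \<Rightarrow> 'k)" by unfold_locales (auto simp: algebra_simps)
  moreover have "module smul" by unfold_locales
  moreover have "vector_space smul" by unfold_locales
  ultimately show ?thesis
    by (simp add: Vector_Spaces.linear_def module_hom_iff)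
qed

lemma linear_functionalD:
  assumes "linear_functional f"
  shows linear_functional_add: "f (x + y) = f x + f y"
    and linear_functional_scale: "f (smul c x) = c * f x"
    and linear_functional_zero: "f 0 = 0"
    and linear_functional_diff: "f (x - y) = f x - f y"
    and linear_functional_sum: "f (sum g I) = (\<Sum>i\<in>I. f (g i))"
proof -
  interpret f: Vector_Spaces.linear smul "(*)" f by (rule assms)
  show "f (x + y) = f x + f y" "f (smul c x) = c * f x" "f 0 = 0" "f (x - y) = f x - f y"
    "f (sum g I) = (\<Sum>i\<in>I. f (g i))"
    by (simp_all add: f.add f.scale f.zero f.diff f.sum)
qed

text \<open>Such a seminorm lives on a finite-dimensional quotient. The subspace \<open>S\<close> is
  carried along for the induction, which removes a functional by passing to its kernel inside
  \<open>S\<close>.\<close>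

lemma seminorm_le_sum_functionals:
  assumes "seminorm p" "finite F" "\<And>f. f \<in> F \<Longrightarrow> linear_functional f" "subspace S"
    and "\<And>x. x \<in> S \<Longrightarrow> \<forall>f\<in>F. f x = 0 \<Longrightarrow> p x = 0"
  shows "\<exists>C\<ge>0. \<forall>x\<in>S. p x \<le> C * (\<Sum>f\<in>F. norm (f x))"
  using assms(2-5)
proof (induction F arbitrary: S rule: finite_induct)
  case empty
  then show ?case by (intro exI[of _ 0]) auto
next
  case (insert f F)
  show ?case
  proof (cases "\<forall>x\<in>S. f x = 0")
    case True
    then have "\<exists>C\<ge>0. \<forall>x\<in>S. p x \<le> C * (\<Sum>f\<in>F. norm (f x))"
      by (intro insert.IH) (use insert.prems in auto)
    then show ?thesis using True insert.hyps by simp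
  next
    case False
    note f = linear_functionalD[of f] insert.prems(1)
    obtain a0 where a0: "a0 \<in> S" "f a0 \<noteq> 0" using False by blast
    define a where "a = smul (inverse (f a0)) a0"
    have a: "a \<in> S" "f a = 1"
      using a0 insert.prems(2) f by (auto simp: a_def subspace_scale)
    define S' where "S' = {x \<in> S. f x = 0}"
    have "subspace S'"
      using insert.prems(2) f unfolding S'_def subspace_def by auto
    then have "\<exists>C\<ge>0. \<forall>x\<in>S'. p x \<le> C * (\<Sum>f\<in>F. norm (f x))"
      by (intro insert.IH) (use insert.prems in \<open>auto simp: S'_def\<close>)
    then obtain C where C: "C \<ge> 0" "\<And>x. x \<in> S' \<Longrightarrow> p x \<le> C * (\<Sum>f\<in>F. norm (f x))" by blast
    define M where "M = C + p a + C * (\<Sum>g\<in>F. norm (g a))"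
    have pa: "p a \<ge> 0" by (rule seminorm_nonneg[OF assms(1)])
    have sa: "(\<Sum>g\<in>F. norm (g a)) \<ge> 0" by (intro sum_nonneg) auto
    have "p x \<le> M * (\<Sum>g\<in>insert f F. norm (g x))" if x: "x \<in> S" for x
    proof -
      \<comment> \<open>The projection of \<open>x\<close> along \<open>a\<close> onto the kernel of
        \<open>f\<close>.\<close>
      define y where "y = x - smul (f x) a"
      have "y \<in> S'"
        using x a insert.prems(2) f
        by (auto simp: S'_def y_def intro: subspace_diff subspace_scale)
      have 1: "p x \<le> p y + norm (f x) * p a"
        using seminorm_add[OF assms(1), of y "smul (f x) a"] seminorm_scale[OF assms(1)]
        by (simp add: y_def)
      have 2: "p y \<le> C * (\<Sum>g\<in>F. norm (g y))" by (rule C) fact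
      have "(\<Sum>g\<in>F. norm (g y)) \<le> (\<Sum>g\<in>F. norm (g x) + norm (f x) * norm (g a))"
      proof (rule sum_mono)
        fix g assume "g \<in> F"
        then have "g y = g x - f x * g a"
          using insert.prems(1)[of g] by (simp add: y_def linear_functional_diff linear_functional_scale)
        then show "norm (g y) \<le> norm (g x) + norm (f x) * norm (g a)"
          by (metis norm_mult norm_triangle_ineq4)
      qed
      also have "\<dots> = (\<Sum>g\<in>F. norm (g x)) + norm (f x) * (\<Sum>g\<in>F. norm (g a))"
        by (simp add: sum.distrib sum_distrib_left)
      finally have "p x \<le> C * (\<Sum>g\<in>F. norm (g x)) + norm (f x) * (p a + C * (\<Sum>g\<in>F. norm (g a)))"
        using 1 2 by (auto simp: algebra_simps dest: mult_left_mono[OF _ C(1)])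
      also have "\<dots> \<le> M * (\<Sum>g\<in>F. norm (g x)) + norm (f x) * M"
        using C(1) pa sa unfolding M_def
        by (intro add_mono mult_right_mono mult_left_mono sum_nonneg) auto
      finally show ?thesis using insert.hyps by (simp add: algebra_simps)
    qed
    moreover have "M \<ge> 0" using C(1) pa sa by (simp add: M_def)
    ultimately show ?thesis by blast
  qed
qed

lemma sigma_open_ball:
  assumes "f \<in> Y"
  shows "sigma_open Y {y. norm (f y - f x) < e}"
proof -
  have "{y. norm (f y - f x) < e} = f -` ball (f x) e" by (auto simp: dist_norm norm_minus_commute)
  then show ?thesis unfolding sigma_open_def using assms by (intro generate_topology.Basis) blast
qed

lemma sigma_open_finite_Inter:
  assumes "finite F" "\<And>f. f \<in> F \<Longrightarrow> sigma_open Y (A f)"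
  shows "sigma_open Y (\<Inter>f\<in>F. A f)"
  using assms
  by (induction F rule: finite_induct)
    (auto simp: sigma_open_def intro: generate_topology.UNIV generate_topology.Int)

text \<open>The witness is the whole continuous dual: a seminorm dominated by finitely many
  functionals has a finite intersection of their strips inside its unit ball.\<close>

lemma weak_topologyI:
  assumes sep: "\<And>x. x \<noteq> 0 \<Longrightarrow> \<exists>f. linear_functional f \<and> continuous_on UNIV f \<and> f x \<noteq> 0"
    and fin: "\<And>p. seminorm p \<Longrightarrow> continuous_on UNIV p \<Longrightarrow>
      \<exists>F. finite F \<and> (\<forall>f\<in>F. linear_functional f \<and> continuous_on UNIV f) \<and>
        (\<forall>x. (\<forall>f\<in>F. f x = 0) \<longrightarrow> p x = 0)"
  shows "weak_topology smul"
proof -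
  define Y where "Y = {f. linear_functional f \<and> continuous_on UNIV f}"
  have "separating_functional_space smul Y"
    unfolding separating_functional_space_def
  proof (intro conjI ballI allI impI)
    show "(\<lambda>x. 0) \<in> Y" by (simp add: Y_def linear_functional_iff)
    show "linear_functional f" if "f \<in> Y" for f using that by (simp add: Y_def)
    show "(\<lambda>x. f x + g x) \<in> Y" if "f \<in> Y" "g \<in> Y" for f g
      using that by (auto simp: Y_def linear_functional_iff algebra_simps intro: continuous_on_add)
    show "(\<lambda>x. c * f x) \<in> Y" if "f \<in> Y" for f c
      using that by (auto simp: Y_def linear_functional_iff algebra_simps intro: continuous_on_mult_left)
    show "\<exists>f\<in>Y. f x \<noteq> f y" if "x \<noteq> y" for x y
      using sep[of "x - y"] that by (auto simp: Y_def linear_functional_diff)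
  qed
  moreover have "open S" if "sigma_open Y S" for S
    using that unfolding sigma_open_def
  proof induction
    case (Basis S)
    then show ?case by (auto simp: Y_def intro: open_vimage)
  qed auto
  moreover have "sigma_open Y S" if S: "open S" for S
  proof -
    have "\<exists>T. sigma_open Y T \<and> x \<in> T \<and> T \<subseteq> S" if xS: "x \<in> S" for x
    proof -
      have "open ((\<lambda>z. z + x) -` S)" by (intro open_vimage[OF S] continuous_intros)
      then obtain p where p: "seminorm p" "continuous_on UNIV p" "{z. p z < 1} \<subseteq> (\<lambda>z. z + x) -` S"
        using minkowski_seminorm[of "(\<lambda>z. z + x) -` S"] xS by auto
      obtain F where F: "finite F" "F \<subseteq> Y" "\<And>x. \<forall>f\<in>F. f x = 0 \<Longrightarrow> p x = 0"
        using fin[OF p(1,2)] by (auto simp: Y_def)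
      obtain C where C: "C \<ge> 0" "\<And>x. p x \<le> C * (\<Sum>f\<in>F. norm (f x))"
        using seminorm_le_sum_functionals[OF p(1) F(1) _ subspace_UNIV] F(2,3) by (auto simp: Y_def)
      \<comment> \<open>The added 1 keeps the denominator positive when \<open>C\<close> or
        \<open>F\<close> is trivial and makes \<open>C * (card F * e) < 1\<close> strict.\<close>
      define e where "e = 1 / (C * card F + 1)"
      have "C * card F + 1 > 0" using C(1) by (simp add: add_nonneg_pos)
      then have e: "e > 0" "C * (card F * e) < 1"
        by (simp_all add: e_def field_simps)
      define T where "T = (\<Inter>f\<in>F. {y. norm (f y - f x) < e})"
      have "sigma_open Y T"
        unfolding T_def by (intro sigma_open_finite_Inter sigma_open_ball F) (use F in auto)
      moreover have "x \<in> T" using e by (simp add: T_def)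
      moreover have "y \<in> S" if "y \<in> T" for y
      proof -
        have "(\<Sum>f\<in>F. norm (f (y - x))) \<le> card F * e"
        proof (rule sum_bounded_above)
          fix f assume f: "f \<in> F"
          then have "linear_functional f" using F(2) by (auto simp: Y_def)
          then show "norm (f (y - x)) \<le> e" using that f
            by (auto simp: T_def linear_functional_diff intro: less_imp_le)
        qed
        then have "p (y - x) < 1"
          using C(2)[of "y - x"] mult_left_mono[OF _ C(1)] e(2) by (meson le_less_trans)
        then have "y - x \<in> (\<lambda>z. z + x) -` S" using p(3) by blast
        then show ?thesis by simp
      qed
      ultimately show ?thesis by blast
    qed
    then have "S = \<Union>{T. sigma_open Y T \<and> T \<subseteq> S}" by blast
    moreover have "sigma_open Y (\<Union>{T. sigma_open Y T \<and> T \<subseteq> S})"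
      unfolding sigma_open_def by (rule generate_topology.UN) simp
    ultimately show ?thesis by simp
  qed
  ultimately show ?thesis unfolding weak_topology_def by blast
qed

text \<open>The only consequence of Hahn-Banach used below, isolated so that the main construction
  is uniform in the scalar field. The factor 2 pays for the crude bound of a complex number by its
  real and imaginary parts.\<close>

definition enough_functionals :: bool
  where "enough_functionals \<longleftrightarrow> (\<forall>p y. seminorm p \<and> p y \<noteq> 0 \<longrightarrow>
    (\<exists>f. linear_functional f \<and> f y \<noteq> 0 \<and> (\<forall>x. norm (f x) \<le> 2 * p x)))"

lemma seminorm_scaled:
  assumes "seminorm p" "c \<ge> 0"
  shows "seminorm (\<lambda>x. c * p x)"
  unfolding seminorm_def
proof (intro conjI allI)
  show "c * p (x + y) \<le> c * p x + c * p y" for x y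
    using mult_left_mono[OF seminorm_add[OF assms(1)] assms(2)] by (simp add: distrib_left)
  show "c * p (smul b x) = norm b * (c * p x)" for b x
    by (simp add: seminorm_scale[OF assms(1)])
qed

text \<open>The contrapositive of \<open>weak_topologyI\<close>: separation of points follows from
  \<open>enough_functionals\<close>, so the finiteness condition has to fail for some
  seminorm.\<close>

lemma not_weak_infinite_seminorm:
  assumes "\<not> weak_topology smul" "enough_functionals"
  obtains p where "seminorm p" "continuous_on UNIV p"
    "\<forall>F. finite F \<longrightarrow> (\<forall>f\<in>F. linear_functional f \<and> continuous_on UNIV f) \<longrightarrow>
      (\<exists>x. (\<forall>f\<in>F. f x = 0) \<and> p x \<noteq> 0)"
proof -
  have "\<exists>f. linear_functional f \<and> continuous_on UNIV f \<and> f x \<noteq> 0" if "x \<noteq> 0" for x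
  proof -
    obtain p where p: "seminorm p" "continuous_on UNIV p" "{y. p y < 1} \<subseteq> - {x}"
      using minkowski_seminorm[of "- {x}"] \<open>x \<noteq> 0\<close> by (metis ComplI closed_singleton open_Compl singletonD)
    then have "p x \<noteq> 0" by force
    then obtain f where f: "linear_functional f" "f x \<noteq> 0" "\<And>x. norm (f x) \<le> 2 * p x"
      using assms(2) p(1) unfolding enough_functionals_def by blast
    have "continuous_on UNIV f"
      by (rule bounded_functional_continuous[OF seminorm_scaled[OF p(1), of 2] _ linear_functional_diff[OF f(1)] f(3)])
        (auto intro: continuous_on_mult_left p)
    with f show ?thesis by blast
  qed
  note sep = this
  define good where "good p \<longleftrightarrow> (\<exists>F. finite F \<and>
    (\<forall>f\<in>F. linear_functional f \<and> continuous_on UNIV f) \<and> (\<forall>x. (\<forall>f\<in>F. f x = 0) \<longrightarrow> p x = 0))"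
    for p :: "'a \<Rightarrow> real"
  have "\<exists>p. seminorm p \<and> continuous_on UNIV p \<and> \<not> good p"
  proof (rule ccontr)
    assume neg: "\<not> ?thesis"
    have "weak_topology smul"
    proof (rule weak_topologyI, goal_cases)
      case (2 p)
      with neg have "good p" by blast
      then show ?case by (simp only: good_def)
    qed (rule sep)
    then show False using assms(1) by simp
  qed
  then obtain p where p: "seminorm p" "continuous_on UNIV p" and *: "\<not> good p" by blast
  show ?thesis
  proof (rule that[OF p], intro allI impI)
    fix F :: "('a \<Rightarrow> 'k) set"
    assume F: "finite F" "\<forall>f\<in>F. linear_functional f \<and> continuous_on UNIV f"
    then have "\<not> (\<forall>x. (\<forall>f\<in>F. f x = 0) \<longrightarrow> p x = 0)" using * unfolding good_def by metis
    then show "\<exists>x. (\<forall>f\<in>F. f x = 0) \<and> p x \<noteq> 0" by simp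
  qed
qed

end

section \<open>Hahn-Banach functionals over the two scalar fields\<close>

lemma enough_functionals_real:
  fixes smul :: "real \<Rightarrow> 'a::{real_vector, topological_ab_group_add, t2_space} \<Rightarrow> 'a"
  assumes "hausdorff_lcs smul"
  shows "hausdorff_lcs.enough_functionals smul"
proof -
  interpret hausdorff_lcs smul by fact
  show ?thesis
    unfolding enough_functionals_def
  proof (intro allI impI)
    fix p y assume "seminorm p \<and> p y \<noteq> 0"
    then have p: "seminorm p" "p y \<noteq> 0" by auto
    obtain g where g: "linear g" "\<And>x. g x \<le> p x" "g y = p y"
      using hahn_banach_sublinear[OF seminorm_sublinear[OF p(1)]] by blast
    have "\<bar>g x\<bar> \<le> 2 * p x" for x
      using g(2)[of x] g(2)[of "- x"] seminorm_nonneg[OF p(1), of x]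
      by (simp add: linear_neg[OF g(1)] seminorm_minus[OF p(1)])
    moreover have "linear_functional g"
      using g(1) smul_of_real
      by (simp add: linear_functional_iff linear_add linear_scale)
    ultimately show "\<exists>f. linear_functional f \<and> f y \<noteq> 0 \<and> (\<forall>x. norm (f x) \<le> 2 * p x)"
      using g p by auto
  qed
qed

text \<open>A complex functional is recovered from its real part \<open>g\<close> as \<open>g x - i g (i x)\<close>.\<close>

lemma enough_functionals_complex:
  fixes smul :: "complex \<Rightarrow> 'a::{real_vector, topological_ab_group_add, t2_space} \<Rightarrow> 'a"
  assumes "hausdorff_lcs smul"
  shows "hausdorff_lcs.enough_functionals smul"
proof -
  interpret hausdorff_lcs smul by fact
  show ?thesis
    unfolding enough_functionals_def
  proof (intro allI impI)
    fix p y assume "seminorm p \<and> p y \<noteq> 0"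
    then have p: "seminorm p" "p y \<noteq> 0" by auto
    obtain g where g: "linear g" "\<And>x. g x \<le> p x" "g y = p y"
      using hahn_banach_sublinear[OF seminorm_sublinear[OF p(1)]] by blast
    have gp: "\<bar>g x\<bar> \<le> p x" for x
      using g(2)[of x] g(2)[of "- x"]
      by (simp add: linear_neg[OF g(1)] seminorm_minus[OF p(1)])
    define f where "f x = Complex (g x) (- g (smul \<i> x))" for x
    have "f (smul c x) = c * f x" for c x
    proof -
      have "smul c x = Re c *\<^sub>R x + Im c *\<^sub>R smul \<i> x"
      proof -
        have "smul c x = smul (of_real (Re c) + of_real (Im c) * \<i>) x"
          by (intro arg_cong2[where f = smul]) (auto simp: complex_eq_iff)
        then show ?thesis by (simp add: scale_left_distrib smul_of_real flip: scale_scale)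
      qed
      moreover have "smul \<i> (smul c x) = Re c *\<^sub>R smul \<i> x - Im c *\<^sub>R x"
      proof -
        have "smul \<i> (smul c x) = smul (of_real (Re c) * \<i> - of_real (Im c)) x"
          unfolding scale_scale by (intro arg_cong2[where f = smul]) (auto simp: complex_eq_iff)
        then show ?thesis by (simp add: scale_left_diff_distrib smul_of_real flip: scale_scale)
      qed
      ultimately show ?thesis
        by (simp add: f_def complex_eq_iff linear_add[OF g(1)] linear_diff[OF g(1)]
            linear_scale[OF g(1)])
    qed
    moreover have "f (x + z) = f x + f z" for x z
      by (simp add: f_def complex_eq_iff linear_add[OF g(1)] scale_right_distrib)
    ultimately have "linear_functional f" by (simp add: linear_functional_iff)
    moreover have "norm (f x) \<le> 2 * p x" for x
      using cmod_le[of "f x"] gp[of x] gp[of "smul \<i> x"]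
      by (simp add: f_def seminorm_scale[OF p(1)])
    moreover have "f y \<noteq> 0" using g p by (simp add: f_def complex_eq_iff)
    ultimately show "\<exists>f. linear_functional f \<and> f y \<noteq> 0 \<and> (\<forall>x. norm (f x) \<le> 2 * p x)"
      by blast
  qed
qed

subsection \<open>The Banach disc of an l1-sequence\<close>

locale l1_lcs = hausdorff_lcs smul
  for smul :: "'k::{real_normed_field, banach} \<Rightarrow>
    'a::{real_vector, topological_ab_group_add, t2_space} \<Rightarrow> 'a" +
  fixes w :: "nat \<Rightarrow> 'a"
  assumes l1: "l1_sequence smul w"
begin

text \<open>The image of a closed ball of l1 under summation against \<open>w\<close>. Membership
  replaces a norm bound: it records one representation of size at most \<open>r\<close>, so no
  infimum over representations has to be handled. For negative \<open>r\<close> the set is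
  empty.\<close>

definition l1_ball :: "real \<Rightarrow> 'a set"
  where "l1_ball r = {x. \<exists>c. summable (\<lambda>n. norm (c n)) \<and> (\<Sum>n. norm (c n)) \<le> r \<and>
    (\<lambda>n. smul (c n) (w n)) sums x}"

lemma l1_ballI:
  "summable (\<lambda>n. norm (c n)) \<Longrightarrow> (\<Sum>n. norm (c n)) \<le> r \<Longrightarrow> (\<lambda>n. smul (c n) (w n)) sums x \<Longrightarrow>
    x \<in> l1_ball r"
  by (auto simp: l1_ball_def)

lemma l1_ball_mono: "x \<in> l1_ball r \<Longrightarrow> r \<le> s \<Longrightarrow> x \<in> l1_ball s"
  unfolding l1_ball_def by (auto intro: order_trans)

lemma sums_smul: "f sums s \<Longrightarrow> (\<lambda>n. smul c (f n)) sums smul c s"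
  unfolding sums_def using continuous_on_tendsto_compose[OF continuous_smul_right, of "\<lambda>n. sum f {..<n}" s sequentially c]
  by (simp add: scale_sum_right)

lemma l1_ball_add:
  assumes "x \<in> l1_ball r" "y \<in> l1_ball s"
  shows "x + y \<in> l1_ball (r + s)"
proof -
  obtain c where c: "summable (\<lambda>n. norm (c n))" "(\<Sum>n. norm (c n)) \<le> r" "(\<lambda>n. smul (c n) (w n)) sums x"
    using assms(1) by (auto simp: l1_ball_def)
  obtain d where d: "summable (\<lambda>n. norm (d n))" "(\<Sum>n. norm (d n)) \<le> s" "(\<lambda>n. smul (d n) (w n)) sums y"
    using assms(2) by (auto simp: l1_ball_def)
  have cd: "summable (\<lambda>n. norm (c n + d n))"
    by (rule summable_comparison_test'[OF summable_add[OF c(1) d(1)]]) (simp add: norm_triangle_ineq)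
  show ?thesis
  proof (rule l1_ballI)
    show "summable (\<lambda>n. norm (c n + d n))" by (rule cd)
    have "(\<Sum>n. norm (c n + d n)) \<le> (\<Sum>n. norm (c n) + norm (d n))"
      by (intro suminf_le norm_triangle_ineq cd summable_add c d)
    then show "(\<Sum>n. norm (c n + d n)) \<le> r + s"
      using suminf_add[OF c(1) d(1)] c(2) d(2) by simp
    show "(\<lambda>n. smul (c n + d n) (w n)) sums (x + y)"
      using sums_add[OF c(3) d(3)] by (simp add: scale_left_distrib)
  qed
qed

lemma l1_ball_scale:
  assumes "x \<in> l1_ball r"
  shows "smul b x \<in> l1_ball (norm b * r)"
proof -
  obtain c where c: "summable (\<lambda>n. norm (c n))" "(\<Sum>n. norm (c n)) \<le> r" "(\<lambda>n. smul (c n) (w n)) sums x"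
    using assms(1) by (auto simp: l1_ball_def)
  show ?thesis
  proof (rule l1_ballI)
    show "summable (\<lambda>n. norm (b * c n))"
      using summable_mult[OF c(1), of "norm b"] by (simp add: norm_mult)
    show "(\<Sum>n. norm (b * c n)) \<le> norm b * r"
      using c(2) suminf_mult[OF c(1), of "norm b"] by (simp add: norm_mult mult_left_mono)
    show "(\<lambda>n. smul (b * c n) (w n)) sums smul b x"
      using sums_smul[OF c(3), of b] by simp
  qed
qed

lemma zero_in_l1_ball: "0 \<le> r \<Longrightarrow> 0 \<in> l1_ball r"
  by (rule l1_ballI[of "\<lambda>_. 0"]) auto

lemma l1_ball_nonneg: "x \<in> l1_ball r \<Longrightarrow> 0 \<le> r"
  unfolding l1_ball_def by (auto intro: order_trans[OF suminf_nonneg])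

lemma l1_ball_sum:
  "finite I \<Longrightarrow> (\<And>i. i \<in> I \<Longrightarrow> f i \<in> l1_ball (r i)) \<Longrightarrow> sum f I \<in> l1_ball (sum r I)"
  by (induction I rule: finite_induct) (auto simp: zero_in_l1_ball l1_ball_add)

lemma generator_in_l1_ball: "w n \<in> l1_ball 1"
proof (rule l1_ballI)
  have "(\<lambda>m. norm (if m = n then 1 else 0 :: 'k)) = (\<lambda>m. if m = n then 1 else 0)" by auto
  then show "summable (\<lambda>m. norm (if m = n then 1 else 0 :: 'k))"
    "(\<Sum>m. norm (if m = n then 1 else 0 :: 'k)) \<le> 1"
    using sums_single[of n "\<lambda>_. 1 :: real"] by (auto simp: sums_iff)
  have "(\<lambda>m. smul (if m = n then 1 else 0) (w m)) = (\<lambda>m. if m = n then w m else 0)" by auto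
  then show "(\<lambda>m. smul (if m = n then 1 else 0) (w m)) sums w n"
    using sums_single[of n w] by simp
qed

lemma span_in_l1_ball:
  assumes "x \<in> span (range w)"
  shows "\<exists>r>0. x \<in> l1_ball r"
  using assms
proof (induction rule: span_induct_alt)
  case base
  then show ?case by (intro exI[of _ 1]) (simp add: zero_in_l1_ball)
next
  case (step c x y)
  then obtain r n where "r > 0" "y \<in> l1_ball r" "x = w n" by blast
  then have "smul c x + y \<in> l1_ball (norm c * 1 + r)"
    using l1_ball_add[OF l1_ball_scale[OF generator_in_l1_ball]] by blast
  then show ?case using \<open>r > 0\<close> by (intro exI[of _ "norm c * 1 + r"]) (auto simp: add_nonneg_pos)
qed

text \<open>\<open>C\<close> bounds \<open>p\<close> along \<open>w\<close>, which is possible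
  because \<open>w\<close> tends to 0; partial sums then obey the bound, and continuity of
  \<open>p\<close> passes it to the limit.\<close>

lemma l1_ball_seminorm_bound:
  assumes p: "seminorm p" "continuous_on UNIV p"
  obtains C where "C > 0" "\<And>r x. x \<in> l1_ball r \<Longrightarrow> p x \<le> C * r"
proof -
  have "w \<longlonglongrightarrow> 0" using l1 by (simp add: l1_sequence_def)
  then have "(\<lambda>n. p (w n)) \<longlonglongrightarrow> p 0"
    by (intro continuous_on_tendsto_compose[OF p(2)]) auto
  then have "Bseq (\<lambda>n. p (w n))" by (rule convergent_imp_Bseq[OF convergentI])
  then obtain C where C: "C > 0" "\<And>n. norm (p (w n)) \<le> C" by (auto elim: BseqE)
  have "p x \<le> C * r" if x: "x \<in> l1_ball r" for r x
  proof -
    obtain c where c: "summable (\<lambda>n. norm (c n))" "(\<Sum>n. norm (c n)) \<le> r" "(\<lambda>n. smul (c n) (w n)) sums x"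
      using x by (auto simp: l1_ball_def)
    have le: "p (\<Sum>n<m. smul (c n) (w n)) \<le> C * (\<Sum>n<m. norm (c n))" for m
    proof (induction m)
      case (Suc m)
      have "p (\<Sum>n<Suc m. smul (c n) (w n)) \<le> p (\<Sum>n<m. smul (c n) (w n)) + norm (c m) * p (w m)"
        using seminorm_add[OF p(1), of "\<Sum>n<m. smul (c n) (w n)" "smul (c m) (w m)"]
        by (simp add: seminorm_scale[OF p(1)])
      also have "\<dots> \<le> C * (\<Sum>n<m. norm (c n)) + norm (c m) * C"
        using Suc C(2)[of m] by (intro add_mono mult_left_mono) auto
      finally show ?case by (simp add: algebra_simps)
    qed (simp add: seminorm_zero[OF p(1)])
    have "(\<lambda>m. p (\<Sum>n<m. smul (c n) (w n))) \<longlonglongrightarrow> p x"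
      using c(3) unfolding sums_def by (intro continuous_on_tendsto_compose[OF p(2)]) auto
    moreover have "p (\<Sum>n<m. smul (c n) (w n)) \<le> C * r" for m
    proof -
      have "(\<Sum>n<m. norm (c n)) \<le> r"
        using sum_le_suminf[OF c(1), of "{..<m}"] c(2) by auto
      then show ?thesis using le[of m] C(1) by (meson mult_left_mono less_imp_le order_trans)
    qed
    ultimately show ?thesis by (intro LIMSEQ_le_const2) auto
  qed
  with C(1) show ?thesis using that by blast
qed

lemma l1_ball_in_neighbourhood:
  assumes "open U" "0 \<in> U"
  obtains e where "e > 0" "l1_ball e \<subseteq> U"
proof -
  obtain p where p: "seminorm p" "continuous_on UNIV p" "{x. p x < 1} \<subseteq> U"
    using minkowski_seminorm[OF assms] by blast
  obtain C where C: "C > 0" "\<And>r x. x \<in> l1_ball r \<Longrightarrow> p x \<le> C * r"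
    using l1_ball_seminorm_bound[OF p(1,2)] by blast
  have "x \<in> U" if "x \<in> l1_ball (1 / (2 * C))" for x
    using C(2)[OF that] C(1) p(3) by auto
  then show ?thesis using that[of "1 / (2 * C)"] C(1) by auto
qed

lemma l1_ball_tendsto:
  assumes "\<And>m. s - f m \<in> l1_ball (R m)" "R \<longlonglongrightarrow> 0"
  shows "f \<longlonglongrightarrow> s"
proof (rule topological_tendstoI)
  fix U assume U: "open U" "s \<in> U"
  have "open ((\<lambda>z. s - z) -` U)" by (intro open_vimage[OF U(1)] continuous_intros)
  then obtain e where e: "e > 0" "l1_ball e \<subseteq> (\<lambda>z. s - z) -` U"
    using l1_ball_in_neighbourhood[of "(\<lambda>z. s - z) -` U"] U(2) by auto
  have "\<forall>\<^sub>F m in sequentially. R m < e" using assms(2) e(1) by (rule order_tendstoD)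
  then show "\<forall>\<^sub>F m in sequentially. f m \<in> U"
  proof eventually_elim
    case (elim m)
    then have "s - f m \<in> l1_ball e" using assms(1) by (meson l1_ball_mono less_imp_le)
    then have "s - (s - f m) \<in> U" using e(2) by blast
    then show ?case by simp
  qed
qed

end

text \<open>Completeness of l1 in coordinates: an absolutely convergent series of l1-vectors is
  summed entry by entry. Interchanging the double series of norms over finitely many entries
  suffices.\<close>

lemma suminf_swap_norm_le:
  fixes c :: "nat \<Rightarrow> nat \<Rightarrow> 'k::banach"
  assumes "\<And>n. summable (\<lambda>i. norm (c n i))" "\<And>n. (\<Sum>i. norm (c n i)) \<le> r n" "summable r"
  shows "summable (\<lambda>n. c n i)" "summable (\<lambda>i. norm (\<Sum>n. c n i))" "(\<Sum>i. norm (\<Sum>n. c n i)) \<le> suminf r"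
proof -
  have le: "(\<Sum>i\<in>I. norm (c n i)) \<le> r n" if "finite I" for n I
    by (rule order_trans[OF sum_le_suminf[OF assms(1) that] assms(2)]) simp
  have s: "summable (\<lambda>n. norm (c n i))" for i
    by (rule summable_comparison_test'[OF assms(3), of 0]) (use le[of "{i}"] in simp)
  then show "summable (\<lambda>n. c n i)" by (rule summable_norm_cancel)
  have b: "(\<Sum>i<m. norm (\<Sum>n. c n i)) \<le> suminf r" for m
  proof -
    have "(\<Sum>i<m. norm (\<Sum>n. c n i)) \<le> (\<Sum>i<m. \<Sum>n. norm (c n i))"
      by (intro sum_mono summable_norm s)
    also have "\<dots> = (\<Sum>n. \<Sum>i<m. norm (c n i))" by (intro suminf_sum[symmetric] s)
    also have "\<dots> \<le> suminf r"
      by (rule suminf_le[OF le summable_sum assms(3)]) (simp_all add: s)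
    finally show ?thesis .
  qed
  then show "summable (\<lambda>i. norm (\<Sum>n. c n i))" by (intro summableI_nonneg_bounded[where x = "suminf r"]) simp_all
  then show "(\<Sum>i. norm (\<Sum>n. c n i)) \<le> suminf r" by (rule suminf_le_const[OF _ b])
qed

context l1_lcs
begin

text \<open>The sets \<open>l1_ball r\<close> are the balls of a Banach space continuously included in the whole space.\<close>

lemma l1_ball_suminf:
  assumes t: "\<And>n. t n \<in> l1_ball (r n)" and r: "summable r"
  shows "summable t" and "suminf t \<in> l1_ball (suminf r)"
proof -
  obtain c where c: "\<And>n. summable (\<lambda>i. norm (c n i))" "\<And>n. (\<Sum>i. norm (c n i)) \<le> r n"
    "\<And>n. (\<lambda>i. smul (c n i) (w i)) sums t n"
    using t unfolding l1_ball_def mem_Collect_eq by metis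
  note 0 = suminf_swap_norm_le[OF c(1,2) r]
  define a where "a i = (\<Sum>n. c n i)" for i
  have "summable (\<lambda>i. smul (a i) (w i))" using l1 0(2) by (simp add: l1_sequence_def a_def)
  then obtain s where s: "(\<lambda>i. smul (a i) (w i)) sums s" by (auto simp: summable_def)
  \<comment> \<open>The remainder is represented by the tails of the coefficients, taken entry by
    entry; this gives convergence together with a rate.\<close>
  have "s - (\<Sum>n<m. t n) \<in> l1_ball (\<Sum>n. r (n + m))" for m
  proof (rule l1_ballI)
    have "summable (\<lambda>n. r (n + m))" using r by (rule summable_ignore_initial_segment)
    note 1 = suminf_swap_norm_le[OF c(1,2) this]
    show "summable (\<lambda>i. norm (\<Sum>n. c (n + m) i))" "(\<Sum>i. norm (\<Sum>n. c (n + m) i)) \<le> (\<Sum>n. r (n + m))"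
      using 1 by auto
    have "(\<Sum>n. c (n + m) i) = a i - (\<Sum>n<m. c n i)" for i
      using suminf_minus_initial_segment[OF 0(1), of m i] by (simp add: a_def)
    moreover have "(\<lambda>i. \<Sum>n<m. smul (c n i) (w i)) sums (\<Sum>n<m. t n)" by (intro sums_sum c(3))
    ultimately show "(\<lambda>i. smul (\<Sum>n. c (n + m) i) (w i)) sums (s - (\<Sum>n<m. t n))"
      using sums_add[OF s sums_smul[of _ _ "- 1"]]
      by (simp add: scale_left_diff_distrib scale_sum_left scale_minus_left)
  qed
  moreover have "(\<lambda>m. \<Sum>n. r (n + m)) \<longlonglongrightarrow> 0"
    using tendsto_diff[OF tendsto_const summable_LIMSEQ[OF r], of "suminf r"]
    by (simp add: suminf_minus_initial_segment[OF r])
  ultimately have "t sums s" unfolding sums_def by (rule l1_ball_tendsto)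
  moreover have "s \<in> l1_ball (suminf r)"
    using 0 s by (intro l1_ballI) (auto simp: a_def)
  ultimately show "summable t" "suminf t \<in> l1_ball (suminf r)" by (auto simp: sums_iff)
qed

end

subsection \<open>Biorthogonal systems\<close>

context hausdorff_lcs
begin

lemma subspace_closure:
  assumes "subspace S"
  shows "subspace (closure S)"
proof -
  have image: "F ` closure S \<subseteq> closure S" if "continuous_on UNIV F" "F ` S \<subseteq> closure S" for F
    using image_closure_subset[OF continuous_on_subset[OF that(1)] closed_closure that(2)] by blast
  \<comment> \<open>The sum is treated one argument at a time: first with one summand in
    \<open>S\<close>, then with both in the closure.\<close>
  have 1: "x + y \<in> closure S" if "x \<in> S" "y \<in> closure S" for x y
  proof -
    have "(\<lambda>y. x + y) ` closure S \<subseteq> closure S"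
      using assms that closure_subset[of S]
      by (intro image continuous_intros) (auto intro: subspace_add)
    then show ?thesis using that by blast
  qed
  have 2: "x + y \<in> closure S" if "x \<in> closure S" "y \<in> closure S" for x y
  proof -
    have "(\<lambda>x. x + y) ` closure S \<subseteq> closure S"
      using 1 that by (intro image continuous_intros) auto
    then show ?thesis using that by blast
  qed
  have 3: "smul c x \<in> closure S" if "x \<in> closure S" for c x
  proof -
    have "smul c ` closure S \<subseteq> closure S"
      using assms closure_subset[of S]
      by (intro image continuous_smul_right) (auto intro: subspace_scale)
    then show ?thesis using that by blast
  qed
  show ?thesis
    using 2 3 subspace_0[OF assms] closure_subset[of S] by (auto simp: subspace_def)
qed

end

lemma closure_UNIV_open_meets:
  assumes "closure S = UNIV" "open U" "U \<noteq> {}"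
  shows "\<exists>x\<in>S. x \<in> U"
  using assms open_Int_closure_eq_empty[of U S] by auto

context l1_lcs
begin

text \<open>One Gram-Schmidt step. A remainder of \<open>w'\<close> visible to \<open>p\<close>
  becomes the new vector. Otherwise the remainder is a \<open>p\<close>-null vector
  \<open>u\<close>, kept so that \<open>w'\<close> stays in the span, and the new vector is found
  elsewhere in \<open>span W\<close>.\<close>

lemma biorthogonal_extend:
  fixes Y :: "nat \<Rightarrow> 'a" and G :: "nat \<Rightarrow> 'a \<Rightarrow> 'k"
  assumes p: "seminorm p" "continuous_on UNIV p"
    and infinite: "\<forall>F. finite F \<longrightarrow> (\<forall>f\<in>F. linear_functional f \<and> continuous_on UNIV f) \<longrightarrow>
      (\<exists>x. (\<forall>f\<in>F. f x = 0) \<and> p x \<noteq> 0)"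
    and "enough_functionals" and dense: "closure (span W) = UNIV"
    and G: "\<And>i. i < n \<Longrightarrow> linear_functional (G i)" "\<And>i x. i < n \<Longrightarrow> norm (G i x) \<le> p x"
    and bi: "\<And>i j. i < n \<Longrightarrow> j < n \<Longrightarrow> G i (Y j) = of_bool (i = j)"
    and Y: "\<And>i. i < n \<Longrightarrow> Y i \<in> span W" and w': "w' \<in> span W"
  obtains y g u where "linear_functional g" "\<forall>x. norm (g x) \<le> p x" "g y = 1"
    "\<forall>i<n. G i y = 0 \<and> g (Y i) = 0 \<and> G i u = 0" "p u = 0" "y \<in> span W" "u \<in> span W" "w' \<in> span (insert u (insert y (Y ` {..<n})))"
proof -
  \<comment> \<open>The projection onto the common kernel of the \<open>G i\<close>;
    \<open>M\<close> bounds it with respect to \<open>p\<close>.\<close>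
  define \<Phi> where "\<Phi> x = x - (\<Sum>i<n. smul (G i x) (Y i))" for x
  define M where "M = 1 + (\<Sum>i<n. p (Y i))"
  have M: "M \<ge> 1" unfolding M_def by (simp add: sum_nonneg seminorm_nonneg[OF p(1)])
  have \<Phi>_span: "\<Phi> x \<in> span W" if "x \<in> span W" for x
    unfolding \<Phi>_def using that Y by (intro span_diff span_sum span_scale) auto
  have G\<Phi>: "G j (\<Phi> x) = 0" if "j < n" for j x
  proof -
    have "G j (\<Phi> x) = G j x - (\<Sum>i<n. G i x * of_bool (j = i))"
      unfolding \<Phi>_def
      by (simp add: linear_functional_diff linear_functional_sum linear_functional_scale G that bi)
    also have "(\<Sum>i<n. G i x * of_bool (j = i)) = (\<Sum>i<n. if i = j then G i x else 0)"
      by (intro sum.cong) auto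
    finally show ?thesis using that by simp
  qed
  have p_sum: "p (sum f I) \<le> (\<Sum>i\<in>I. p (f i))" for f and I :: "nat set"
    by (induction I rule: infinite_finite_induct)
      (auto simp: seminorm_zero[OF p(1)] intro: order_trans[OF seminorm_add[OF p(1)]])
  have \<Phi>_bound: "p (\<Phi> x) \<le> M * p x" for x
  proof -
    have "p (\<Sum>i<n. smul (G i x) (Y i)) \<le> (\<Sum>i<n. p x * p (Y i))"
      by (intro order_trans[OF p_sum] sum_mono)
        (auto simp: seminorm_scale[OF p(1)] intro!: mult_right_mono G seminorm_nonneg[OF p(1)])
    then show ?thesis
      using seminorm_diff[OF p(1), of x "\<Sum>i<n. smul (G i x) (Y i)"]
      by (simp add: \<Phi>_def M_def sum_distrib_left algebra_simps)
  qed
  have \<Phi>_diff: "\<Phi> (x - z) = \<Phi> x - \<Phi> z" for x z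
    by (simp add: \<Phi>_def linear_functional_diff G scale_left_diff_distrib sum_subtractf)
  obtain y0 u where y0: "y0 \<in> span W" "\<And>i. i < n \<Longrightarrow> G i y0 = 0" "p y0 \<noteq> 0"
    and u: "u \<in> span W" "\<And>i. i < n \<Longrightarrow> G i u = 0" "p u = 0" and y0u: "\<Phi> w' = u \<or> \<Phi> w' = y0"
  proof (cases "p (\<Phi> w') = 0")
    case False
    then show ?thesis
      using that[of "\<Phi> w'" 0] G\<Phi> \<Phi>_span[OF w']
      by (simp add: span_zero seminorm_zero[OF p(1)] linear_functional_zero G)
  next
    case True
    \<comment> \<open>A vector of the common kernel outside the null space of \<open>p\<close>
      exists, but perhaps not in \<open>span W\<close>. It is approximated from there within
      \<open>p x / M\<close>, which after projection leaves an error below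
      \<open>p x\<close>.\<close>
    have "\<exists>x. (\<forall>f\<in>G ` {..<n}. f x = 0) \<and> p x \<noteq> 0"
    proof (rule infinite[rule_format])
      fix f assume "f \<in> G ` {..<n}"
      then show "linear_functional f \<and> continuous_on UNIV f"
        using G by (auto intro!: bounded_functional_continuous[OF p] linear_functional_diff)
    qed simp
    then obtain x where x: "\<And>i. i < n \<Longrightarrow> G i x = 0" "p x \<noteq> 0" by auto
    then have px: "p x > 0" using seminorm_nonneg[OF p(1), of x] by simp
    have "x \<in> {z. p (z - x) < p x / M}" using px M by (simp add: seminorm_zero[OF p(1)])
    then obtain z where z: "z \<in> span W" "p (z - x) < p x / M"
      using closure_UNIV_open_meets[OF dense open_seminorm_ball[OF p(2), of x "p x / M"]] by blast
    have "\<Phi> x = x" using x by (simp add: \<Phi>_def)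
    then have "p x \<le> p (\<Phi> z) + p (\<Phi> (z - x))"
      using seminorm_diff[OF p(1), of "\<Phi> z" "\<Phi> (z - x)"] by (simp add: \<Phi>_diff)
    also have "p (\<Phi> (z - x)) < p x"
      using \<Phi>_bound[of "z - x"] z(2) M by (simp add: field_simps)
    finally have "p (\<Phi> z) \<noteq> 0" by simp
    then show ?thesis
      using that[of "\<Phi> z" "\<Phi> w'"] G\<Phi> \<Phi>_span w' z True by blast
  qed
  obtain h where h: "linear_functional h" "h y0 \<noteq> 0" "\<And>x. norm (h x) \<le> 2 * p x"
    using assms(4) p(1) y0(3) unfolding enough_functionals_def by blast
  \<comment> \<open>After subtracting multiples of the \<open>G i\<close>, \<open>h\<close> is
    bounded by \<open>B * p\<close>: 2 comes from \<open>h\<close>, the rest from the correction.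
    Dividing by \<open>B\<close> restores the bound \<open>p\<close>, and \<open>y\<close> is
    rescaled so that \<open>g y = 1\<close>.\<close>
  define B where "B = 2 + (\<Sum>i<n. norm (h (Y i)))"
  have B: "B > 0" unfolding B_def by (intro add_pos_nonneg sum_nonneg) auto
  define g where "g x = (h x - (\<Sum>i<n. h (Y i) * G i x)) / of_real B" for x
  define y where "y = smul (of_real B / h y0) y0"
  have "linear_functional g"
    unfolding linear_functional_iff g_def
    by (auto simp: linear_functional_add linear_functional_scale h G algebra_simps sum.distrib
        sum_distrib_left add_divide_distrib diff_divide_distrib)
  moreover have "norm (g x) \<le> p x" for x
  proof -
    have "norm (\<Sum>i<n. h (Y i) * G i x) \<le> (\<Sum>i<n. norm (h (Y i)) * p x)"
      by (intro sum_norm_le) (auto simp: norm_mult intro!: mult_left_mono G)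
    then have "norm (h x - (\<Sum>i<n. h (Y i) * G i x)) \<le> B * p x"
      using h(3)[of x] norm_triangle_ineq4[of "h x" "\<Sum>i<n. h (Y i) * G i x"]
      by (simp add: B_def sum_distrib_right distrib_right)
    then show ?thesis using B by (simp add: g_def norm_divide field_simps)
  qed
  moreover have "g y = 1"
    using B h(2) y0(2)
    by (simp add: g_def y_def linear_functional_scale h(1) G field_simps)
  moreover have "G i y = 0" if "i < n" for i
    using y0(2) that by (simp add: y_def linear_functional_scale G)
  moreover have "g (Y j) = 0" if "j < n" for j
  proof -
    have "(\<Sum>i<n. h (Y i) * G i (Y j)) = (\<Sum>i<n. if i = j then h (Y i) else 0)"
      using bi that by (intro sum.cong) auto
    then show ?thesis using that by (simp add: g_def)
  qed
  moreover have "y \<in> span W" using y0(1) by (simp add: y_def span_scale)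
  moreover have "w' \<in> span (insert u (insert y (Y ` {..<n})))"
  proof -
    let ?V = "span (insert u (insert y (Y ` {..<n})))"
    have "y0 = smul (h y0 / of_real B) y" using B h(2) by (simp add: y_def)
    moreover have "y \<in> ?V" by (intro span_base) simp
    ultimately have "y0 \<in> ?V" by (metis span_scale)
    moreover have "u \<in> ?V" by (intro span_base) simp
    ultimately have "\<Phi> w' \<in> ?V" using y0u by auto
    moreover have "(\<Sum>i<n. smul (G i w') (Y i)) \<in> ?V"
      by (intro span_sum span_scale span_base) auto
    ultimately have "\<Phi> w' + (\<Sum>i<n. smul (G i w') (Y i)) \<in> ?V" by (rule span_add)
    then show ?thesis by (simp add: \<Phi>_def)
  qed
  ultimately show ?thesis using u by (intro that[of g y u]) auto
qed

text \<open>Functionals bounded by \<open>p\<close> vanish on the null vectors \<open>u k\<close>,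
  so these cannot be members of the system. Adding multiples of them to the \<open>Y n\<close>
  changes no value of the \<open>f i\<close> and still brings them into the closed span.\<close>

lemma biorthogonal_system:
  assumes p: "seminorm p" "continuous_on UNIV p"
    and infinite: "\<forall>F. finite F \<longrightarrow> (\<forall>f\<in>F. linear_functional f \<and> continuous_on UNIV f) \<longrightarrow>
      (\<exists>x. (\<forall>f\<in>F. f x = 0) \<and> p x \<noteq> 0)"
    and functionals: "enough_functionals" and dense: "closure (span (range w)) = UNIV"
  obtains x :: "nat \<Rightarrow> 'a" and f where "\<forall>i. linear_functional (f i)" "\<forall>i z. norm (f i z) \<le> p z"
    "\<forall>i j. f i (x j) = of_bool (i = j)" "\<forall>i. x i \<in> span (range w)"
    "closure (span (range x)) = UNIV"
proof -
  let ?W = "range w"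
  define P where "P \<phi> n r \<longleftrightarrow> (case r of (y, g, u) \<Rightarrow>
      linear_functional g \<and> (\<forall>x. norm (g x) \<le> p x) \<and> g y = 1 \<and>
      (\<forall>i<n. fst (snd (\<phi> i)) y = 0 \<and> g (fst (\<phi> i)) = 0 \<and> fst (snd (\<phi> i)) u = 0) \<and>
      p u = 0 \<and> y \<in> span ?W \<and> u \<in> span ?W \<and>
      w n \<in> span (insert u (insert y ((\<lambda>i. fst (\<phi> i)) ` {..<n}))))"
    for \<phi> :: "nat \<Rightarrow> 'a \<times> ('a \<Rightarrow> 'k) \<times> 'a" and n r
  \<comment> \<open>\<open>u\<close> takes up \<open>w n\<close> whenever \<open>p\<close> vanishes on the remainder of \<open>w n\<close> modulo the previous vectors.\<close>
  have "\<exists>\<phi>. \<forall>n. P \<phi> n (\<phi> n)"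
  proof (rule dependent_wellorder_choice)
    fix r and \<phi> \<psi> :: "nat \<Rightarrow> 'a \<times> ('a \<Rightarrow> 'k) \<times> 'a" and n :: nat
    assume "\<And>i. i < n \<Longrightarrow> \<phi> i = \<psi> i"
    moreover from this have "(\<lambda>i. fst (\<phi> i)) ` {..<n} = (\<lambda>i. fst (\<psi> i)) ` {..<n}"
      by (intro image_cong) auto
    ultimately show "P \<phi> n r = P \<psi> n r" by (simp add: P_def)
  next
    fix n :: nat and \<phi>
    assume IH: "\<And>i. i < n \<Longrightarrow> P \<phi> i (\<phi> i)"
    define Y G where "Y i = fst (\<phi> i)" and "G i = fst (snd (\<phi> i))" for i
    have G: "linear_functional (G i)" "norm (G i x) \<le> p x" and Yi: "Y i \<in> span ?W" and "G i (Y i) = 1"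
      if "i < n" for i x
      using IH[OF that] by (auto simp: P_def Y_def G_def split: prod.splits)
    moreover have "G i (Y j) = 0 \<and> G j (Y i) = 0" if "i < j" "j < n" for i j
      using IH[OF that(2)] that(1) by (auto simp: P_def Y_def G_def split: prod.splits)
    ultimately have bi: "G i (Y j) = of_bool (i = j)" if "i < n" "j < n" for i j
      using that by (cases i j rule: linorder_cases) auto
    have wn: "w n \<in> span ?W" by (intro span_base) simp
    obtain y g u where "linear_functional g" "\<forall>x. norm (g x) \<le> p x" "g y = 1"
      "\<forall>i<n. G i y = 0 \<and> g (Y i) = 0 \<and> G i u = 0"
      "p u = 0" "y \<in> span ?W" "u \<in> span ?W" "w n \<in> span (insert u (insert y (Y ` {..<n})))"
      by (rule biorthogonal_extend[OF p infinite functionals dense G bi Yi wn])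
    then have "P \<phi> n (y, g, u)" by (simp add: P_def Y_def G_def)
    then show "\<exists>r. P \<phi> n r" by blast
  qed
  then obtain \<phi> where \<phi>: "\<And>n. P \<phi> n (\<phi> n)" by blast
  define Y f u where "Y i = fst (\<phi> i)" and "f i = fst (snd (\<phi> i))" and "u i = snd (snd (\<phi> i))" for i
  have f: "linear_functional (f i)" "norm (f i z) \<le> p z" and "f i (Y i) = 1"
    and Yu: "Y i \<in> span ?W" "u i \<in> span ?W" "p (u i) = 0"
    and wi: "w i \<in> span (insert (u i) (insert (Y i) (Y ` {..<i})))" for i z
    using \<phi>[of i] by (auto simp: P_def Y_def f_def u_def split: prod.splits)
  moreover have less: "f i (Y j) = 0 \<and> f j (Y i) = 0 \<and> f i (u j) = 0" if "i < j" for i j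
    using \<phi>[of j] that by (auto simp: P_def Y_def f_def u_def split: prod.splits)
  ultimately have bi: "f i (Y j) = of_bool (i = j)" for i j
    by (cases i j rule: linorder_cases) auto
  have fu: "f i (u j) = 0" for i j
    using f(2)[of i "u j"] Yu(3)[of j] by simp
  obtain \<beta> where \<beta>: "\<And>n. \<beta> n > 0" "\<And>n. Y n \<in> l1_ball (\<beta> n)"
    using span_in_l1_ball[OF Yu(1)] by metis
  \<comment> \<open>\<open>\<beta> n\<close> makes \<open>Y n / s n\<close> of size
    \<open>1 / Suc n\<close>, which tends to 0 along every sequence of indices carrying the same
    \<open>u k\<close>.\<close>
  define s where "s n = real (Suc n) * \<beta> n" for n
  have s: "s n > 0" for n using \<beta>(1)[of n] by (simp add: s_def)
  \<comment> \<open>Each \<open>u k\<close> is added infinitely often, with factors so large that it is a limit of multiples of the \<open>x n\<close>.\<close>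
  define x where "x n = Y n + smul (of_real (s n)) (u (fst (prod_decode n)))" for n
  let ?C = "closure (span (range x))"
  have C: "subspace ?C" by (intro subspace_closure subspace_span)
  have xC: "x n \<in> ?C" for n by (intro subsetD[OF closure_subset] span_base) simp
  have uC: "u k \<in> ?C" for k
  proof -
    define t where "t m = smul (of_real (1 / s (prod_encode (k, m)))) (x (prod_encode (k, m)))" for m
    have "u k - t m \<in> l1_ball (inverse (real (Suc m)))" for m
    proof -
      define n where "n = prod_encode (k, m)"
      have k: "fst (prod_decode n) = k" by (simp add: n_def)
      have "t m = smul (of_real (1 / s n)) (x n)" by (simp add: t_def n_def)
      also have "\<dots> = smul (of_real (1 / s n)) (Y n) + u k"
        unfolding x_def k using s[of n] by (simp add: scale_right_distrib)
      finally have "t m = smul (of_real (1 / s n)) (Y n) + u k" .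
      then have "u k - t m = smul (- of_real (1 / s n)) (Y n)" by (simp add: scale_minus_left)
      also have "\<dots> \<in> l1_ball (norm (- of_real (1 / s n) :: 'k) * \<beta> n)"
        by (intro l1_ball_scale \<beta>)
      also have "norm (- of_real (1 / s n) :: 'k) * \<beta> n = inverse (real (Suc n))"
        unfolding norm_minus_cancel norm_of_real
        using \<beta>(1)[of n] by (simp add: s_def field_simps del: of_nat_Suc)
      finally show ?thesis
        by (rule l1_ball_mono) (use le_prod_encode_2[of m k] in \<open>simp add: n_def le_imp_inverse_le\<close>)
    qed
    then have "t \<longlonglongrightarrow> u k" by (rule l1_ball_tendsto) (rule LIMSEQ_inverse_real_of_nat)
    moreover have "t m \<in> ?C" for m unfolding t_def by (intro subspace_scale[OF C] xC)
    ultimately show ?thesis by (intro Lim_in_closed_set[of ?C t]) auto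
  qed
  have "Y n \<in> ?C" for n
  proof -
    have "Y n = x n - smul (of_real (s n)) (u (fst (prod_decode n)))" by (simp add: x_def)
    also have "\<dots> \<in> ?C" by (intro subspace_diff[OF C] subspace_scale[OF C] xC uC)
    finally show ?thesis .
  qed
  then have "insert (u i) (insert (Y i) (Y ` {..<i})) \<subseteq> ?C" for i using uC by auto
  then have "w i \<in> ?C" for i using subsetD[OF span_minimal[OF _ C] wi[of i]] by simp
  then have "span ?W \<subseteq> ?C" by (intro span_minimal C) auto
  then have "closure (span ?W) \<subseteq> ?C" by (intro closure_minimal) auto
  then have "?C = UNIV" using dense by auto
  moreover have "f i (x j) = of_bool (i = j)" for i j
    by (simp add: x_def linear_functional_add linear_functional_scale f bi fu)
  moreover have "x i \<in> span ?W" for i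
    unfolding x_def by (intro span_add span_scale Yu)
  ultimately show ?thesis using f by (intro that[of f x]) auto
qed

end

subsection \<open>Bilateral weighted shifts\<close>

text \<open>A unipotent Jordan block adds to each coefficient its successor; \<open>d L = 0\<close>
  supplies the successor of the last one. The families are abstract because both vectors and
  functional values will be inserted.\<close>

lemma chain_sum:
  fixes E E' :: "nat \<Rightarrow> 'v::real_vector"
  assumes "E' 0 = E 0" "\<And>l. Suc l < L \<Longrightarrow> E' (Suc l) = E (Suc l) + E l" "d L = 0"
  shows "(\<Sum>l<L. d l *\<^sub>R E' l) = (\<Sum>l<L. (d l + d (Suc l)) *\<^sub>R E l)"
proof (cases L)
  case (Suc k)
  have "(\<Sum>l<Suc k. d l *\<^sub>R E' l) = (\<Sum>l<Suc k. d l *\<^sub>R E l) + (\<Sum>l<k. d (Suc l) *\<^sub>R E l)"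
    if "Suc k \<le> L" for k
    using that
  proof (induction k)
    case (Suc k)
    then show ?case using assms(2)[of k] by (simp add: algebra_simps)
  qed (simp add: assms(1))
  from this[of k] show ?thesis
    using assms(3) Suc by (simp add: sum.distrib scaleR_left_distrib)
qed simp

text \<open>The normalisation \<open>p_ball\<close> lets one estimate of an image in a ball also
  serve as an estimate in \<open>p\<close>, with the same constant; this makes powers of the
  operator easy to bound.\<close>

locale weighted_shift = l1_lcs smul w
  for smul :: "'k::{real_normed_field, banach} \<Rightarrow>
    'a::{real_vector, topological_ab_group_add, t2_space} \<Rightarrow> 'a" and w +
  fixes p :: "'a \<Rightarrow> real" and x :: "int \<Rightarrow> 'a" and f :: "int \<Rightarrow> 'a \<Rightarrow> 'k" and \<beta> :: "int \<Rightarrow> real"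
  assumes p: "seminorm p" "continuous_on UNIV p"
    and p_ball: "z \<in> l1_ball r \<Longrightarrow> p z \<le> r"
    and f_linear: "linear_functional (f j)" and f_le: "norm (f j z) \<le> p z"
    and biorthogonal: "f i (x j) = of_bool (i = j)"
    and x_ball: "x j \<in> l1_ball (\<beta> j)" and \<beta>_pos: "\<beta> j > 0"
    and dense: "closure (span (range x)) = UNIV"
begin

lemma p_nonneg: "0 \<le> p z"
  by (rule seminorm_nonneg[OF p(1)])

lemma l1_ball_scaleR: "z \<in> l1_ball r \<Longrightarrow> c *\<^sub>R z \<in> l1_ball (\<bar>c\<bar> * r)"
  using l1_ball_scale[of z r "of_real c"] by (simp add: smul_of_real)

text \<open>The coefficient \<open>\<omega> j * f j z\<close> multiplies \<open>x (j - 1)\<close>,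
  hence the shifted index of \<open>\<beta>\<close>. The total cost bounds the shift as a map from
  \<open>p\<close> into the coefficient balls.\<close>

definition cost :: "(int \<Rightarrow> real) \<Rightarrow> nat \<Rightarrow> real"
  where "cost \<omega> n = \<bar>\<omega> (int_decode n)\<bar> * \<beta> (int_decode n - 1)"

definition bounded_cost :: "(int \<Rightarrow> real) \<Rightarrow> real \<Rightarrow> bool"
  where "bounded_cost \<omega> \<sigma> \<longleftrightarrow> summable (cost \<omega>) \<and> suminf (cost \<omega>) \<le> \<sigma>"

definition shift_term :: "(int \<Rightarrow> real) \<Rightarrow> 'a \<Rightarrow> int \<Rightarrow> 'a"
  where "shift_term \<omega> z j = smul (of_real (\<omega> j) * f j z) (x (j - 1))"

definition shift :: "(int \<Rightarrow> real) \<Rightarrow> 'a \<Rightarrow> 'a"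
  where "shift \<omega> z = (\<Sum>n. shift_term \<omega> z (int_decode n))"

lemma shift_term_ball: "shift_term \<omega> z (int_decode n) \<in> l1_ball (p z * cost \<omega> n)"
proof -
  have "shift_term \<omega> z (int_decode n) \<in>
      l1_ball (norm (of_real (\<omega> (int_decode n)) * f (int_decode n) z) * \<beta> (int_decode n - 1))"
    unfolding shift_term_def by (intro l1_ball_scale x_ball)
  moreover have "norm (of_real (\<omega> (int_decode n)) * f (int_decode n) z) * \<beta> (int_decode n - 1) \<le>
      p z * cost \<omega> n"
    using mult_right_mono[OF f_le[of "int_decode n" z], of "cost \<omega> n"] \<beta>_pos[of "int_decode n - 1"]
    by (simp add: norm_mult cost_def algebra_simps)
  ultimately show ?thesis by (rule l1_ball_mono)
qed

lemma shift_summable: "bounded_cost \<omega> \<sigma> \<Longrightarrow> summable (\<lambda>n. shift_term \<omega> z (int_decode n))"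
  by (intro l1_ball_suminf(1)[OF shift_term_ball] summable_mult) (simp add: bounded_cost_def)

lemma shift_ball:
  assumes "bounded_cost \<omega> \<sigma>"
  shows "shift \<omega> z \<in> l1_ball (\<sigma> * p z)"
proof -
  have s: "summable (cost \<omega>)" "suminf (cost \<omega>) \<le> \<sigma>" using assms by (auto simp: bounded_cost_def)
  have "shift \<omega> z \<in> l1_ball (\<Sum>n. p z * cost \<omega> n)"
    unfolding shift_def by (intro l1_ball_suminf(2)[OF shift_term_ball] summable_mult s)
  then show ?thesis
    by (rule l1_ball_mono) (use s mult_left_mono[OF s(2) p_nonneg] in \<open>simp add: suminf_mult mult.commute\<close>)
qed

lemma shift_add:
  assumes "bounded_cost \<omega> \<sigma>"
  shows "shift \<omega> (y + z) = shift \<omega> y + shift \<omega> z"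
  unfolding shift_def suminf_add[OF shift_summable[OF assms] shift_summable[OF assms]]
  by (simp add: shift_term_def linear_functional_add[OF f_linear] scale_left_distrib distrib_left)

lemma shift_scale:
  assumes "bounded_cost \<omega> \<sigma>"
  shows "shift \<omega> (smul c z) = smul c (shift \<omega> z)"
proof -
  have "(\<lambda>n. smul c (shift_term \<omega> z (int_decode n))) sums smul c (shift \<omega> z)"
    unfolding shift_def by (intro sums_smul summable_sums shift_summable[OF assms])
  then show ?thesis
    unfolding shift_def[of \<omega> "smul c z"]
    by (simp add: shift_term_def linear_functional_scale[OF f_linear] sums_iff mult.left_commute)
qed

lemma shift_add_weights:
  assumes "bounded_cost \<omega> \<sigma>" "bounded_cost \<omega>' \<sigma>'"
  shows "shift (\<lambda>j. \<omega> j + \<omega>' j) z = shift \<omega> z + shift \<omega>' z"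
  unfolding shift_def suminf_add[OF shift_summable[OF assms(1)] shift_summable[OF assms(2)]]
  by (simp add: shift_term_def scale_left_distrib distrib_right)

lemma shift_finite:
  assumes "finite J" "\<And>j. j \<notin> J \<Longrightarrow> \<omega> j = 0"
  shows "shift \<omega> z = (\<Sum>j\<in>J. shift_term \<omega> z j)"
proof -
  have "shift \<omega> z = (\<Sum>n\<in>int_encode ` J. shift_term \<omega> z (int_decode n))"
    unfolding shift_def
  proof (rule suminf_finite)
    fix n assume "n \<notin> int_encode ` J"
    then have "int_decode n \<notin> J" by (metis image_eqI int_decode_inverse)
    then show "shift_term \<omega> z (int_decode n) = 0" by (simp add: shift_term_def assms(2))
  qed (use assms(1) in simp)
  also have "\<dots> = (\<Sum>j\<in>J. shift_term \<omega> z j)"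
    by (rule sum.reindex_bij_witness[of _ int_encode int_decode]) auto
  finally show ?thesis .
qed

definition oper :: "(int \<Rightarrow> real) \<Rightarrow> 'a \<Rightarrow> 'a"
  where "oper \<omega> z = z + shift \<omega> z"

context
  fixes \<omega> assumes \<omega>: "bounded_cost \<omega> 1"
begin

lemma oper_add: "oper \<omega> (y + z) = oper \<omega> y + oper \<omega> z"
  by (simp add: oper_def shift_add[OF \<omega>])

lemma oper_scale: "oper \<omega> (smul c z) = smul c (oper \<omega> z)"
  by (simp add: oper_def shift_scale[OF \<omega>] scale_right_distrib)

lemma oper_pow_add: "(oper \<omega> ^^ n) (y + z) = (oper \<omega> ^^ n) y + (oper \<omega> ^^ n) z"
  by (induction n) (simp_all add: oper_add)

lemma oper_pow_scale: "(oper \<omega> ^^ n) (smul c z) = smul c ((oper \<omega> ^^ n) z)"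
  by (induction n) (simp_all add: oper_scale)

lemma oper_pow_sum: "(oper \<omega> ^^ n) (sum g I) = (\<Sum>i\<in>I. (oper \<omega> ^^ n) (g i))"
proof (induction I rule: infinite_finite_induct)
  case empty
  show ?case using oper_pow_scale[of n 0 0] by simp
next
  case (infinite A)
  then show ?case using oper_pow_scale[of n 0 0] by simp
qed (simp_all add: oper_pow_add)

lemma oper_pow_diff: "(oper \<omega> ^^ n) (y - z) = (oper \<omega> ^^ n) y - (oper \<omega> ^^ n) z"
  using oper_pow_add[of n y "- z"] oper_pow_scale[of n "- 1" z] by (simp add: scale_minus_left)

lemma oper_p_le: "p (oper \<omega> z) \<le> 2 * p z"
  using seminorm_add[OF p(1), of z "shift \<omega> z"] p_ball[OF shift_ball[OF \<omega>, of z]]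
  by (simp add: oper_def)

lemma oper_pow_p_le: "p ((oper \<omega> ^^ n) z) \<le> 2 ^ n * p z"
proof (induction n)
  case (Suc n)
  then show ?case using oper_p_le[of "(oper \<omega> ^^ n) z"] by simp
qed simp

lemma oper_ball: "z \<in> l1_ball r \<Longrightarrow> oper \<omega> z \<in> l1_ball (2 * r)"
proof -
  assume z: "z \<in> l1_ball r"
  have "shift \<omega> z \<in> l1_ball r"
    using shift_ball[OF \<omega>, of z] p_ball[OF z] by (auto intro: l1_ball_mono)
  from l1_ball_add[OF z this] show ?thesis by (simp add: oper_def)
qed

lemma oper_pow_ball: "z \<in> l1_ball r \<Longrightarrow> (oper \<omega> ^^ n) z \<in> l1_ball (2 ^ n * r)"
proof (induction n)
  case (Suc n)
  then show ?case using oper_ball[of "(oper \<omega> ^^ n) z"] by (simp add: mult.assoc)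
qed simp

lemma oper_linear: "Vector_Spaces.linear smul smul (oper \<omega>)"
proof -
  have "module smul" "vector_space smul" by unfold_locales
  then show ?thesis by (simp add: Vector_Spaces.linear_def module_hom_iff oper_add oper_scale)
qed

lemma oper_continuous: "continuous_on UNIV (oper \<omega>)"
  unfolding oper_def
proof (intro continuous_on_add continuous_on_id additive_continuous[OF p(2)])
  show "shift \<omega> (y - z) = shift \<omega> y - shift \<omega> z" for y z
    using shift_add[OF \<omega>, of y "- z"] shift_scale[OF \<omega>, of "- 1" z] by (simp add: scale_minus_left)
  show "\<exists>e>0. \<forall>z. p z < e \<longrightarrow> shift \<omega> z \<in> U" if "open U" "0 \<in> U" for U
  proof -
    obtain e where e: "e > 0" "l1_ball e \<subseteq> U"
      by (rule l1_ball_in_neighbourhood[OF \<open>open U\<close> \<open>0 \<in> U\<close>])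
    have "shift \<omega> z \<in> l1_ball e" if "p z < e" for z
      using shift_ball[OF \<omega>, of z] that by (auto intro: l1_ball_mono)
    then show ?thesis using e by blast
  qed
qed (rule seminorm_zero[OF p(1)])

end

text \<open>Induction on \<open>T u - T' v = T (u - v) + (T - T') v\<close>. The constant grows with
  \<open>n\<close>, which is harmless because every use fixes \<open>n\<close> before
  \<open>e\<close>.\<close>

lemma oper_perturb:
  assumes \<omega>: "bounded_cost \<omega> 1" and \<omega>': "bounded_cost \<omega>' 1" and e: "bounded_cost (\<lambda>j. \<omega> j - \<omega>' j) e"
    and "e \<ge> 0"
  shows "(oper \<omega> ^^ n) z - (oper \<omega>' ^^ n) z \<in> l1_ball (real n * 2 ^ n * e * p z)"
proof (induction n)
  case 0
  show ?case by (simp add: zero_in_l1_ball)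
next
  case (Suc n)
  let ?u = "(oper \<omega> ^^ n) z" and ?v = "(oper \<omega>' ^^ n) z"
  have "oper \<omega> ?v - oper \<omega>' ?v = shift (\<lambda>j. \<omega> j - \<omega>' j) ?v"
    using shift_add_weights[OF e \<omega>', of ?v] by (simp add: oper_def)
  moreover have "shift (\<lambda>j. \<omega> j - \<omega>' j) ?v \<in> l1_ball (e * p ?v)" by (rule shift_ball[OF e])
  moreover have "e * p ?v \<le> e * (2 ^ n * p z)"
    by (intro mult_left_mono oper_pow_p_le[OF \<omega>'] \<open>e \<ge> 0\<close>)
  ultimately have "oper \<omega> ?v - oper \<omega>' ?v \<in> l1_ball (e * (2 ^ n * p z))"
    by (metis l1_ball_mono)
  moreover have "oper \<omega> ?u - oper \<omega> ?v \<in> l1_ball (2 * (real n * 2 ^ n * e * p z))"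
    using oper_ball[OF \<omega> Suc] oper_pow_diff[OF \<omega>, of 1 ?u ?v] by simp
  ultimately have "(oper \<omega> ?u - oper \<omega> ?v) + (oper \<omega> ?v - oper \<omega>' ?v) \<in>
      l1_ball (2 * (real n * 2 ^ n * e * p z) + e * (2 ^ n * p z))"
    by (intro l1_ball_add)
  moreover have "2 * (real n * 2 ^ n * e * p z) + e * (2 ^ n * p z) \<le> real (Suc n) * 2 ^ Suc n * e * p z"
    using \<open>e \<ge> 0\<close> p_nonneg[of z] by (simp add: algebra_simps)
  ultimately show ?case by (simp add: l1_ball_mono)
qed

end

section \<open>Finite Jordan blocks of the shift and their duals\<close>

locale shift_block = weighted_shift smul w p x f \<beta>
  for smul :: "'k::{real_normed_field, banach} \<Rightarrow>
    'a::{real_vector, topological_ab_group_add, t2_space} \<Rightarrow> 'a" and w p x f \<beta> +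
  fixes \<omega> a :: "int \<Rightarrow> real" and A B :: int and D :: nat
  assumes a: "a j > 0" "a (j - 1) = \<omega> j * a j"
    and AB: "0 < A" "0 < B" "A + B = 2 * int D"
begin

text \<open>With the window open at both ends, \<open>x (- A)\<close> is sent to 0 and
  \<open>x (B - 1)\<close> is the top vector, so the block consists of \<open>A + B = 2 * D\<close>
  vectors.\<close>

definition cut :: "int \<Rightarrow> real"
  where "cut j = (if j \<in> {- A<..<B} then \<omega> j else 0)"

text \<open>The scales turn the weights into 1: by \<open>a (j - 1) = \<omega> j * a j\<close>, the
  truncated shift sends each member of the block to its predecessor.\<close>

definition chain :: "nat \<Rightarrow> 'a"
  where "chain l = a (int l - A) *\<^sub>R x (int l - A)"

text \<open>The adjoint shift raises the index, hence the numbering downwards from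
  \<open>B - 1\<close> and the reciprocal scales; the functionals then form a chain of the same
  kind.\<close>

definition cochain :: "nat \<Rightarrow> 'a \<Rightarrow> 'k"
  where "cochain l z = f (B - 1 - int l) z / of_real (a (B - 1 - int l))"

lemma shift_cut: "shift cut z = (\<Sum>j\<in>{- A<..<B}. shift_term \<omega> z j)"
proof -
  have "shift cut z = (\<Sum>j\<in>{- A<..<B}. shift_term cut z j)"
    by (rule shift_finite) (auto simp: cut_def)
  also have "\<dots> = (\<Sum>j\<in>{- A<..<B}. shift_term \<omega> z j)"
    by (intro sum.cong) (auto simp: cut_def shift_term_def)
  finally show ?thesis .
qed

lemma shift_cut_x: "shift cut (x i) = (if i \<in> {- A<..<B} then \<omega> i *\<^sub>R x (i - 1) else 0)"
proof -
  have "shift cut (x i) = (\<Sum>j\<in>{- A<..<B}. if j = i then \<omega> i *\<^sub>R x (i - 1) else 0)"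
    unfolding shift_cut by (intro sum.cong) (auto simp: shift_term_def biorthogonal smul_of_real)
  then show ?thesis by simp
qed

lemma f_shift_cut: "f i (shift cut z) = (if i + 1 \<in> {- A<..<B} then of_real (\<omega> (i + 1)) * f (i + 1) z else 0)"
proof -
  have "f i (shift cut z) = (\<Sum>j\<in>{- A<..<B}. if j = i + 1 then of_real (\<omega> j) * f j z else 0)"
    unfolding shift_cut linear_functional_sum[OF f_linear]
    by (intro sum.cong) (auto simp: shift_term_def biorthogonal linear_functional_scale[OF f_linear])
  then show ?thesis by simp
qed

lemma oper_chain:
  assumes "bounded_cost cut 1"
  shows "oper cut (chain 0) = chain 0"
    and "Suc l < 2 * D \<Longrightarrow> oper cut (chain (Suc l)) = chain (Suc l) + chain l"
proof -
  have *: "oper cut (chain l) = chain l + a (int l - A) *\<^sub>R shift cut (x (int l - A))" for l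
    using shift_scale[OF assms, of "of_real (a (int l - A))" "x (int l - A)"]
    by (simp add: oper_def chain_def smul_of_real)
  show "oper cut (chain 0) = chain 0" by (simp add: * shift_cut_x)
  show "oper cut (chain (Suc l)) = chain (Suc l) + chain l" if "Suc l < 2 * D"
    unfolding *[of "Suc l"] using that AB a(2)[of "int (Suc l) - A"]
    by (simp add: shift_cut_x chain_def algebra_simps)
qed

lemma cochain_oper:
  shows "cochain 0 (oper cut z) = cochain 0 z"
    and "Suc l < 2 * D \<Longrightarrow> cochain (Suc l) (oper cut z) = cochain (Suc l) z + cochain l z"
proof -
  have *: "cochain l (oper cut z) = cochain l z + f (B - 1 - int l) (shift cut z) / of_real (a (B - 1 - int l))" for l
    by (simp add: cochain_def oper_def linear_functional_add[OF f_linear] add_divide_distrib)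
  show "cochain 0 (oper cut z) = cochain 0 z" by (simp add: * f_shift_cut)
  show "cochain (Suc l) (oper cut z) = cochain (Suc l) z + cochain l z" if "Suc l < 2 * D"
  proof -
    have "a (B - 2 - int l) = \<omega> (B - 1 - int l) * a (B - 1 - int l)"
      using a(2)[of "B - 1 - int l"] by (simp add: algebra_simps)
    moreover have "a (B - 2 - int l) > 0" by (rule a)
    moreover have "\<omega> (B - 1 - int l) \<noteq> 0"
      using a(1)[of "B - 1 - int l - 1"] unfolding a(2) by auto
    moreover have "B - 1 - int (Suc l) = B - 2 - int l" "B - 2 - int l + 1 = B - 1 - int l" by auto
    moreover have "B - 1 - int l \<in> {- A<..<B}" using that AB by auto
    ultimately show ?thesis unfolding *[of "Suc l"] f_shift_cut
      unfolding cochain_def by (simp add: field_simps)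
  qed
qed

definition poly_vector :: "(nat \<Rightarrow> real) \<Rightarrow> 'a"
  where "poly_vector U = (\<Sum>l<2 * D. (fdiff ^^ l) U 0 *\<^sub>R chain l)"

definition poly_functional :: "(nat \<Rightarrow> real) \<Rightarrow> 'a \<Rightarrow> 'k"
  where "poly_functional U z = (\<Sum>l<2 * D. (fdiff ^^ l) U 0 *\<^sub>R cochain l z)"

text \<open>On Newton coefficient vectors the block of \<open>oper\<close> is the translation \<open>U(t) \<mapsto> U(t + 1)\<close>.\<close>

lemma fdiff_translate: "(fdiff ^^ l) U 0 + (fdiff ^^ Suc l) U 0 = (fdiff ^^ l) (\<lambda>t. U (t + 1)) 0"
  unfolding fdiff_funpow_Suc fdiff_funpow_shift by simp

lemma oper_pow_poly_vector:
  assumes "bounded_cost cut 1" "(fdiff ^^ (2 * D)) U = (\<lambda>_. 0)"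
  shows "(oper cut ^^ n) (poly_vector U) = poly_vector (\<lambda>t. U (t + n))"
proof -
  have "oper cut (poly_vector V) = poly_vector (\<lambda>t. V (t + 1))" if "(fdiff ^^ (2 * D)) V = (\<lambda>_. 0)" for V
  proof -
    have "oper cut (poly_vector V) = (\<Sum>l<2 * D. (fdiff ^^ l) V 0 *\<^sub>R oper cut (chain l))"
      using oper_pow_sum[OF assms(1), of 1 "\<lambda>l. (fdiff ^^ l) V 0 *\<^sub>R chain l" "{..<2 * D}"]
        oper_scale[OF assms(1), of "of_real _"]
      by (simp add: poly_vector_def smul_of_real)
    also have "\<dots> = (\<Sum>l<2 * D. ((fdiff ^^ l) V 0 + (fdiff ^^ Suc l) V 0) *\<^sub>R chain l)"
      by (rule chain_sum) (use oper_chain[OF assms(1)] that in \<open>auto dest: fun_cong\<close>)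
    also have "\<dots> = poly_vector (\<lambda>t. V (t + 1))"
      unfolding fdiff_translate poly_vector_def ..
    finally show ?thesis .
  qed
  moreover have "(fdiff ^^ (2 * D)) (\<lambda>t. U (t + n)) = (\<lambda>_. 0)" for n
    by (simp add: fdiff_funpow_shift assms(2))
  ultimately show ?thesis
    by (induction n) (simp_all add: add.assoc add.commute)
qed

lemma poly_functional_oper_pow:
  assumes "(fdiff ^^ (2 * D)) U = (\<lambda>_. 0)"
  shows "poly_functional U ((oper cut ^^ n) z) = poly_functional (\<lambda>t. U (t + n)) z"
proof -
  have "poly_functional V (oper cut z) = poly_functional (\<lambda>t. V (t + 1)) z"
    if "(fdiff ^^ (2 * D)) V = (\<lambda>_. 0)" for V z
  proof -
    have "poly_functional V (oper cut z) = (\<Sum>l<2 * D. ((fdiff ^^ l) V 0 + (fdiff ^^ Suc l) V 0) *\<^sub>R cochain l z)"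
      unfolding poly_functional_def
      by (rule chain_sum) (use cochain_oper that in \<open>auto dest: fun_cong\<close>)
    also have "\<dots> = poly_functional (\<lambda>t. V (t + 1)) z"
      unfolding fdiff_translate poly_functional_def ..
    finally show ?thesis .
  qed
  note step = this
  show ?thesis
    using assms
  proof (induction n arbitrary: U)
    case (Suc n)
    have "poly_functional U ((oper cut ^^ Suc n) z) = poly_functional (\<lambda>t. U (t + 1)) ((oper cut ^^ n) z)"
      using step[OF Suc.prems] by simp
    also have "\<dots> = poly_functional (\<lambda>t. U (t + Suc n)) z"
      using Suc.IH[of "\<lambda>t. U (t + 1)"] fdiff_funpow_shift[of "2 * D" U 1] Suc.prems by (simp add: add.assoc)
    finally show ?case .
  qed simp
qed

lemma chain_ball: "chain l \<in> l1_ball (a (int l - A) * \<beta> (int l - A))"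
  using l1_ball_scaleR[OF x_ball, of "a (int l - A)" "int l - A"] a(1)[of "int l - A"]
  by (simp add: chain_def)

lemma chain_span: "chain l \<in> span (range x)"
  unfolding chain_def by (subst smul_of_real[symmetric]) (intro span_scale span_base, simp)

lemma poly_vector_span: "poly_vector U \<in> span (range x)"
  unfolding poly_vector_def
  by (subst smul_of_real[symmetric]) (intro span_sum span_scale chain_span)

lemma poly_vector_ball:
  "poly_vector U \<in> l1_ball (\<Sum>l<2 * D. \<bar>(fdiff ^^ l) U 0\<bar> * (a (int l - A) * \<beta> (int l - A)))"
  unfolding poly_vector_def by (intro l1_ball_sum l1_ball_scaleR chain_ball) simp

lemma poly_vector_diff_chain_ball:
  assumes "i < 2 * D"
  shows "poly_vector U - chain i \<in>
    l1_ball (\<Sum>l<2 * D. \<bar>(fdiff ^^ l) U 0 - of_bool (l = i)\<bar> * (a (int l - A) * \<beta> (int l - A)))"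
proof -
  have "chain i = (\<Sum>l<2 * D. if l = i then chain l else 0)" using assms by simp
  also have "\<dots> = (\<Sum>l<2 * D. of_bool (l = i) *\<^sub>R chain l)" by (intro sum.cong) auto
  finally have "poly_vector U - chain i = (\<Sum>l<2 * D. ((fdiff ^^ l) U 0 - of_bool (l = i)) *\<^sub>R chain l)"
    by (simp add: poly_vector_def scaleR_left_diff_distrib sum_subtractf)
  then show ?thesis by (simp only:) (intro l1_ball_sum l1_ball_scaleR chain_ball, simp)
qed

text \<open>The start is carried by orbits that die out by time \<open>n\<close>, the target by
  orbits that emerge by time \<open>n\<close>; \<open>z\<close> collects the initial errors. The
  bound \<open>M\<close> makes a single \<open>n\<close> serve all coefficients.\<close>

lemma hypercyclic_block:
  assumes cut: "bounded_cost cut 1" and "\<eta> > 0" "M \<ge> 0"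
  obtains n where "\<forall>c d. (\<forall>i<D. norm (c i) \<le> M \<and> norm (d i) \<le> M) \<longrightarrow>
    (\<exists>z\<in>span (range x) \<inter> l1_ball \<eta>.
      (oper cut ^^ n) ((\<Sum>i<D. smul (c i) (chain i)) + z) - (\<Sum>i<D. smul (d i) (chain i)) \<in> l1_ball \<eta>)"
proof -
  let ?\<gamma> = "\<lambda>l. a (int l - A) * \<beta> (int l - A)"
  have "\<forall>i. \<exists>U :: nat \<Rightarrow> nat \<Rightarrow> real. i < D \<longrightarrow> (\<forall>n. (fdiff ^^ (2 * D)) (U n) = (\<lambda>_. 0)) \<and>
      (\<forall>l. (\<lambda>n. (fdiff ^^ l) (U n) 0) \<longlonglongrightarrow> of_bool (l = i)) \<and> (\<forall>l. (\<lambda>n. (fdiff ^^ l) (U n) n) \<longlonglongrightarrow> 0)"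
    using chain_to_zero by blast
  from choice[OF this] obtain U where U': "\<forall>i. i < D \<longrightarrow> (\<forall>n. (fdiff ^^ (2 * D)) (U i n) = (\<lambda>_. 0)) \<and>
      (\<forall>l. (\<lambda>n. (fdiff ^^ l) (U i n) 0) \<longlonglongrightarrow> of_bool (l = i)) \<and>
      (\<forall>l. (\<lambda>n. (fdiff ^^ l) (U i n) n) \<longlonglongrightarrow> 0)"
    by (elim exE)
  note U = U'[rule_format, THEN conjunct1, rule_format]
    U'[rule_format, THEN conjunct2, THEN conjunct1, rule_format]
    U'[rule_format, THEN conjunct2, THEN conjunct2, rule_format]
  have "\<forall>i. \<exists>U :: nat \<Rightarrow> nat \<Rightarrow> real. i < D \<longrightarrow> (\<forall>n. (fdiff ^^ (2 * D)) (U n) = (\<lambda>_. 0)) \<and>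
      (\<forall>l. (\<lambda>n. (fdiff ^^ l) (U n) 0) \<longlonglongrightarrow> 0) \<and> (\<forall>l. (\<lambda>n. (fdiff ^^ l) (U n) n) \<longlonglongrightarrow> of_bool (l = i))"
    using chain_from_zero by blast
  from choice[OF this] obtain V where V': "\<forall>i. i < D \<longrightarrow> (\<forall>n. (fdiff ^^ (2 * D)) (V i n) = (\<lambda>_. 0)) \<and>
      (\<forall>l. (\<lambda>n. (fdiff ^^ l) (V i n) 0) \<longlonglongrightarrow> 0) \<and>
      (\<forall>l. (\<lambda>n. (fdiff ^^ l) (V i n) n) \<longlonglongrightarrow> of_bool (l = i))"
    by (elim exE)
  note V = V'[rule_format, THEN conjunct1, rule_format]
    V'[rule_format, THEN conjunct2, THEN conjunct1, rule_format]
    V'[rule_format, THEN conjunct2, THEN conjunct2, rule_format]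
  \<comment> \<open>A radius for the combination of the chain with coefficients
    \<open>u\<close>.\<close>
  define size where "size u = (\<Sum>l<2 * D. \<bar>u l\<bar> * ?\<gamma> l)" for u
  have size_lim: "(\<lambda>n. size (u n)) \<longlonglongrightarrow> 0" if "\<And>l. (\<lambda>n. u n l) \<longlonglongrightarrow> 0" for u
  proof -
    have "(\<lambda>n. size (u n)) \<longlonglongrightarrow> (\<Sum>l<2 * D. \<bar>0\<bar> * ?\<gamma> l)"
      unfolding size_def by (intro tendsto_intros that)
    then show ?thesis by simp
  qed
  define u1 u2 v1 v2 where "u1 i n = size (\<lambda>l. (fdiff ^^ l) (U i n) 0 - of_bool (l = i))"
    and "u2 i n = size (\<lambda>l. (fdiff ^^ l) (U i n) n)"
    and "v1 i n = size (\<lambda>l. (fdiff ^^ l) (V i n) 0)"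
    and "v2 i n = size (\<lambda>l. (fdiff ^^ l) (V i n) n - of_bool (l = i))" for i n
  have lims: "(\<lambda>n. u1 i n) \<longlonglongrightarrow> 0" "(\<lambda>n. u2 i n) \<longlonglongrightarrow> 0" "(\<lambda>n. v1 i n) \<longlonglongrightarrow> 0" "(\<lambda>n. v2 i n) \<longlonglongrightarrow> 0"
    if "i < D" for i
    unfolding u1_def u2_def v1_def v2_def
    by (intro size_lim LIM_zero U(2,3) V(2,3) that)+
  have "(\<lambda>n. \<Sum>i<D. M * (u1 i n + v1 i n)) \<longlonglongrightarrow> (\<Sum>i<D. M * (0 + 0))"
    by (intro tendsto_intros lims) simp_all
  then have e1: "\<forall>\<^sub>F n in sequentially. (\<Sum>i<D. M * (u1 i n + v1 i n)) < \<eta>"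
    using \<open>\<eta> > 0\<close> by (intro order_tendstoD(2)) auto
  have "(\<lambda>n. \<Sum>i<D. M * (u2 i n + v2 i n)) \<longlonglongrightarrow> (\<Sum>i<D. M * (0 + 0))"
    by (intro tendsto_intros lims) simp_all
  then have e2: "\<forall>\<^sub>F n in sequentially. (\<Sum>i<D. M * (u2 i n + v2 i n)) < \<eta>"
    using \<open>\<eta> > 0\<close> by (intro order_tendstoD(2)) auto
  obtain n where n: "(\<Sum>i<D. M * (u1 i n + v1 i n)) < \<eta>" "(\<Sum>i<D. M * (u2 i n + v2 i n)) < \<eta>"
    using eventually_happens[OF eventually_conj[OF e1 e2]] by auto
  have size_nonneg: "0 \<le> size u" for u
    unfolding size_def by (intro sum_nonneg mult_nonneg_nonneg less_imp_le[OF a(1)] less_imp_le[OF \<beta>_pos]) auto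
  have combine: "(\<Sum>i<D. smul (c i) (y i) + smul (d i) (z i)) \<in> l1_ball \<eta>"
    if "\<And>i. i < D \<Longrightarrow> y i \<in> l1_ball (q i)" "\<And>i. i < D \<Longrightarrow> z i \<in> l1_ball (r i)"
      "\<forall>i<D. norm (c i) \<le> M \<and> norm (d i) \<le> M" "(\<Sum>i<D. M * (q i + r i)) < \<eta>" for c d y z q r
  proof -
    have *: "smul b t \<in> l1_ball (M * s)" if "t \<in> l1_ball s" "norm b \<le> M" for b t s
      by (rule l1_ball_mono[OF l1_ball_scale[OF that(1)]])
        (rule mult_right_mono[OF that(2) l1_ball_nonneg[OF that(1)]])
    have "(\<Sum>i<D. smul (c i) (y i) + smul (d i) (z i)) \<in> l1_ball (\<Sum>i<D. M * q i + M * r i)"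
      using that by (intro l1_ball_sum l1_ball_add *) auto
    then show ?thesis
      by (rule l1_ball_mono) (use that(4) in \<open>simp add: distrib_left\<close>)
  qed
  show ?thesis
  proof (rule that, intro allI impI)
    fix c d :: "nat \<Rightarrow> 'k" assume cd: "\<forall>i<D. norm (c i) \<le> M \<and> norm (d i) \<le> M"
    define z where "z = (\<Sum>i<D. smul (c i) (poly_vector (U i n) - chain i) + smul (d i) (poly_vector (V i n)))"
    have "z \<in> l1_ball \<eta>"
      unfolding z_def
    proof (rule combine[OF _ _ cd n(1)])
      show "poly_vector (U i n) - chain i \<in> l1_ball (u1 i n)" if "i < D" for i
        unfolding u1_def size_def using that by (intro poly_vector_diff_chain_ball) simp
      show "poly_vector (V i n) \<in> l1_ball (v1 i n)" for i
        unfolding v1_def size_def by (rule poly_vector_ball)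
    qed
    moreover have "z \<in> span (range x)"
      unfolding z_def
      by (intro span_sum span_add span_scale span_diff poly_vector_span chain_span)
    moreover have "(oper cut ^^ n) ((\<Sum>i<D. smul (c i) (chain i)) + z) - (\<Sum>i<D. smul (d i) (chain i)) \<in> l1_ball \<eta>"
    proof -
      have "(\<Sum>i<D. smul (c i) (chain i)) + z =
          (\<Sum>i<D. smul (c i) (poly_vector (U i n)) + smul (d i) (poly_vector (V i n)))"
        unfolding z_def by (simp add: scale_right_diff_distrib flip: sum.distrib)
      then have "(oper cut ^^ n) ((\<Sum>i<D. smul (c i) (chain i)) + z) =
          (\<Sum>i<D. smul (c i) (poly_vector (\<lambda>t. U i n (t + n))) + smul (d i) (poly_vector (\<lambda>t. V i n (t + n))))"
        by (simp add: oper_pow_sum[OF cut] oper_pow_add[OF cut] oper_pow_scale[OF cut]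
            oper_pow_poly_vector[OF cut] U(1) V(1))
      then have "(oper cut ^^ n) ((\<Sum>i<D. smul (c i) (chain i)) + z) - (\<Sum>i<D. smul (d i) (chain i)) =
          (\<Sum>i<D. smul (c i) (poly_vector (\<lambda>t. U i n (t + n))) +
            smul (d i) (poly_vector (\<lambda>t. V i n (t + n)) - chain i))"
        by (simp add: scale_right_diff_distrib add_diff_eq flip: sum_subtractf)
      also have "\<dots> \<in> l1_ball \<eta>"
      proof (rule combine[OF _ _ cd n(2)])
        show "poly_vector (\<lambda>t. U i n (t + n)) \<in> l1_ball (u2 i n)" for i
          using poly_vector_ball[of "\<lambda>t. U i n (t + n)"]
          by (simp add: u2_def size_def fdiff_funpow_shift)
        show "poly_vector (\<lambda>t. V i n (t + n)) - chain i \<in> l1_ball (v2 i n)" if "i < D" for i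
          using poly_vector_diff_chain_ball[of i "\<lambda>t. V i n (t + n)"] that
          by (simp add: v2_def size_def fdiff_funpow_shift)
      qed
      finally show ?thesis .
    qed
    ultimately show "\<exists>z\<in>span (range x) \<inter> l1_ball \<eta>.
      (oper cut ^^ n) ((\<Sum>i<D. smul (c i) (chain i)) + z) - (\<Sum>i<D. smul (d i) (chain i)) \<in> l1_ball \<eta>"
      by blast
  qed
qed

lemma cochain_le: "norm (cochain l z) \<le> 1 / a (B - 1 - int l) * p z"
  using f_le[of "B - 1 - int l" z] a(1)[of "B - 1 - int l"]
  by (simp add: cochain_def norm_divide field_simps)

lemma sum_cochain_le:
  "norm (\<Sum>l<2 * D. u l *\<^sub>R cochain l z) \<le> (\<Sum>l<2 * D. \<bar>u l\<bar> * (1 / a (B - 1 - int l))) * p z"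
  unfolding sum_distrib_right
  by (intro sum_norm_le) (use mult_left_mono[OF cochain_le] in \<open>simp add: mult.assoc\<close>)

lemma poly_functional_linear: "linear_functional (\<lambda>z. b * poly_functional U z)"
  unfolding linear_functional_iff poly_functional_def cochain_def
  by (auto simp: linear_functional_add[OF f_linear] linear_functional_scale[OF f_linear] add_divide_distrib
      scaleR_add_right sum.distrib distrib_left sum_distrib_left scaleR_conv_of_real intro!: sum.cong)

text \<open>Up to the factor \<open>a 0\<close>, \<open>f 0\<close> is the cochain with index
  \<open>B - 1\<close>. The hypothesis puts it into the first half of the dual chain, where
  \<open>chain_to_zero\<close> applies; both limits hold for all large \<open>n\<close>, so
  \<open>N\<close> is arbitrary.\<close>

lemma dual_block:
  assumes "nat (B - 1) < D" "\<eta> > 0"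
  obtains n G where "n \<ge> N" "linear_functional G" "\<forall>z. norm (G z - f 0 z) \<le> \<eta> * p z"
    "\<forall>z. norm (G ((oper cut ^^ n) z)) \<le> \<eta> * p z"
proof -
  define i where "i = nat (B - 1)"
  have i: "i < D" "B - 1 - int i = 0" using assms(1) AB by (auto simp: i_def)
  obtain U :: "nat \<Rightarrow> nat \<Rightarrow> real" where U: "\<And>n. (fdiff ^^ (2 * D)) (U n) = (\<lambda>_. 0)"
    "\<And>l. (\<lambda>n. (fdiff ^^ l) (U n) 0) \<longlonglongrightarrow> of_bool (l = i)"
    "\<And>l. (\<lambda>n. (fdiff ^^ l) (U n) n) \<longlonglongrightarrow> 0"
    using chain_to_zero[OF i(1)] by blast
  define size where "size u = a 0 * (\<Sum>l<2 * D. \<bar>u l\<bar> * (1 / a (B - 1 - int l)))" for u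
  have size_lim: "(\<lambda>n. size (u n)) \<longlonglongrightarrow> 0" if "\<And>l. (\<lambda>n. u n l) \<longlonglongrightarrow> 0" for u
  proof -
    have "(\<lambda>n. size (u n)) \<longlonglongrightarrow> a 0 * (\<Sum>l<2 * D. \<bar>0\<bar> * (1 / a (B - 1 - int l)))"
      unfolding size_def by (intro tendsto_intros that)
    then show ?thesis by simp
  qed
  have "\<forall>\<^sub>F n in sequentially. size (\<lambda>l. (fdiff ^^ l) (U n) 0 - of_bool (l = i)) < \<eta>"
    by (intro order_tendstoD(2)[OF size_lim \<open>\<eta> > 0\<close>] LIM_zero U)
  moreover have "\<forall>\<^sub>F n in sequentially. size (\<lambda>l. (fdiff ^^ l) (U n) n) < \<eta>"
    by (intro order_tendstoD(2)[OF size_lim \<open>\<eta> > 0\<close>] U)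
  ultimately have "\<forall>\<^sub>F n in sequentially. n \<ge> N \<and>
      size (\<lambda>l. (fdiff ^^ l) (U n) 0 - of_bool (l = i)) < \<eta> \<and> size (\<lambda>l. (fdiff ^^ l) (U n) n) < \<eta>"
    by (intro eventually_conj eventually_ge_at_top)
  then obtain n where n: "n \<ge> N" "size (\<lambda>l. (fdiff ^^ l) (U n) 0 - of_bool (l = i)) < \<eta>"
    "size (\<lambda>l. (fdiff ^^ l) (U n) n) < \<eta>"
    using eventually_happens'[OF sequentially_bot] by blast
  have bound: "norm (of_real (a 0) * (\<Sum>l<2 * D. u l *\<^sub>R cochain l z)) \<le> \<eta> * p z" if "size u < \<eta>" for u z
  proof -
    have "norm (of_real (a 0) * (\<Sum>l<2 * D. u l *\<^sub>R cochain l z)) \<le> size u * p z"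
      using mult_left_mono[OF sum_cochain_le[of u z], of "a 0"] a(1)[of 0]
      by (simp add: norm_mult size_def mult.assoc)
    also have "\<dots> \<le> \<eta> * p z" using that p_nonneg by (intro mult_right_mono) auto
    finally show ?thesis .
  qed
  show ?thesis
  proof (rule that[OF n(1) poly_functional_linear[of "of_real (a 0)" "U n"]]; intro allI)
    fix z
    have "cochain i z = (\<Sum>l<2 * D. if l = i then cochain l z else 0)" using i by simp
    also have "\<dots> = (\<Sum>l<2 * D. of_bool (l = i) *\<^sub>R cochain l z)" by (intro sum.cong) auto
    finally have c: "cochain i z = (\<Sum>l<2 * D. of_bool (l = i) *\<^sub>R cochain l z)" .
    have "f 0 z = of_real (a 0) * cochain i z" using i a(1)[of 0] by (simp add: cochain_def)
    then have "of_real (a 0) * poly_functional (U n) z - f 0 z =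
        of_real (a 0) * (\<Sum>l<2 * D. ((fdiff ^^ l) (U n) 0 - of_bool (l = i)) *\<^sub>R cochain l z)"
      unfolding c by (simp add: poly_functional_def scaleR_left_diff_distrib sum_subtractf right_diff_distrib)
    then show "norm (of_real (a 0) * poly_functional (U n) z - f 0 z) \<le> \<eta> * p z"
      using bound[OF n(2)] by simp
    show "norm (of_real (a 0) * poly_functional (U n) ((oper cut ^^ n) z)) \<le> \<eta> * p z"
      using bound[OF n(3), of z] unfolding poly_functional_oper_pow[OF U(1)]
      by (simp add: poly_functional_def fdiff_funpow_shift)
  qed
qed

end

subsection \<open>Choice of the weights\<close>

text \<open>The recursion is solved in both directions from \<open>a 0 = 1\<close>; at least one of
  the two products in the witness is always empty.\<close>

lemma chain_scales_exist:
  fixes \<omega> :: "int \<Rightarrow> real"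
  assumes "\<And>j. \<omega> j > 0"
  obtains a where "\<forall>j. a j > 0" "\<forall>j. a (j - 1) = \<omega> j * a j"
proof
  define a where "a j = (\<Prod>i\<in>{j<..0}. \<omega> i) / (\<Prod>i\<in>{0<..j}. \<omega> i)" for j
  show "\<forall>j. a j > 0" using assms by (simp add: a_def prod_pos)
  show "\<forall>j. a (j - 1) = \<omega> j * a j"
  proof
    fix j
    show "a (j - 1) = \<omega> j * a j"
    proof (cases "j \<le> 0")
      case True
      then have "{j - 1<..0} = insert j {j<..0}" by auto
      with True show ?thesis by (simp add: a_def)
    next
      case False
      then have "{0<..j} = insert j {0<..j - 1}" by auto
      with False assms[of j] show ?thesis by (simp add: a_def)
    qed
  qed
qed

definition decreasing_weights :: "(nat \<Rightarrow> real) \<Rightarrow> bool"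
  where "decreasing_weights \<theta> \<longleftrightarrow> (\<forall>i. 0 < \<theta> i \<and> \<theta> i \<le> 1) \<and> antimono \<theta>"

text \<open>A diagonal construction. Requirement \<open>k\<close> depends on the values up to
  \<open>k\<close> and on the later ones being small; since sequences decrease, a bound on the value
  at \<open>Suc k\<close> controls the entire tail.\<close>

lemma decreasing_weights_selection:
  assumes step: "\<And>k \<theta>. decreasing_weights \<theta> \<Longrightarrow> \<exists>\<epsilon>>0. \<forall>\<theta>'. decreasing_weights \<theta>' \<longrightarrow>
    (\<forall>i\<le>k. \<theta>' i = \<theta> i) \<longrightarrow> \<theta>' (Suc k) \<le> \<epsilon> \<longrightarrow> C k \<theta>'"
  shows "\<exists>\<theta>. decreasing_weights \<theta> \<and> (\<forall>k. C k \<theta>)"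
proof -
  define good where "good \<epsilon> k \<theta> \<longleftrightarrow> \<epsilon> > 0 \<and> (\<forall>\<theta>'. decreasing_weights \<theta>' \<longrightarrow>
    (\<forall>i\<le>k. \<theta>' i = \<theta> i) \<longrightarrow> \<theta>' (Suc k) \<le> \<epsilon> \<longrightarrow> C k \<theta>')" for \<epsilon> k \<theta>
  define E where "E k \<theta> = (SOME \<epsilon>. good \<epsilon> k \<theta>)" for k \<theta>
  have E: "good (E k \<theta>) k \<theta>" if "decreasing_weights \<theta>" for k \<theta>
    unfolding E_def by (rule someI_ex) (use step[OF that] in \<open>simp add: good_def\<close>)
  \<comment> \<open>Passing to stage \<open>Suc k\<close> keeps the values up to \<open>k\<close>
    and continues with a constant below the threshold for requirement \<open>k\<close>. Later stages
    never alter a kept value, so the diagonal meets every threshold.\<close>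
  define g where "g = rec_nat (\<lambda>_. 1) (\<lambda>k \<theta> i. if i \<le> k then \<theta> i else min (\<theta> k) (E k \<theta>))"
  have g0: "g 0 = (\<lambda>_. 1)" and gS: "g (Suc k) = (\<lambda>i. if i \<le> k then g k i else min (g k k) (E k (g k)))" for k
    unfolding g_def by simp_all
  have dec: "decreasing_weights (g k)" for k
  proof (induction k)
    case (Suc k)
    then have "E k (g k) > 0" using E by (simp add: good_def)
    with Suc show ?case
      unfolding gS decreasing_weights_def antimono_def
      by (auto simp: min_le_iff_disj)
  qed (simp add: g0 decreasing_weights_def antimono_def)
  have stable: "g (i + m) i = g i i" for i m
    by (induction m) (auto simp: gS)
  define \<theta> where "\<theta> i = g i i" for i
  have agree: "\<theta> i = g k i" if "i \<le> k" for i k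
    using stable[of i "k - i"] that by (simp add: \<theta>_def)
  have "decreasing_weights \<theta>"
    unfolding decreasing_weights_def
  proof (intro conjI allI)
    show "0 < \<theta> i" "\<theta> i \<le> 1" for i using dec[of i] by (auto simp: \<theta>_def decreasing_weights_def)
    show "antimono \<theta>"
    proof (rule antimonoI)
      fix i j :: nat assume "i \<le> j"
      then show "\<theta> j \<le> \<theta> i"
        using agree[of i j] agree[of j j] dec[of j] by (auto simp: decreasing_weights_def antimono_def)
    qed
  qed
  moreover have "C k \<theta>" for k
  proof -
    have "\<theta> (Suc k) \<le> E k (g k)" by (simp add: \<theta>_def gS)
    then show ?thesis
      using E[OF dec[of k], of k] \<open>decreasing_weights \<theta>\<close> agree unfolding good_def by blast
  qed
  ultimately show ?thesis by blast
qed

text \<open>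
  The chains alternately grow at the top (odd \<open>k\<close>) and at the bottom (even \<open>k\<close>).
\<close>

definition blk :: "nat \<Rightarrow> int set"
  where "blk k = {- (3 ^ (k div 2))<..<3 ^ (Suc k div 2)}"

definition rk :: "int \<Rightarrow> nat"
  where "rk j = (LEAST k. j \<in> blk k)"

lemma blk_mono: "k \<le> l \<Longrightarrow> blk k \<subseteq> blk l"
proof -
  assume "k \<le> l"
  have "(3::int) ^ (k div 2) \<le> 3 ^ (l div 2)"
    by (intro power_increasing div_le_mono \<open>k \<le> l\<close>) simp
  moreover have "(3::int) ^ (Suc k div 2) \<le> 3 ^ (Suc l div 2)"
    by (intro power_increasing div_le_mono) (use \<open>k \<le> l\<close> in simp_all)
  ultimately show ?thesis
    by (intro subsetI; simp only: blk_def greaterThanLessThan_iff; linarith)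
qed

lemma rk_le_iff: "rk j \<le> k \<longleftrightarrow> j \<in> blk k"
proof -
  have "\<bar>j\<bar> < 3 ^ nat \<bar>j\<bar>"
  proof -
    have "nat \<bar>j\<bar> < 3 ^ nat \<bar>j\<bar>" by (rule less_exp[THEN less_le_trans]) (simp add: power_mono)
    then have "int (nat \<bar>j\<bar>) < int (3 ^ nat \<bar>j\<bar>)" by (simp only: of_nat_less_iff)
    then show ?thesis by simp
  qed
  then have "j \<in> blk (2 * nat \<bar>j\<bar>)" by (auto simp: blk_def)
  then have "j \<in> blk (rk j)" unfolding rk_def by (rule LeastI)
  then show ?thesis
    using blk_mono[of "rk j" k] by (auto simp: rk_def intro: Least_le)
qed

section \<open>Truncation of the weights and the two kinds of stages\<close>

context weighted_shift
begin

text \<open>Indices entering with the same block share the factor \<open>\<theta> (rk j)\<close>, so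
  one number controls everything outside a block. The other factor has total cost 1:
  \<open>\<beta> (j - 1)\<close> cancels and the powers of 1/2 sum along the enumeration of the
  integers.\<close>

definition weight :: "(nat \<Rightarrow> real) \<Rightarrow> int \<Rightarrow> real"
  where "weight \<theta> j = \<theta> (rk j) * ((1 / 2) ^ Suc (int_encode j) / \<beta> (j - 1))"

lemma bounded_costI:
  assumes "\<And>j. \<bar>\<omega> j\<bar> \<le> e * ((1 / 2) ^ Suc (int_encode j) / \<beta> (j - 1))"
  shows "bounded_cost \<omega> e"
proof -
  have le: "cost \<omega> n \<le> e * (1 / 2) ^ Suc n" for n
    using mult_right_mono[OF assms[of "int_decode n"], of "\<beta> (int_decode n - 1)"] \<beta>_pos[of "int_decode n - 1"]
    by (simp add: cost_def)
  have sums: "(\<lambda>n. e * (1 / 2) ^ Suc n) sums (e * 1)"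
    by (intro sums_mult power_half_series)
  have nonneg: "0 \<le> cost \<omega> n" for n
    using \<beta>_pos[of "int_decode n - 1"] by (simp add: cost_def)
  have "summable (cost \<omega>)"
    by (rule summable_comparison_test'[OF sums_summable[OF sums], of 0]) (use le nonneg in simp)
  moreover from suminf_le[OF le this sums_summable[OF sums]] have "suminf (cost \<omega>) \<le> e"
    using sums by (simp add: sums_iff)
  ultimately show ?thesis by (simp add: bounded_cost_def)
qed

lemma base_weight_pos: "(1 / 2) ^ Suc (int_encode j) / \<beta> (j - 1) > 0"
  using \<beta>_pos[of "j - 1"] by simp

lemma weight_bounds:
  assumes "decreasing_weights \<theta>"
  shows "weight \<theta> j > 0" "\<bar>weight \<theta> j\<bar> \<le> 1 * ((1 / 2) ^ Suc (int_encode j) / \<beta> (j - 1))"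
proof -
  have t: "0 < \<theta> (rk j)" "\<theta> (rk j) \<le> 1" using assms by (auto simp: decreasing_weights_def)
  show 1: "weight \<theta> j > 0"
    unfolding weight_def by (intro mult_pos_pos base_weight_pos t)
  show "\<bar>weight \<theta> j\<bar> \<le> 1 * ((1 / 2) ^ Suc (int_encode j) / \<beta> (j - 1))"
    unfolding abs_of_pos[OF 1]
    unfolding weight_def by (intro mult_right_mono t less_imp_le[OF base_weight_pos])
qed

lemma weight_bounded_cost: "decreasing_weights \<theta> \<Longrightarrow> bounded_cost (weight \<theta>) 1"
  by (intro bounded_costI weight_bounds)

text \<open>Biorthogonality makes all additional coefficients vanish, so the index set may be
  enlarged at will and several vectors can share one window.\<close>

lemma span_expansion:
  assumes "s \<in> span (range x)"
  obtains J where "finite J" "\<forall>J'. finite J' \<longrightarrow> J \<subseteq> J' \<longrightarrow> s = (\<Sum>j\<in>J'. smul (f j s) (x j))"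
proof -
  have "\<exists>J. finite J \<and> (\<forall>J'. finite J' \<longrightarrow> J \<subseteq> J' \<longrightarrow> s = (\<Sum>j\<in>J'. smul (f j s) (x j)))"
    using assms
  proof (induction rule: span_induct_alt)
    case base
    show ?case by (intro exI[of _ "{}"]) (simp add: linear_functional_zero[OF f_linear])
  next
    case (step c v y)
    then obtain i where i: "v = x i" by blast
    obtain J where J: "finite J" "\<And>J'. finite J' \<Longrightarrow> J \<subseteq> J' \<Longrightarrow> y = (\<Sum>j\<in>J'. smul (f j y) (x j))"
      using step.IH by blast
    have "smul c v + y = (\<Sum>j\<in>J'. smul (f j (smul c v + y)) (x j))"
      if J': "finite J'" "insert i J \<subseteq> J'" for J'
    proof -
      have "(\<Sum>j\<in>J'. smul (f j (smul c v + y)) (x j)) =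
          (\<Sum>j\<in>J'. if j = i then smul c v else 0) + (\<Sum>j\<in>J'. smul (f j y) (x j))"
        unfolding sum.distrib[symmetric]
        by (intro sum.cong)
          (auto simp: i linear_functional_add[OF f_linear] linear_functional_scale[OF f_linear]
            biorthogonal scale_left_distrib)
      then show ?thesis using J' J(2)[of J'] by simp
    qed
    then show ?case using J(1) by (intro exI[of _ "insert i J"]) auto
  qed
  then show ?thesis using that by blast
qed

text \<open>The two equations say that \<open>s\<close> and \<open>y\<close> lie in the span of the
  window. The exponent precedes them, so that the later weights can be made small in terms of
  \<open>n\<close> alone.\<close>

definition transitive_at :: "nat \<Rightarrow> (int \<Rightarrow> real) \<Rightarrow> bool"
  where "transitive_at N \<omega> \<longleftrightarrow> (\<exists>n. \<forall>s y.
    s = (\<Sum>j\<in>{- (3 ^ N)..<3 ^ N}. smul (f j s) (x j)) \<longrightarrow>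
    y = (\<Sum>j\<in>{- (3 ^ N)..<3 ^ N}. smul (f j y) (x j)) \<longrightarrow> p s \<le> 3 ^ N \<longrightarrow> p y \<le> 3 ^ N \<longrightarrow>
    (\<exists>z\<in>span (range x) \<inter> l1_ball (1 / 3 ^ N). (oper \<omega> ^^ n) (s + z) - y \<in> l1_ball (1 / 3 ^ N)))"

text \<open>The tolerance is independent of \<open>N\<close>, so one pair of open sets can refute
  mixing for all these exponents. Its value leaves a multiple of \<open>x 0\<close> in the second
  set.\<close>

definition obstructed_at :: "nat \<Rightarrow> (int \<Rightarrow> real) \<Rightarrow> bool"
  where "obstructed_at N \<omega> \<longleftrightarrow> (\<exists>n\<ge>N. \<exists>G. linear_functional G \<and>
    (\<forall>z. norm (G z - f 0 z) \<le> 1 / (2 * (1 + p (x 0))) * p z) \<and> (\<forall>z. norm (G ((oper \<omega> ^^ n) z)) \<le> p z))"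

text \<open>Inside the block the weights agree, as only values up to \<open>k\<close> occur there;
  outside, monotonicity carries the bound at \<open>Suc k\<close> to all later ranks.\<close>

lemma cut_bounds:
  assumes \<theta>: "decreasing_weights \<theta>" "decreasing_weights \<theta>'" and agree: "\<forall>i\<le>k. \<theta>' i = \<theta> i"
    and "\<theta>' (Suc k) \<le> \<epsilon>"
  shows "bounded_cost (\<lambda>j. weight \<theta>' j - (if j \<in> blk k then weight \<theta> j else 0)) \<epsilon>"
proof (rule bounded_costI)
  fix j
  have "\<epsilon> > 0" using \<theta>(2) assms(4) by (metis decreasing_weights_def less_le_trans)
  let ?b = "(1 / 2) ^ Suc (int_encode j) / \<beta> (j - 1)"
  have b: "?b > 0" by (rule base_weight_pos)
  show "\<bar>weight \<theta>' j - (if j \<in> blk k then weight \<theta> j else 0)\<bar> \<le> \<epsilon> * ?b"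
  proof (cases "j \<in> blk k")
    case True
    then have "rk j \<le> k" by (simp add: rk_le_iff)
    then have "weight \<theta>' j = weight \<theta> j" using agree by (simp add: weight_def)
    then show ?thesis using True mult_pos_pos[OF \<open>\<epsilon> > 0\<close> b] by simp
  next
    case False
    then have "Suc k \<le> rk j" using rk_le_iff[of j k] by simp
    then have "\<theta>' (rk j) \<le> \<epsilon>"
      using \<theta>(2) assms(4) by (meson antimonoD decreasing_weights_def order_trans)
    then have "weight \<theta>' j \<le> \<epsilon> * ?b"
      unfolding weight_def by (intro mult_right_mono less_imp_le[OF b])
    then show ?thesis using False weight_bounds(1)[OF \<theta>(2), of j] by simp
  qed
qed

lemma cut_bounded_cost:
  assumes "decreasing_weights \<theta>"
  shows "bounded_cost (\<lambda>j. if j \<in> blk k then weight \<theta> j else 0) 1"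
proof (rule bounded_costI)
  fix j
  show "\<bar>if j \<in> blk k then weight \<theta> j else 0\<bar> \<le> 1 * ((1 / 2) ^ Suc (int_encode j) / \<beta> (j - 1))"
    using weight_bounds(2)[OF assms, of j] base_weight_pos[of j] by simp
qed

lemma transitive_step:
  assumes \<theta>: "decreasing_weights \<theta>"
  shows "\<exists>\<epsilon>>0. \<forall>\<theta>'. decreasing_weights \<theta>' \<longrightarrow> (\<forall>i\<le>2 * N + 1. \<theta>' i = \<theta> i) \<longrightarrow>
    \<theta>' (Suc (2 * N + 1)) \<le> \<epsilon> \<longrightarrow> transitive_at N (weight \<theta>')"
proof -
  obtain a where a: "\<forall>j. a j > 0" "\<forall>j. a (j - 1) = weight \<theta> j * a j"
    by (rule chain_scales_exist[OF weight_bounds(1)[OF \<theta>]])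
  define R :: nat where "R = 3 ^ N"
  have R: "R > 0" by (simp add: R_def)
  \<comment> \<open>The block has \<open>4 * R\<close> vectors, so its lower half, of length
    \<open>2 * R\<close>, runs from \<open>x (- R)\<close> to \<open>x (R - 1)\<close>: exactly the
    window of \<open>transitive_at\<close>.\<close>
  interpret shift_block smul w p x f \<beta> "weight \<theta>" a "int R" "3 * int R" "2 * R"
    by unfold_locales (use a R in auto)
  have blk: "blk (2 * N + 1) = {- int R<..<3 * int R}" by (simp add: blk_def R_def)
  have cut_eq: "cut = (\<lambda>j. if j \<in> blk (2 * N + 1) then weight \<theta> j else 0)"
    unfolding blk by (auto simp: cut_def)
  have cut: "bounded_cost cut 1" unfolding cut_eq by (rule cut_bounded_cost[OF \<theta>])
  \<comment> \<open>A vector with \<open>p s \<le> R\<close> has chain coefficients at most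
    \<open>R / a j\<close>; the sum dominates all of these.\<close>
  define M where "M = (\<Sum>i<2 * R. real R / a (int i - int R))"
  have M: "real R / a (int i - int R) \<le> M" if "i < 2 * R" for i
    unfolding M_def using that a(1) by (intro member_le_sum) (auto intro: less_imp_le)
  have "M \<ge> 0" unfolding M_def using a(1) by (intro sum_nonneg) (auto intro: less_imp_le)
  obtain n where n: "\<forall>c d. (\<forall>i<2 * R. norm (c i) \<le> M \<and> norm (d i) \<le> M) \<longrightarrow>
    (\<exists>z\<in>span (range x) \<inter> l1_ball (1 / (2 * real R)).
      (oper cut ^^ n) ((\<Sum>i<2 * R. smul (c i) (chain i)) + z) - (\<Sum>i<2 * R. smul (d i) (chain i))
        \<in> l1_ball (1 / (2 * real R)))"
    by (rule hypercyclic_block[OF cut _ \<open>M \<ge> 0\<close>, of "1 / (2 * real R)"]) (use R in auto)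
  \<comment> \<open>The perturbation may use half of the tolerance \<open>1 / R\<close>, the block
    having used the other half; \<open>R + 1\<close> bounds \<open>p (s + z)\<close>. The added 1
    covers \<open>n = 0\<close>.\<close>
  define \<epsilon> where "\<epsilon> = 1 / ((real n * 2 ^ n * (real R + 1) + 1) * (2 * real R))"
  have den: "real n * 2 ^ n * (real R + 1) + 1 > 0" by (intro add_nonneg_pos mult_nonneg_nonneg) auto
  have "\<epsilon> > 0" unfolding \<epsilon>_def using R den by (intro divide_pos_pos mult_pos_pos) auto
  have \<epsilon>: "real n * 2 ^ n * \<epsilon> * (real R + 1) \<le> 1 / (2 * real R)"
    using den R unfolding \<epsilon>_def by (simp add: divide_simps)
  have expand: "\<exists>c. (\<forall>i<2 * R. norm (c i) \<le> M) \<and> s = (\<Sum>i<2 * R. smul (c i) (chain i))"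
    if "s = (\<Sum>j\<in>{- (3 ^ N)..<3 ^ N}. smul (f j s) (x j))" "p s \<le> 3 ^ N" for s
  proof (intro exI conjI allI impI)
    define c where "c i = f (int i - int R) s / of_real (a (int i - int R))" for i
    show "norm (c i) \<le> M" if "i < 2 * R" for i
    proof -
      have "norm (c i) \<le> real R / a (int i - int R)"
        using order_trans[OF f_le[of "int i - int R" s] \<open>p s \<le> 3 ^ N\<close>] a(1)
        by (simp add: c_def norm_divide divide_right_mono less_imp_le abs_of_pos R_def)
      then show ?thesis using M[OF that] by simp
    qed
    have "{- (3 ^ N)..<3 ^ N} = {- int R..<int R}" by (simp add: R_def)
    then have "(\<Sum>j\<in>{- (3 ^ N)..<3 ^ N}. smul (f j s) (x j)) =
        (\<Sum>i<2 * R. smul (f (int i - int R) s) (x (int i - int R)))"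
      by (simp only:) (rule sum.reindex_bij_witness[of _ "\<lambda>i. int i - int R" "\<lambda>j. nat (j + int R)"], auto)
    also have "\<dots> = (\<Sum>i<2 * R. smul (c i) (chain i))"
      using a(1) by (intro sum.cong)
        (auto simp: c_def chain_def less_imp_neq[THEN not_sym] simp flip: smul_of_real)
    finally show "s = (\<Sum>i<2 * R. smul (c i) (chain i))" using that(1) by simp
  qed
  have "transitive_at N (weight \<theta>')"
    if \<theta>': "decreasing_weights \<theta>'" "\<forall>i\<le>2 * N + 1. \<theta>' i = \<theta> i" "\<theta>' (Suc (2 * N + 1)) \<le> \<epsilon>" for \<theta>'
    unfolding transitive_at_def
  proof (intro exI allI impI)
    fix s y
    have diff: "bounded_cost (\<lambda>j. weight \<theta>' j - cut j) \<epsilon>"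
      unfolding cut_eq by (rule cut_bounds[OF \<theta> \<theta>'])
    assume s: "s = (\<Sum>j\<in>{- (3 ^ N)..<3 ^ N}. smul (f j s) (x j))" "p s \<le> 3 ^ N"
      and y: "y = (\<Sum>j\<in>{- (3 ^ N)..<3 ^ N}. smul (f j y) (x j))" "p y \<le> 3 ^ N"
    obtain c where c: "\<forall>i<2 * R. norm (c i) \<le> M" "s = (\<Sum>i<2 * R. smul (c i) (chain i))"
      using expand[OF s] by blast
    obtain d where d: "\<forall>i<2 * R. norm (d i) \<le> M" "y = (\<Sum>i<2 * R. smul (d i) (chain i))"
      using expand[OF y] by blast
    have "\<exists>z\<in>span (range x) \<inter> l1_ball (1 / (2 * real R)).
        (oper cut ^^ n) (s + z) - y \<in> l1_ball (1 / (2 * real R))"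
      unfolding c(2) d(2) by (rule n[rule_format]) (use c(1) d(1) in simp)
    then obtain z where z: "z \<in> span (range x)" "z \<in> l1_ball (1 / (2 * real R))"
      "(oper cut ^^ n) (s + z) - y \<in> l1_ball (1 / (2 * real R))"
      by blast
    have "p (s + z) \<le> real R + 1"
    proof -
      have "1 / (2 * real R) \<le> 1" using R by simp
      then have "p z \<le> 1" using p_ball[OF z(2)] by simp
      then show ?thesis using seminorm_add[OF p(1), of s z] s(2) by (simp add: R_def)
    qed
    then have "real n * 2 ^ n * \<epsilon> * p (s + z) \<le> real n * 2 ^ n * \<epsilon> * (real R + 1)"
      using \<open>\<epsilon> > 0\<close> by (intro mult_left_mono) auto
    then have le: "real n * 2 ^ n * \<epsilon> * p (s + z) \<le> 1 / (2 * real R)" using \<epsilon> by simp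
    have "(oper (weight \<theta>') ^^ n) (s + z) - (oper cut ^^ n) (s + z) \<in> l1_ball (real n * 2 ^ n * \<epsilon> * p (s + z))"
      by (rule oper_perturb[OF weight_bounded_cost[OF \<theta>'(1)] cut diff less_imp_le[OF \<open>\<epsilon> > 0\<close>]])
    then have "(oper (weight \<theta>') ^^ n) (s + z) - (oper cut ^^ n) (s + z) \<in> l1_ball (1 / (2 * real R))"
      using le by (rule l1_ball_mono)
    from l1_ball_add[OF this z(3)]
    have "(oper (weight \<theta>') ^^ n) (s + z) - y \<in> l1_ball (1 / 3 ^ N)"
      by (simp add: R_def)
    moreover have "z \<in> l1_ball (1 / 3 ^ N)"
      by (rule l1_ball_mono[OF z(2)]) (simp add: R_def field_simps)
    ultimately show "\<exists>z\<in>span (range x) \<inter> l1_ball (1 / 3 ^ N).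
        (oper (weight \<theta>') ^^ n) (s + z) - y \<in> l1_ball (1 / 3 ^ N)"
      using z(1) by blast
  qed
  then show ?thesis using \<open>\<epsilon> > 0\<close> by blast
qed

lemma obstructed_step:
  assumes \<theta>: "decreasing_weights \<theta>"
  shows "\<exists>\<epsilon>>0. \<forall>\<theta>'. decreasing_weights \<theta>' \<longrightarrow> (\<forall>i\<le>2 * N. \<theta>' i = \<theta> i) \<longrightarrow>
    \<theta>' (Suc (2 * N)) \<le> \<epsilon> \<longrightarrow> obstructed_at N (weight \<theta>')"
proof -
  obtain a where a: "\<forall>j. a j > 0" "\<forall>j. a (j - 1) = weight \<theta> j * a j"
    by (rule chain_scales_exist[OF weight_bounds(1)[OF \<theta>]])
  define R :: nat where "R = 3 ^ N"
  have R: "R > 0" by (simp add: R_def)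
  \<comment> \<open>In the symmetric block \<open>f 0\<close> has cochain index
    \<open>R - 1\<close>, just below \<open>D = R\<close>.\<close>
  interpret shift_block smul w p x f \<beta> "weight \<theta>" a "int R" "int R" R
    by unfold_locales (use a R in auto)
  have blk: "blk (2 * N) = {- int R<..<int R}" by (simp add: blk_def R_def)
  have cut_eq: "cut = (\<lambda>j. if j \<in> blk (2 * N) then weight \<theta> j else 0)"
    unfolding blk by (auto simp: cut_def)
  have cut: "bounded_cost cut 1" unfolding cut_eq by (rule cut_bounded_cost[OF \<theta>])
  define \<eta> where "\<eta> = 1 / (2 * (1 + p (x 0)))"
  have \<eta>: "\<eta> > 0" "\<eta> \<le> 1 / 2" using p_nonneg[of "x 0"] by (auto simp: \<eta>_def)
  have "nat (int R - 1) < R" using R by simp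
  then obtain n G where n: "n \<ge> N" and G: "linear_functional G" "\<forall>z. norm (G z - f 0 z) \<le> \<eta> * p z"
    "\<forall>z. norm (G ((oper cut ^^ n) z)) \<le> \<eta> * p z"
    by (rule dual_block[OF _ \<eta>(1)])
  \<comment> \<open>The deviation of the powers is at most \<open>p z / 4\<close>; as
    \<open>G\<close> is bounded by \<open>2 * p\<close>, it contributes \<open>p z / 2\<close>, and
    the truncated operator contributes at most the other half.\<close>
  define \<epsilon> where "\<epsilon> = 1 / (4 * (real n * 2 ^ n + 1))"
  have den: "real n * 2 ^ n + 1 > 0" by (intro add_nonneg_pos) auto
  have "\<epsilon> > 0" unfolding \<epsilon>_def using den by simp
  have \<epsilon>: "real n * 2 ^ n * \<epsilon> \<le> 1 / 4"
    using den unfolding \<epsilon>_def by (simp add: divide_simps)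
  have G2: "norm (G z) \<le> 2 * p z" for z
  proof -
    have "norm (G z) \<le> norm (f 0 z) + norm (G z - f 0 z)" by (metis add.commute diff_add_cancel norm_triangle_ineq)
    also have "\<dots> \<le> p z + 1 / 2 * p z"
      using G(2)[rule_format, of z] mult_right_mono[OF \<eta>(2) p_nonneg[of z]] f_le[of 0 z] by simp
    finally show ?thesis using p_nonneg[of z] by simp
  qed
  have "obstructed_at N (weight \<theta>')"
    if \<theta>': "decreasing_weights \<theta>'" "\<forall>i\<le>2 * N. \<theta>' i = \<theta> i" "\<theta>' (Suc (2 * N)) \<le> \<epsilon>" for \<theta>'
  proof -
    have diff: "bounded_cost (\<lambda>j. weight \<theta>' j - cut j) \<epsilon>"
      unfolding cut_eq by (rule cut_bounds[OF \<theta> \<theta>'])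
    have "norm (G ((oper (weight \<theta>') ^^ n) z)) \<le> p z" for z
    proof -
      define t where "t = (oper (weight \<theta>') ^^ n) z - (oper cut ^^ n) z"
      have "t \<in> l1_ball (real n * 2 ^ n * \<epsilon> * p z)"
        unfolding t_def
        by (rule oper_perturb[OF weight_bounded_cost[OF \<theta>'(1)] cut diff less_imp_le[OF \<open>\<epsilon> > 0\<close>]])
      then have "p t \<le> 1 / 4 * p z"
        using p_ball mult_right_mono[OF \<epsilon> p_nonneg[of z]] by (meson order_trans)
      then have "norm (G t) \<le> 1 / 2 * p z" using G2[of t] by simp
      moreover have "norm (G ((oper cut ^^ n) z)) \<le> 1 / 2 * p z"
        using G(3)[rule_format, of z] mult_right_mono[OF \<eta>(2) p_nonneg[of z]] by simp
      moreover have "G ((oper (weight \<theta>') ^^ n) z) = G t + G ((oper cut ^^ n) z)"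
        unfolding linear_functional_add[OF G(1), symmetric] by (simp add: t_def)
      ultimately show ?thesis
        using norm_triangle_ineq[of "G t" "G ((oper cut ^^ n) z)"] by simp
    qed
    then show ?thesis
      unfolding obstructed_at_def using n G(1,2) by (auto simp: \<eta>_def)
  qed
  then show ?thesis using \<open>\<epsilon> > 0\<close> by blast
qed

lemma good_weights_exist:
  obtains \<omega> where "bounded_cost \<omega> 1" "\<forall>N. transitive_at N \<omega>" "\<forall>N. obstructed_at N \<omega>"
proof -
  define C where "C k \<theta> = (if odd k then transitive_at (k div 2) (weight \<theta>) else obstructed_at (k div 2) (weight \<theta>))"
    for k \<theta>
  have "\<exists>\<theta>. decreasing_weights \<theta> \<and> (\<forall>k. C k \<theta>)"
  proof (rule decreasing_weights_selection)
    fix k \<theta> assume \<theta>: "decreasing_weights \<theta>"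
    show "\<exists>\<epsilon>>0. \<forall>\<theta>'. decreasing_weights \<theta>' \<longrightarrow> (\<forall>i\<le>k. \<theta>' i = \<theta> i) \<longrightarrow> \<theta>' (Suc k) \<le> \<epsilon> \<longrightarrow> C k \<theta>'"
    proof (cases "odd k")
      case True
      then obtain N where "k = 2 * N + 1" by (rule oddE)
      then show ?thesis using transitive_step[OF \<theta>, of N] by (simp add: C_def)
    next
      case False
      then obtain N where "k = 2 * N" by (auto elim: evenE)
      then show ?thesis using obstructed_step[OF \<theta>, of N] by (simp add: C_def)
    qed
  qed
  then obtain \<theta> where \<theta>: "decreasing_weights \<theta>" "\<And>k. C k \<theta>" by blast
  have "transitive_at N (weight \<theta>)" for N using \<theta>(2)[of "2 * N + 1"] by (simp add: C_def)
  moreover have "obstructed_at N (weight \<theta>)" for N using \<theta>(2)[of "2 * N"] by (simp add: C_def)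
  ultimately show ?thesis using weight_bounded_cost[OF \<theta>(1)] by (intro that[of "weight \<theta>"]) auto
qed

section \<open>From the stages to non-mixing and transitivity\<close>

lemma not_mixing:
  assumes obstructed: "\<forall>N. obstructed_at N \<omega>"
  shows "\<not> mixing (oper \<omega>)"
proof
  assume mixing: "mixing (oper \<omega>)"
  define \<eta> where "\<eta> = 1 / (2 * (1 + p (x 0)))"
  have px: "1 + p (x 0) > 0" using p_nonneg[of "x 0"] by simp
  \<comment> \<open>Replacing \<open>f 0\<close> by \<open>G\<close> costs at most
    \<open>\<eta> * p\<close>, the very term subtracted in \<open>V\<close>. A vector of
    \<open>U\<close> moved into \<open>V\<close> would thus have \<open>G\<close>-value above 1,
    although \<open>G\<close> composed with the power is bounded by \<open>p < 1\<close>.\<close>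
  define U V where "U = {z. p z < 1}" and "V = {z. norm (f 0 z) - \<eta> * p z > 1}"
  have "open U"
    using open_seminorm_ball[OF p(2), of 0 1] by (simp add: U_def)
  moreover have "0 \<in> U" by (simp add: U_def seminorm_zero[OF p(1)])
  moreover have "continuous_on UNIV (f 0)"
    by (rule bounded_functional_continuous[OF p linear_functional_diff[OF f_linear] f_le])
  then have "open V"
    unfolding V_def by (intro open_Collect_less continuous_intros p)
  \<comment> \<open>The choice of \<open>\<eta>\<close> gives
    \<open>\<eta> * p (x 0) \<le> 1 / 2\<close>, so the factor 3 leaves at least
    \<open>3 - 3 / 2 > 1\<close>.\<close>
  moreover have "3 *\<^sub>R x 0 \<in> V"
  proof -
    have "norm (f 0 (3 *\<^sub>R x 0)) = 3"
      using linear_functional_scale[OF f_linear, of 0 "of_real 3" "x 0"]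
      by (simp add: smul_of_real biorthogonal del: of_real_numeral)
    moreover have "\<eta> * p (3 *\<^sub>R x 0) \<le> 3 / 2"
      using px by (simp add: \<eta>_def seminorm_scaleR[OF p(1)] field_simps)
    ultimately show ?thesis by (simp add: V_def)
  qed
  ultimately obtain r where r: "\<And>n. n > r \<Longrightarrow> (oper \<omega> ^^ n) ` U \<inter> V \<noteq> {}"
    using mixing unfolding mixing_def by (metis empty_iff)
  obtain n G where n: "n \<ge> Suc r" and G: "linear_functional G" "\<forall>z. norm (G z - f 0 z) \<le> \<eta> * p z"
    "\<forall>z. norm (G ((oper \<omega> ^^ n) z)) \<le> p z"
    using obstructed unfolding obstructed_at_def \<eta>_def by blast
  obtain u where u: "u \<in> U" "(oper \<omega> ^^ n) u \<in> V" using r[of n] n by auto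
  let ?v = "(oper \<omega> ^^ n) u"
  have "norm (f 0 ?v) \<le> norm (G ?v) + norm (G ?v - f 0 ?v)"
    using norm_triangle_ineq4[of "G ?v" "G ?v - f 0 ?v"] by simp
  also have "\<dots> \<le> p u + \<eta> * p ?v" using G(2,3) by (intro add_mono) auto
  finally show False using u by (simp add: U_def V_def)
qed

lemma transitive:
  assumes trans: "\<forall>N. transitive_at N \<omega>" and s: "s \<in> span (range x)" and y: "y \<in> span (range x)" and "\<eta> > 0"
  shows "\<exists>n. \<exists>z\<in>span (range x) \<inter> l1_ball \<eta>. (oper \<omega> ^^ n) (s + z) - y \<in> l1_ball \<eta>"
proof -
  obtain J where J: "finite J" "\<forall>J'. finite J' \<longrightarrow> J \<subseteq> J' \<longrightarrow> s = (\<Sum>j\<in>J'. smul (f j s) (x j))"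
    by (rule span_expansion[OF s])
  obtain L where L: "finite L" "\<forall>J'. finite J' \<longrightarrow> L \<subseteq> J' \<longrightarrow> y = (\<Sum>j\<in>J'. smul (f j y) (x j))"
    by (rule span_expansion[OF y])
  define i1 i2 i3 where "i1 = nat \<lceil>p s\<rceil>" and "i2 = nat \<lceil>p y\<rceil>" and "i3 = nat \<lceil>1 / \<eta>\<rceil>"
  \<comment> \<open>Since \<open>m < 3 ^ m\<close>, this one number makes the window contain both
    supports and makes \<open>3 ^ m\<close> exceed \<open>p s\<close>, \<open>p y\<close> and
    \<open>1 / \<eta>\<close>.\<close>
  define m where "m = nat (\<Sum>j\<in>J \<union> L. \<bar>j\<bar>) + i1 + i2 + i3"
  have m: "m < 3 ^ m" by (rule less_le_trans[OF less_exp]) (simp add: power_mono)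
  then have mR: "real m < 3 ^ m" by (metis of_nat_less_iff of_nat_numeral of_nat_power)
  have "j \<in> {- (3 ^ m)..<3 ^ m}" if "j \<in> J \<union> L" for j
  proof -
    have "\<bar>j\<bar> \<le> (\<Sum>j\<in>J \<union> L. \<bar>j\<bar>)" using that J(1) L(1) by (intro member_le_sum) auto
    also have "\<dots> = int (nat (\<Sum>j\<in>J \<union> L. \<bar>j\<bar>))" by (simp add: sum_nonneg)
    also have "\<dots> \<le> int m" unfolding m_def of_nat_le_iff by simp
    finally have "\<bar>j\<bar> \<le> int m" .
    moreover have "int m < 3 ^ m" using m by (metis of_nat_less_iff of_nat_numeral of_nat_power)
    ultimately have "- (3 ^ m) \<le> j" "j < 3 ^ m" by linarith+
    then show ?thesis by simp
  qed
  then have sub: "J \<subseteq> {- (3 ^ m)..<3 ^ m}" "L \<subseteq> {- (3 ^ m)..<3 ^ m}" by blast+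
  have "real i1 \<le> real m" "real i2 \<le> real m" "real i3 \<le> real m"
    unfolding of_nat_le_iff by (simp_all add: m_def)
  moreover have "p s \<le> real i1" "p y \<le> real i2" "1 / \<eta> \<le> real i3"
    unfolding i1_def i2_def i3_def by (rule real_nat_ceiling_ge)+
  ultimately have "p s \<le> 3 ^ m" "p y \<le> 3 ^ m" "1 / \<eta> \<le> 3 ^ m"
    using mR by linarith+
  moreover from this have "1 / 3 ^ m \<le> \<eta>" using \<open>\<eta> > 0\<close> by (simp add: field_simps)
  ultimately show ?thesis
    using trans[rule_format, of m] J(2)[rule_format, OF _ sub(1)] L(2)[rule_format, OF _ sub(2)]
    unfolding transitive_at_def by (blast intro: l1_ball_mono)
qed

end

subsection \<open>Hypercyclic vectors\<close>

context weighted_shift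
begin

lemma countable_dense_combinations:
  fixes K :: "'k set"
  assumes K: "countable K" "\<forall>U. open U \<longrightarrow> U \<noteq> {} \<longrightarrow> (\<exists>d\<in>K. d \<in> U)"
  obtains Q where "countable Q" "Q \<subseteq> span (range x)" "closure Q = UNIV"
proof -
  define comb where "comb m d = (\<Sum>i<m. smul (d i) (x (int_decode i)))" for m and d :: "nat \<Rightarrow> 'k"
  define Q where "Q = (\<lambda>L. comb (length L) ((!) L)) ` lists K"
  have "countable Q" unfolding Q_def by (intro countable_image countable_lists K)
  moreover have "Q \<subseteq> span (range x)"
    unfolding Q_def comb_def by (intro image_subsetI span_sum span_scale span_base) simp
  moreover have "closure Q = UNIV"
  proof -
    have "\<exists>q\<in>Q. q \<in> U" if U: "open U" "U \<noteq> {}" for U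
    proof -
      obtain s where s: "s \<in> span (range x)" "s \<in> U"
        using closure_UNIV_open_meets[OF dense U] by blast
      obtain J where J: "finite J" "\<forall>J'. finite J' \<longrightarrow> J \<subseteq> J' \<longrightarrow> s = (\<Sum>j\<in>J'. smul (f j s) (x j))"
        by (rule span_expansion[OF s(1)])
      obtain m where m: "\<forall>i\<in>int_encode ` J. i < m"
        using finite_nat_set_iff_bounded[of "int_encode ` J"] J(1) by blast
      then have sub: "J \<subseteq> int_decode ` {..<m}"
        by (auto intro!: image_eqI[where x = "int_encode _"])
      define c where "c i = f (int_decode i) s" for i
      have "s = (\<Sum>j\<in>int_decode ` {..<m}. smul (f j s) (x j))" using J(2) sub by blast
      also have "\<dots> = comb m c"
        unfolding comb_def c_def by (subst sum.reindex) (auto simp: inj_on_def int_decode_eq)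
      finally have sc: "s = comb m c" .
      have "open ((\<lambda>z. s - z) -` U)" by (intro open_vimage[OF U(1)] continuous_intros)
      moreover have "0 \<in> (\<lambda>z. s - z) -` U" using s(2) by simp
      ultimately obtain e where e: "e > 0" "l1_ball e \<subseteq> (\<lambda>z. s - z) -` U"
        by (rule l1_ball_in_neighbourhood)
      \<comment> \<open>Each of the \<open>m\<close> coordinates receives an error of at most
        \<open>e / Suc m\<close>; the successor covers the empty combination.\<close>
      define \<delta> where "\<delta> i = e / (real (Suc m) * \<beta> (int_decode i))" for i
      have \<delta>: "\<delta> i > 0" for i
        unfolding \<delta>_def using e(1) \<beta>_pos by (intro divide_pos_pos mult_pos_pos) auto
      have "\<exists>d\<in>K. d \<in> ball (c i) (\<delta> i)" for i
        using \<delta>[of i] by (intro K(2)[rule_format]) auto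
      then obtain d where d: "\<And>i. d i \<in> K" "\<And>i. d i \<in> ball (c i) (\<delta> i)" by metis
      have "comb m c - comb m d = (\<Sum>i<m. smul (c i - d i) (x (int_decode i)))"
        by (simp add: comb_def scale_left_diff_distrib sum_subtractf)
      also have "\<dots> \<in> l1_ball (\<Sum>i<m. norm (c i - d i) * \<beta> (int_decode i))"
        by (intro l1_ball_sum l1_ball_scale x_ball) simp
      finally have "comb m c - comb m d \<in> l1_ball e"
      proof (rule l1_ball_mono)
        have "(\<Sum>i<m. norm (c i - d i) * \<beta> (int_decode i)) \<le> (\<Sum>i<m. e / real (Suc m))"
        proof (rule sum_mono)
          fix i
          have "norm (c i - d i) * \<beta> (int_decode i) \<le> \<delta> i * \<beta> (int_decode i)"
            using d(2)[of i] \<beta>_pos[of "int_decode i"] by (intro mult_right_mono) (auto simp: dist_norm)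
          then show "norm (c i - d i) * \<beta> (int_decode i) \<le> e / real (Suc m)"
            using \<beta>_pos[of "int_decode i"] by (simp add: \<delta>_def)
        qed
        also have "\<dots> \<le> e" using e(1) by (simp add: field_simps)
        finally show "(\<Sum>i<m. norm (c i - d i) * \<beta> (int_decode i)) \<le> e" .
      qed
      then have "s - (comb m c - comb m d) \<in> U" using e(2) by blast
      then have "comb m d \<in> U" by (simp add: sc)
      moreover have "comb m d \<in> Q"
      proof -
        have eq: "comb m d = comb (length (map d [0..<m])) ((!) (map d [0..<m]))"
          unfolding comb_def by (intro sum.cong) auto
        have mem: "map d [0..<m] \<in> lists K" using d(1) by auto
        show ?thesis unfolding Q_def
          by (rule image_eqI[where f = "\<lambda>L. comb (length L) ((!) L)", OF eq mem])
      qed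
      ultimately show ?thesis by blast
    qed
    then have "U \<inter> Q \<noteq> {}" if "open U" "U \<noteq> {}" for U using that by blast
    from this[of "- closure Q"] show ?thesis
      using closure_subset[of Q] by (auto simp: open_Compl)
  qed
  ultimately show ?thesis using that by blast
qed

lemma hypercyclic_oper:
  fixes K :: "'k set"
  assumes \<omega>: "bounded_cost \<omega> 1"
    and trans: "\<And>s y \<eta>. s \<in> span (range x) \<Longrightarrow> y \<in> span (range x) \<Longrightarrow> \<eta> > 0 \<Longrightarrow>
      \<exists>n. \<exists>z\<in>span (range x) \<inter> l1_ball \<eta>. (oper \<omega> ^^ n) (s + z) - y \<in> l1_ball \<eta>"
    and Q: "countable Q" "Q \<subseteq> span (range x)" "closure Q = UNIV"
  shows "hypercyclic (oper \<omega>)"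
proof -
  let ?V = "span (range x)" and ?T = "oper \<omega>"
  have "Q \<noteq> {}" using Q(3) by auto
  \<comment> \<open>Decoding pairs makes every member of \<open>Q\<close> a target infinitely often,
    hence with arbitrarily small tolerance.\<close>
  define y where "y k = from_nat_into Q (fst (prod_decode k))" for k
  have y: "y k \<in> ?V" for k
    using from_nat_into[OF \<open>Q \<noteq> {}\<close>] Q(2) unfolding y_def by blast
  \<comment> \<open>\<open>h\<close> bounds the next correction, and halving keeps the sum of all
    remaining ones within \<open>2 * h\<close>. The bound on \<open>2 ^ n * h'\<close> protects the
    approximation reached at time \<open>n\<close>.\<close>
  let ?R = "\<lambda>k (s, h :: real) (s', h'). s' - s \<in> l1_ball h \<and> h' \<le> h / 2 \<and>
    (\<exists>n. (?T ^^ n) s' - y k \<in> l1_ball (inverse (real (Suc k))) \<and> 2 ^ n * h' \<le> inverse (real (Suc k)))"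
  have "\<exists>F. \<forall>k. (fst (F k) \<in> ?V \<and> snd (F k) > 0) \<and> ?R k (F k) (F (Suc k))"
  proof (rule dependent_nat_choice)
    show "\<exists>q. fst q \<in> ?V \<and> snd q > (0::real)"
      by (intro exI[of _ "(0, 1)"]) (simp add: span_zero)
  next
    fix q :: "'a \<times> real" and k
    assume q: "fst q \<in> ?V \<and> snd q > 0"
    define \<eta> where "\<eta> = min (snd q) (inverse (real (Suc k)))"
    have "\<eta> > 0" using q by (simp add: \<eta>_def)
    then obtain n z where z: "z \<in> ?V" "z \<in> l1_ball \<eta>" "(?T ^^ n) (fst q + z) - y k \<in> l1_ball \<eta>"
      using trans[of "fst q" "y k" \<eta>] q y by blast
    define h where "h = min (snd q / 2) (inverse (real (Suc k)) / 2 ^ n)"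
    have "h > 0" using q by (simp add: h_def)
    moreover have "2 ^ n * h \<le> inverse (real (Suc k))"
      unfolding h_def by (rule order_trans[OF mult_left_mono[OF min.cobounded2]]) simp_all
    moreover have "h \<le> snd q / 2" unfolding h_def by (rule min.cobounded1)
    moreover have "fst q + z \<in> ?V" using q z(1) by (simp add: span_add)
    moreover have "z \<in> l1_ball (snd q)" by (rule l1_ball_mono[OF z(2)]) (simp add: \<eta>_def)
    moreover have "(?T ^^ n) (fst q + z) - y k \<in> l1_ball (inverse (real (Suc k)))"
      by (rule l1_ball_mono[OF z(3)]) (simp add: \<eta>_def)
    ultimately show "\<exists>q'. (fst q' \<in> ?V \<and> snd q' > 0) \<and> ?R k q q'"
      by (intro exI[of _ "(fst q + z, h)"]) (auto simp: case_prod_beta)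
  qed
  then obtain F where F: "\<forall>k. (fst (F k) \<in> ?V \<and> snd (F k) > 0) \<and> ?R k (F k) (F (Suc k))" by blast
  define s h where "s k = fst (F k)" and "h k = snd (F k)" for k
  have h: "h k > 0" "h (Suc k) \<le> h k / 2" and s: "s (Suc k) - s k \<in> l1_ball (h k)"
    and near: "\<exists>n. (?T ^^ n) (s (Suc k)) - y k \<in> l1_ball (inverse (real (Suc k))) \<and>
      2 ^ n * h (Suc k) \<le> inverse (real (Suc k))" for k
    using F by (auto simp: s_def h_def case_prod_beta)
  have h_le: "h (l + m) \<le> h m * (1 / 2) ^ l" for l m
  proof (induction l)
    case (Suc l)
    then show ?case using h(2)[of "l + m"] by simp
  qed simp
  have geom: "(\<lambda>l. h m * (1 / 2) ^ l) sums (h m * 2)" for m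
    using geometric_sums[of "1 / 2 :: real"] by (intro sums_mult) simp
  have tail: "summable (\<lambda>l. s (Suc (l + m)) - s (l + m))"
    "(\<Sum>l. s (Suc (l + m)) - s (l + m)) \<in> l1_ball (h m * 2)" for m
  proof -
    have "s (Suc (l + m)) - s (l + m) \<in> l1_ball (h m * (1 / 2) ^ l)" for l
      by (rule l1_ball_mono[OF s h_le])
    note 1 = l1_ball_suminf[of "\<lambda>l. s (Suc (l + m)) - s (l + m)", OF this sums_summable[OF geom]]
    show "summable (\<lambda>l. s (Suc (l + m)) - s (l + m))" by (rule 1)
    show "(\<Sum>l. s (Suc (l + m)) - s (l + m)) \<in> l1_ball (h m * 2)"
      using 1(2) sums_unique[OF geom[of m]] by simp
  qed
  define v where "v = s 0 + (\<Sum>l. s (Suc l) - s l)"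
  have "(\<lambda>n. s 0 + (\<Sum>l<n. s (Suc l) - s l)) \<longlonglongrightarrow> v"
    unfolding v_def using tail(1)[of 0] by (intro tendsto_intros summable_LIMSEQ) simp
  then have sv: "s \<longlonglongrightarrow> v" by (simp add: sum_lessThan_telescope)
  have v_tail: "v - s m \<in> l1_ball (h m * 2)" for m
  proof -
    have "(\<lambda>n. s (n + m) - s m) \<longlonglongrightarrow> v - s m"
      by (intro tendsto_intros LIMSEQ_ignore_initial_segment sv)
    moreover have "(\<Sum>l<n. s (Suc (l + m)) - s (l + m)) = s (n + m) - s m" for n
      using sum_lessThan_telescope[of "\<lambda>l. s (l + m)" n] by simp
    ultimately have "(\<lambda>l. s (Suc (l + m)) - s (l + m)) sums (v - s m)" by (simp add: sums_def)
    then show ?thesis using tail(2)[of m] by (simp add: sums_iff)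
  qed
  \<comment> \<open>One unit of error stems from stage \<open>k\<close>, two from the image of the
    remaining tail \<open>v - s (Suc k)\<close>.\<close>
  have approx: "\<exists>n. (?T ^^ n) v - y k \<in> l1_ball (3 * inverse (real (Suc k)))" for k
  proof -
    obtain n where n: "(?T ^^ n) (s (Suc k)) - y k \<in> l1_ball (inverse (real (Suc k)))"
      "2 ^ n * h (Suc k) \<le> inverse (real (Suc k))"
      using near by blast
    have "(?T ^^ n) (v - s (Suc k)) \<in> l1_ball (2 ^ n * (h (Suc k) * 2))"
      by (intro oper_pow_ball[OF \<omega>] v_tail)
    then have "(?T ^^ n) v - (?T ^^ n) (s (Suc k)) \<in> l1_ball (2 * inverse (real (Suc k)))"
      unfolding oper_pow_diff[OF \<omega>] by (rule l1_ball_mono) (use n(2) in simp)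
    from l1_ball_add[OF this n(1)] show ?thesis by (intro exI[of _ n]) simp
  qed
  have "\<exists>n. (?T ^^ n) v \<in> U" if U: "open U" "U \<noteq> {}" for U
  proof -
    obtain q where q: "q \<in> Q" "q \<in> U" using closure_UNIV_open_meets[OF Q(3) U] by blast
    have "open ((\<lambda>z. z + q) -` U)" by (intro open_vimage[OF U(1)] continuous_intros)
    moreover have "0 \<in> (\<lambda>z. z + q) -` U" using q(2) by simp
    ultimately obtain e where e: "e > 0" "l1_ball e \<subseteq> (\<lambda>z. z + q) -` U"
      by (rule l1_ball_in_neighbourhood)
    obtain i where i: "from_nat_into Q i = q" using from_nat_into_surj[OF Q(1) q(1)] by blast
    obtain m where m: "inverse (real (Suc m)) < e / 3" using reals_Archimedean[of "e / 3"] e(1) by auto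
    define k where "k = prod_encode (i, m)"
    have "y k = q" using i by (simp add: y_def k_def)
    moreover have "inverse (real (Suc k)) \<le> inverse (real (Suc m))"
      using le_prod_encode_2[of m i] by (simp add: k_def le_imp_inverse_le)
    then have "3 * inverse (real (Suc k)) \<le> e" using m by linarith
    moreover obtain n where "(?T ^^ n) v - y k \<in> l1_ball (3 * inverse (real (Suc k)))"
      using approx by blast
    ultimately have "(?T ^^ n) v - q \<in> l1_ball e" using l1_ball_mono by blast
    then have "(?T ^^ n) v - q + q \<in> U" using e(2) by blast
    then show ?thesis by auto
  qed
  from this[of "- closure (range (\<lambda>n. (?T ^^ n) v))"]
  have "closure (range (\<lambda>n. (?T ^^ n) v)) = UNIV"
    using closure_subset[of "range (\<lambda>n. (?T ^^ n) v)"] by (auto simp: open_Compl)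
  then show ?thesis unfolding hypercyclic_def by blast
qed

end

section \<open>Assembling the operator\<close>

lemma class_M_hypercyclic_non_mixing:
  fixes smul :: "'k::{real_normed_field, banach, second_countable_topology} \<Rightarrow>
    'a::{real_vector, topological_ab_group_add, t2_space} \<Rightarrow> 'a"
  assumes M: "class_M smul" and functionals: "hausdorff_lcs.enough_functionals smul"
  shows "\<exists>T\<in>continuous_linear_operators smul. hypercyclic T \<and> \<not> mixing T"
proof -
  obtain w where w: "hausdorff_lcs smul" "\<not> weak_topology smul" "l1_sequence smul w"
    "closure (module.span smul (range w)) = UNIV"
    using M by (auto simp: class_M_def)
  interpret hausdorff_lcs smul by (rule w)
  interpret l1_lcs smul w by unfold_locales (rule w)
  obtain p0 where p0: "seminorm p0" "continuous_on UNIV p0"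
    and infinite0: "\<forall>F. finite F \<longrightarrow> (\<forall>f\<in>F. linear_functional f \<and> continuous_on UNIV f) \<longrightarrow>
      (\<exists>x. (\<forall>f\<in>F. f x = 0) \<and> p0 x \<noteq> 0)"
    by (rule not_weak_infinite_seminorm[OF w(2) functionals])
  obtain C where C: "C > 0" "\<And>r x. x \<in> l1_ball r \<Longrightarrow> p0 x \<le> C * r"
    using l1_ball_seminorm_bound[OF p0] by blast
  \<comment> \<open>Division by \<open>C\<close> achieves the normalisation \<open>p_ball\<close>
    without changing the null space, so the infinite-dimensional quotient persists.\<close>
  define p where "p z = 1 / C * p0 z" for z
  have p: "seminorm p" "continuous_on UNIV p"
    unfolding p_def using C(1) p0 by (auto intro!: seminorm_scaled[of p0 "1 / C", simplified] continuous_intros)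
  have p_ball: "p z \<le> r" if "z \<in> l1_ball r" for z r
    using C(2)[OF that] C(1) by (simp add: p_def field_simps)
  have infinite: "\<forall>F. finite F \<longrightarrow> (\<forall>f\<in>F. linear_functional f \<and> continuous_on UNIV f) \<longrightarrow>
      (\<exists>x. (\<forall>f\<in>F. f x = 0) \<and> p x \<noteq> 0)"
    using infinite0 C(1) by (simp add: p_def)
  obtain x :: "nat \<Rightarrow> 'a" and f where x: "\<forall>i. linear_functional (f i)" "\<forall>i z. norm (f i z) \<le> p z"
    "\<forall>i j. f i (x j) = of_bool (i = j)" "\<forall>i. x i \<in> span (range w)" "closure (span (range x)) = UNIV"
    by (rule biorthogonal_system[OF p infinite functionals w(4)])
  have "\<forall>j. \<exists>r. r > 0 \<and> x (int_encode j) \<in> l1_ball r" using span_in_l1_ball x(4) by blast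
  from choice[OF this] obtain \<beta> where \<beta>: "\<forall>j. \<beta> j > 0 \<and> x (int_encode j) \<in> l1_ball (\<beta> j)" ..
  \<comment> \<open>Biorthogonality and density do not depend on the order of the vectors, so the
    sequence may be indexed by the integers through any bijection.\<close>
  have "range (\<lambda>j. x (int_encode j)) = range x"
    by (metis (no_types) bij_int_encode bij_is_surj image_image)
  then interpret weighted_shift smul w p "\<lambda>j. x (int_encode j)" "\<lambda>j. f (int_encode j)" \<beta>
    by unfold_locales (use p p_ball x \<beta> in
      \<open>simp_all add: int_encode_eq linear_functional_add linear_functional_scale\<close>)
  obtain \<omega> where \<omega>: "bounded_cost \<omega> 1" "\<forall>N. transitive_at N \<omega>" "\<forall>N. obstructed_at N \<omega>"
    by (rule good_weights_exist)
  obtain K :: "'k set" where K: "countable K" "\<forall>U. open U \<longrightarrow> U \<noteq> {} \<longrightarrow> (\<exists>d\<in>K. d \<in> U)"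
    using countable_dense_exists by blast
  obtain Q where Q: "countable Q" "Q \<subseteq> span (range (\<lambda>j. x (int_encode j)))" "closure Q = UNIV"
    by (rule countable_dense_combinations[OF K])
  have "hypercyclic (oper \<omega>)"
    by (rule hypercyclic_oper[OF \<omega>(1) transitive[OF \<omega>(2)] Q])
  moreover have "\<not> mixing (oper \<omega>)" by (rule not_mixing[OF \<omega>(3)])
  moreover have "oper \<omega> \<in> continuous_linear_operators smul"
    by (simp add: continuous_linear_operators_def oper_linear[OF \<omega>(1)] oper_continuous[OF \<omega>(1)])
  ultimately show ?thesis by blast
qed

theorem theorem1p6:
  fixes rscale :: "real \<Rightarrow> 'a::{real_vector, topological_ab_group_add, t2_space} \<Rightarrow> 'a"
    and cscale :: "complex \<Rightarrow> 'b::{real_vector, topological_ab_group_add, t2_space} \<Rightarrow> 'b"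
  shows "(class_M rscale \<longrightarrow>
      (\<exists>T\<in>continuous_linear_operators rscale. hypercyclic T \<and> \<not> mixing T)) \<and>
    (class_M cscale \<longrightarrow>
      (\<exists>T\<in>continuous_linear_operators cscale. hypercyclic T \<and> \<not> mixing T))"
proof (intro conjI impI)
  assume M: "class_M rscale"
  then have "hausdorff_lcs rscale" by (simp add: class_M_def)
  then show "\<exists>T\<in>continuous_linear_operators rscale. hypercyclic T \<and> \<not> mixing T"
    by (intro class_M_hypercyclic_non_mixing[OF M] enough_functionals_real)
next
  assume M: "class_M cscale"
  then have "hausdorff_lcs cscale" by (simp add: class_M_def)
  then show "\<exists>T\<in>continuous_linear_operators cscale. hypercyclic T \<and> \<not> mixing T"
    by (intro class_M_hypercyclic_non_mixing[OF M] enough_functionals_complex)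
qed

end
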